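(* For every univariate polynomial $P\in\mathbb{R}[x]$, the dimension spectrum of its graph, $\mathrm{sp}(S)=\{\dim(x,P(x)) : x\in\mathbb{R}\}$ where $S=\{(x,P(x)):x\in\mathbb{R}\}$, contains at least two points.
   Context: Fix a universal prefix Turing machine $U$ and a binary encoding of tuples of rationals by finite binary strings. $K(q)$ denotes the prefix Kolmogorov complexity of (the encoding of) $q$, i.e. the length of a shortest program $\pi$ on which $U$ outputs $q$. For $z\in\mathbb{R}^m$ and $r\in\mathbb{N}$, $K_r(z)=\min\{K(q): q\in\mathbb{Q}^m\cap B(z,2^{-r})\}$, where $B(z,\rho)$ is the open Euclidean ball of radius $\rho$ about $z$. The effective Hausdorff dimension of $z\in\mathbb{R}^m$ is $\dim(z)=\liminf_{r\to\infty}K_r(z)/r$. For $S\subseteq\mathbb{R}^n$, the dimension spectrum of $S$ is $\mathrm{sp}(S)=\{\dim(z): z\in S\}$. *)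

theory Defs
  imports
    "HOL-Analysis.Analysis"
    "HOL-Computational_Algebra.Polynomial"
    "HOL-Library.Sublist"
begin

section \<open>Turing machines\<close>

text \<open>
  Deterministic machines with finitely many two-way infinite tapes. States and tape symbols are
  initial segments of the naturals: state 0 is the start state, symbol 0 is the blank, and symbols
  1 and 2 are the bits 0 and 1. A machine halts when its transition function is undefined
  (\<open>None\<close>) at the current state and scanned symbols.
\<close>

datatype move = Move_Left | Stay | Move_Right

record turing_machine =
  num_tapes :: nat
  num_states :: nat
  num_symbols :: nat
  transition :: "nat \<Rightarrow> nat list \<Rightarrow> (nat \<times> (nat \<times> move) list) option"

text \<open>
  Only the finitely many values of \<open>transition\<close> on legal states and symbols matter; by
  well-formedness a run from a legal configuration never consults any other value.
\<close>

definition wf_tm :: "turing_machine \<Rightarrow> bool" where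
  "wf_tm M \<longleftrightarrow>
     num_tapes M \<ge> 1 \<and> num_states M \<ge> 1 \<and> num_symbols M \<ge> 3 \<and>
     (\<forall>q ss q' acts.
        q < num_states M \<and> length ss = num_tapes M \<and> (\<forall>s \<in> set ss. s < num_symbols M) \<and>
        transition M q ss = Some (q', acts) \<longrightarrow>
        q' < num_states M \<and> length acts = num_tapes M \<and>
        (\<forall>a \<in> set acts. fst a < num_symbols M))"

text \<open>A tape is its cell contents together with the head position.\<close>

type_synonym tape = "(int \<Rightarrow> nat) \<times> int"
type_synonym config = "nat \<times> tape list"

fun shift :: "move \<Rightarrow> int" where
  "shift Move_Left = - 1"
| "shift Stay = 0"
| "shift Move_Right = 1"

definition scanned :: "tape \<Rightarrow> nat" where
  "scanned t = fst t (snd t)"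

definition act :: "tape \<Rightarrow> nat \<times> move \<Rightarrow> tape" where
  "act t a = ((fst t)(snd t := fst a), snd t + shift (snd a))"

definition step :: "turing_machine \<Rightarrow> config \<Rightarrow> config option" where
  "step M c =
     (case transition M (fst c) (map scanned (snd c)) of
        None \<Rightarrow> None
      | Some (q', acts) \<Rightarrow> Some (q', map2 act (snd c) acts))"

definition bit_symbol :: "bool \<Rightarrow> nat" where
  "bit_symbol b = (if b then 2 else 1)"

definition input_tape :: "bool list \<Rightarrow> tape" where
  "input_tape x =
     ((\<lambda>i. if 0 \<le> i \<and> nat i < length x then bit_symbol (x ! nat i) else 0), 0)"

definition initial_config :: "turing_machine \<Rightarrow> bool list \<Rightarrow> config" where
  "initial_config M x = (0, input_tape x # replicate (num_tapes M - 1) (input_tape []))"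

text \<open>
  The word on a tape is the maximal block of bits starting at cell 0, so that every halting
  computation has exactly one output.
\<close>

definition tape_word :: "tape \<Rightarrow> bool list \<Rightarrow> bool" where
  "tape_word t y \<longleftrightarrow>
     (\<forall>i < length y. fst t (int i) = bit_symbol (y ! i)) \<and>
     fst t (int (length y)) \<notin> range bit_symbol"

text \<open>The input is on the first tape, the output on the last one.\<close>

definition tm_output :: "turing_machine \<Rightarrow> bool list \<Rightarrow> bool list \<Rightarrow> bool" where
  "tm_output M x y \<longleftrightarrow>
     (\<exists>c. (\<lambda>c c'. step M c = Some c')\<^sup>*\<^sup>* (initial_config M x) c \<and>
          step M c = None \<and> tape_word (last (snd c)) y)"

definition tm_domain :: "turing_machine \<Rightarrow> bool list set" where
  "tm_domain M = {x. \<exists>y. tm_output M x y}"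

definition prefix_free :: "'a list set \<Rightarrow> bool" where
  "prefix_free A \<longleftrightarrow> (\<forall>x \<in> A. \<forall>y \<in> A. prefix x y \<longrightarrow> x = y)"

definition prefix_tm :: "turing_machine \<Rightarrow> bool" where
  "prefix_tm M \<longleftrightarrow> wf_tm M \<and> prefix_free (tm_domain M)"

definition universal_prefix_tm :: "turing_machine \<Rightarrow> bool" where
  "universal_prefix_tm U \<longleftrightarrow>
     prefix_tm U \<and>
     (\<forall>M. prefix_tm M \<longrightarrow>
        (\<exists>\<sigma>. \<forall>\<pi> y. tm_output U (\<sigma> @ \<pi>) y \<longleftrightarrow> tm_output M \<pi> y))"


section \<open>Binary encoding of tuples of rationals\<close>

text \<open>
  Binary digits, least significant first, each announced by \<open>True\<close>; \<open>False\<close> marks the end.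
  The code is self-delimiting, so concatenations of codes can be split again.
\<close>

fun nat_code :: "nat \<Rightarrow> bool list" where
  "nat_code n = (if n = 0 then [False] else True # odd n # nat_code (n div 2))"

declare nat_code.simps [simp del]

definition rat_code :: "rat \<Rightarrow> bool list" where
  "rat_code q =
     (let (a, b) = quotient_of q in (a < 0) # nat_code (nat \<bar>a\<bar>) @ nat_code (nat b))"

text \<open>
  The order on the index type only fixes the order in which the components are listed. In the
  type \<open>2\<close> the index \<open>2\<close> equals \<open>0\<close> and therefore precedes \<open>1\<close>.
\<close>

definition tuple_code :: "rat ^ 'm::{finite,linorder} \<Rightarrow> bool list" where
  "tuple_code q = concat (map (\<lambda>i. rat_code (q $ i)) (sorted_list_of_set UNIV))"


section \<open>Kolmogorov complexity and effective dimension\<close>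

text \<open>The complexity measures below are minima of sets of naturals, written with \<open>LEAST\<close>.\<close>

definition kolmogorov :: "turing_machine \<Rightarrow> rat ^ 'm::{finite,linorder} \<Rightarrow> nat" where
  "kolmogorov U q = (LEAST n. \<exists>\<pi>. tm_output U \<pi> (tuple_code q) \<and> n = length \<pi>)"

definition real_vec :: "rat ^ 'm::finite \<Rightarrow> real ^ 'm" where
  "real_vec q = (\<chi> i. of_rat (q $ i))"

definition kolmogorov_at ::
    "turing_machine \<Rightarrow> nat \<Rightarrow> real ^ 'm::{finite,linorder} \<Rightarrow> nat" where
  "kolmogorov_at U r z =
     (LEAST n. \<exists>q :: rat ^ 'm::{finite,linorder}.
        real_vec q \<in> ball z (1 / 2 ^ r) \<and> n = kolmogorov U q)"

definition eff_dim :: "turing_machine \<Rightarrow> real ^ 'm::{finite,linorder} \<Rightarrow> ereal" where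
  "eff_dim U z = liminf (\<lambda>r. ereal (real (kolmogorov_at U r z) / real r))"

definition dim_spectrum ::
    "turing_machine \<Rightarrow> (real ^ 'm::{finite,linorder}) set \<Rightarrow> ereal set" where
  "dim_spectrum U S = eff_dim U ` S"

definition poly_graph :: "real poly \<Rightarrow> (real ^ 2) set" where
  "poly_graph P = {vector [x, poly P x] | x. True}"

end

theory Submission
  imports Defs "HOL-Library.Nat_Bijection"
begin

text \<open>
  Write \<open>z\<close> for the point \<open>(0, P(0))\<close> of the graph. Its first coordinate carries no information, so
  its dimension is at most 1 (\<open>dimension_above_zero_le\<close>). It is enough to find a point of the
  graph of larger dimension.

  Let \<open>d\<close> be the degree of \<open>P\<close> and \<open>a\<close> a large multiple of \<open>d + 1\<close>. At precision \<open>a * n\<close> cut the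
  plane into vertical columns of width \<open>2 ^ - (a * n)\<close> and look at those over \<open>[1, 2]\<close> that
  contain, close to the graph, a rational point of complexity at most \<open>(a + 1) * n\<close>
  (\<open>low_columns\<close>).

  If from some \<open>n\<close> on there are fewer than \<open>2 ^ ((a - 1) * n)\<close> such columns, then the neighbourhoods
  of these columns for all large \<open>n\<close> together have measure below 1. Some \<open>x\<close> in \<open>[1, 2]\<close> avoids
  them, and its point on the graph has dimension at least \<open>1 + 1 / (2 * a) > 1\<close>
  (\<open>few_columns_dimension_ge\<close>).

  Otherwise there are at least \<open>2 ^ ((a - 1) * n)\<close> such columns for infinitely many \<open>n\<close>. Any \<open>d + 1\<close> well
  separated low-complexity points near the graph give an approximation of \<open>P(0)\<close> by Lagrange
  interpolation. Let every separated list of \<open>d + 1\<close> low-complexity points, near the graph or not,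
  vote for the value it interpolates at 0. The approximation of \<open>P(0)\<close> receives a proportion
  \<open>2 ^ - O(n * (d + 1))\<close> of all votes (\<open>popular_near\<close>), and since every list votes only once, at most
  \<open>2 ^ O(n * (d + 1))\<close> values are that popular (\<open>card_popular\<close>). The popular values can be
  enumerated by running all short programs, so the approximation of \<open>P(0)\<close> is described by its
  rank among them and their number. This takes far fewer than \<open>a * n\<close> bits, and the dimension of \<open>z\<close> is at most 1/2
  (\<open>many_columns_dimension_le\<close>), whereas a counting argument gives a point of the graph of
  dimension at least 5/8 (\<open>generic_dimension\<close>).

  All upper bounds on complexity come from one machine scheme (\<open>payload_program\<close>): a search over a
  primitive recursive predicate whose input is self-delimiting at a cost of lower order. To
  reach Turing machines, primitive recursive functions are run on a small register language, and
  that language is compiled to multi-tape machines in which a register is a head position. In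
  the other direction the universal machine is simulated by a primitive recursive function
  (\<open>sim_output\<close>), so that its programs can be enumerated (\<open>enumeration_program\<close>).
\<close>


section \<open>Primitive recursive functions\<close>

definition ppair :: "nat \<Rightarrow> nat \<Rightarrow> nat" where "ppair a b = prod_encode (a, b)"
definition pfst :: "nat \<Rightarrow> nat" where "pfst z = fst (prod_decode z)"
definition psnd :: "nat \<Rightarrow> nat" where "psnd z = snd (prod_decode z)"

lemma pfst_ppair [simp]: "pfst (ppair a b) = a"
  and psnd_ppair [simp]: "psnd (ppair a b) = b"
  and ppair_collapse [simp]: "ppair (pfst z) (psnd z) = z"
  and ppair_eq_iff [simp]: "ppair a b = ppair a' b' \<longleftrightarrow> a = a' \<and> b = b'"
  by (simp_all add: ppair_def pfst_def psnd_def)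

text \<open>
  Pairing doubles the number of bits, up to two more; this measures payloads that carry several
  numbers.
\<close>

lemma ppair_less:
  assumes "a < 2 ^ L" and "b < 2 ^ L"
  shows "ppair a b < 2 ^ (2 * L + 2)"
proof -
  have "a + b < 2 * 2 ^ L" using assms by linarith
  then have "(a + b) * Suc (a + b) \<le> (2 * 2 ^ L) * (2 * 2 ^ L)"
    by (intro mult_le_mono) auto
  then have "triangle (a + b) \<le> 2 * (2 ^ L * 2 ^ L)"
    unfolding triangle_def by simp
  moreover have "a < 2 ^ L * 2 ^ L"
    using assms(1) by (metis less_le_trans mult.right_neutral mult_le_mono2 one_le_numeral one_le_power)
  moreover have "(2 :: nat) ^ (2 * L + 2) = 4 * (2 ^ L * 2 ^ L)"
    by (simp add: power_add mult_2)
  ultimately show ?thesis by (simp add: ppair_def prod_encode_def)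
qed

text \<open>
  Unary functions suffice because Cantor pairing packs several arguments into one, and plain
  iteration then yields the recursion scheme. In this form every clause is realised by a short
  register program that works in place, on the registers from a given one upwards.
\<close>

inductive prim_rec :: "(nat \<Rightarrow> nat) \<Rightarrow> bool" where
  zero: "prim_rec (\<lambda>x. 0)"
| Suc: "prim_rec Suc"
| fst: "prim_rec pfst"
| snd: "prim_rec psnd"
| pair: "prim_rec f \<Longrightarrow> prim_rec g \<Longrightarrow> prim_rec (\<lambda>x. ppair (f x) (g x))"
| comp: "prim_rec f \<Longrightarrow> prim_rec g \<Longrightarrow> prim_rec (\<lambda>x. f (g x))"
| iter: "prim_rec f \<Longrightarrow> prim_rec (\<lambda>x. (f ^^ pfst x) (psnd x))"

named_theorems pr_intros

lemma pr_id [pr_intros]: "prim_rec (\<lambda>x. x)"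
  using prim_rec.pair[OF prim_rec.fst prim_rec.snd] by simp

lemma pr_Suc [pr_intros]: "prim_rec f \<Longrightarrow> prim_rec (\<lambda>x. Suc (f x))"
  and pr_pfst [pr_intros]: "prim_rec f \<Longrightarrow> prim_rec (\<lambda>x. pfst (f x))"
  and pr_psnd [pr_intros]: "prim_rec f \<Longrightarrow> prim_rec (\<lambda>x. psnd (f x))"
  by (rule prim_rec.comp, rule prim_rec.intros, assumption)+

lemmas pr_ppair [pr_intros] = prim_rec.pair

lemma pr_const [pr_intros]: "prim_rec (\<lambda>x. c)"
  by (induction c) (auto intro: prim_rec.zero pr_Suc)

lemma pr_comp2:
  assumes "prim_rec (\<lambda>z. F (pfst z) (psnd z))" "prim_rec f" "prim_rec g"
  shows "prim_rec (\<lambda>x. F (f x) (g x))"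
  using prim_rec.comp[OF assms(1) prim_rec.pair[OF assms(2,3)]] by simp

lemma pr_comp3:
  assumes "prim_rec (\<lambda>z. F (pfst z) (pfst (psnd z)) (psnd (psnd z)))" "prim_rec f" "prim_rec g" "prim_rec h"
  shows "prim_rec (\<lambda>x. F (f x) (g x) (h x))"
  using prim_rec.comp[OF assms(1) prim_rec.pair[OF assms(2) prim_rec.pair[OF assms(3,4)]]] by simp

text \<open>
  The environment \<open>x\<close> is carried along as the second component of the iterated pair.
\<close>

lemma pr_funpow:
  assumes F: "prim_rec (\<lambda>z. F (pfst z) (psnd z))" and n: "prim_rec n" and s: "prim_rec s"
  shows "prim_rec (\<lambda>x. ((\<lambda>v. F v x) ^^ n x) (s x))"
proof -
  define G where "G z = ppair (F (pfst z) (psnd z)) (psnd z)" for z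
  have "prim_rec G" unfolding G_def by (intro pr_intros F)
  moreover have G: "(G ^^ k) (ppair v x) = ppair (((\<lambda>v. F v x) ^^ k) v) x" for k v x
    by (induction k) (auto simp: G_def)
  ultimately have "prim_rec (\<lambda>x. (G ^^ n x) (ppair (s x) x))"
    using prim_rec.comp[OF prim_rec.iter pr_ppair[OF n pr_ppair[OF s pr_id]], of G] by simp
  then have "prim_rec (\<lambda>x. pfst ((G ^^ n x) (ppair (s x) x)))" by (rule pr_pfst)
  then show ?thesis by (simp add: G)
qed

lemma pr_rec_nat:
  assumes S: "prim_rec (\<lambda>w. S (pfst w) (pfst (psnd w)) (psnd (psnd w)))" and n: "prim_rec n" and z: "prim_rec z"
  shows "prim_rec (\<lambda>x. rec_nat (z x) (\<lambda>m a. S m a x) (n x))"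
proof -
  define G where "G v x = ppair (Suc (pfst v)) (S (pfst v) (psnd v) x)" for v x
  have "prim_rec (\<lambda>w. G (pfst w) (psnd w))" unfolding G_def
    by (intro pr_intros pr_comp3[of S, OF S])
  then have "prim_rec (\<lambda>x. ((\<lambda>v. G v x) ^^ n x) (ppair 0 (z x)))"
    by (intro pr_funpow pr_intros n z)
  then have "prim_rec (\<lambda>x. psnd (((\<lambda>v. G v x) ^^ n x) (ppair 0 (z x))))" by (rule pr_psnd)
  moreover have "((\<lambda>v. G v x) ^^ k) (ppair 0 a) = ppair k (rec_nat a (\<lambda>m a. S m a x) k)" for x k a
    by (induction k) (auto simp: G_def)
  ultimately show ?thesis by simp
qed

lemma pr_add [pr_intros]: assumes "prim_rec f" "prim_rec g" shows "prim_rec (\<lambda>x. f x + g x)"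
proof -
  have "(Suc ^^ n) m = m + n" for n m by (induction n) auto
  moreover have "prim_rec (\<lambda>x. ((\<lambda>v. Suc v) ^^ g x) (f x))" by (intro pr_funpow pr_intros assms)
  ultimately show ?thesis by (simp add: add.commute)
qed

lemma pr_pred: assumes "prim_rec f" shows "prim_rec (\<lambda>x. f x - 1)"
proof -
  have "rec_nat 0 (\<lambda>m a. m) n = n - 1" for n by (cases n) auto
  moreover have "prim_rec (\<lambda>x. rec_nat 0 (\<lambda>m a. m) (f x))"
    by (intro pr_rec_nat pr_intros assms)
  ultimately show ?thesis by simp
qed

lemma pr_diff [pr_intros]: assumes "prim_rec f" "prim_rec g" shows "prim_rec (\<lambda>x. f x - g x)"
proof -
  have "((\<lambda>v. v - 1) ^^ n) m = m - n" for n m :: nat by (induction n) auto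
  moreover have "prim_rec (\<lambda>x. ((\<lambda>v. v - 1) ^^ g x) (f x))" by (intro pr_funpow pr_pred pr_intros assms)
  ultimately show ?thesis by simp
qed

lemma pr_mult [pr_intros]: assumes "prim_rec f" "prim_rec g" shows "prim_rec (\<lambda>x. f x * g x)"
proof -
  have "((\<lambda>v. v + m) ^^ n) 0 = m * n" for n m :: nat by (induction n) auto
  moreover have "prim_rec (\<lambda>x. ((\<lambda>v. v + f x) ^^ g x) 0)"
    by (intro pr_funpow[where F="\<lambda>v x. v + f x"] pr_intros prim_rec.comp[OF assms(1)] assms)
  ultimately show ?thesis by simp
qed

lemma pr_power [pr_intros]: assumes "prim_rec f" "prim_rec g" shows "prim_rec (\<lambda>x. f x ^ g x)"
proof -
  have "((\<lambda>v. v * m) ^^ n) 1 = m ^ n" for n m :: nat by (induction n) auto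
  moreover have "prim_rec (\<lambda>x. ((\<lambda>v. v * f x) ^^ g x) 1)"
    by (intro pr_funpow[where F="\<lambda>v x. v * f x"] pr_intros prim_rec.comp[OF assms(1)] assms)
  ultimately show ?thesis by simp
qed

definition prim_rec_pred :: "(nat \<Rightarrow> bool) \<Rightarrow> bool" where "prim_rec_pred P \<longleftrightarrow> prim_rec (\<lambda>x. of_bool (P x))"

lemma pr_of_bool [pr_intros]: "prim_rec_pred P \<Longrightarrow> prim_rec (\<lambda>x. of_bool (P x))"
  by (simp add: prim_rec_pred_def)

lemma prp_comp: "prim_rec_pred P \<Longrightarrow> prim_rec f \<Longrightarrow> prim_rec_pred (\<lambda>x. P (f x))"
  unfolding prim_rec_pred_def by (rule prim_rec.comp)

lemma prp_const [pr_intros]: "prim_rec_pred (\<lambda>x. c)"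
  unfolding prim_rec_pred_def by (rule pr_const)

lemma prp_not [pr_intros]: assumes "prim_rec_pred P" shows "prim_rec_pred (\<lambda>x. \<not> P x)"
proof -
  have "prim_rec (\<lambda>x. 1 - of_bool (P x))" by (intro pr_intros assms)
  then show ?thesis unfolding prim_rec_pred_def by (rule back_subst[of prim_rec]) auto
qed

lemma prp_conj [pr_intros]: assumes "prim_rec_pred P" "prim_rec_pred Q" shows "prim_rec_pred (\<lambda>x. P x \<and> Q x)"
proof -
  have "prim_rec (\<lambda>x. of_bool (P x) * of_bool (Q x))" by (intro pr_intros assms)
  then show ?thesis unfolding prim_rec_pred_def by (rule back_subst[of prim_rec]) auto
qed

lemma prp_disj [pr_intros]: assumes "prim_rec_pred P" "prim_rec_pred Q" shows "prim_rec_pred (\<lambda>x. P x \<or> Q x)"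
proof -
  have "prim_rec_pred (\<lambda>x. \<not> (\<not> P x \<and> \<not> Q x))" by (intro pr_intros assms)
  then show ?thesis by simp
qed

lemma prp_le [pr_intros]: assumes "prim_rec f" "prim_rec g" shows "prim_rec_pred (\<lambda>x. f x \<le> g x)"
proof -
  have "prim_rec (\<lambda>x. 1 - (f x - g x))" by (intro pr_intros assms)
  then show ?thesis unfolding prim_rec_pred_def by (rule back_subst[of prim_rec]) auto
qed

lemma prp_less [pr_intros]: assumes "prim_rec f" "prim_rec g" shows "prim_rec_pred (\<lambda>x. f x < g x)"
proof -
  have "prim_rec_pred (\<lambda>x. Suc (f x) \<le> g x)" by (intro pr_intros assms)
  then show ?thesis by (simp add: Suc_le_eq)
qed

lemma prp_eq [pr_intros]: assumes "prim_rec f" "prim_rec g" shows "prim_rec_pred (\<lambda>x. f x = g x)"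
proof -
  have "prim_rec_pred (\<lambda>x. f x \<le> g x \<and> g x \<le> f x)" by (intro pr_intros assms)
  then show ?thesis by (rule back_subst[of prim_rec_pred]) auto
qed

lemma pr_if [pr_intros]: assumes "prim_rec_pred P" "prim_rec f" "prim_rec g" shows "prim_rec (\<lambda>x. if P x then f x else g x)"
proof -
  have "prim_rec (\<lambda>x. of_bool (P x) * f x + (1 - of_bool (P x)) * g x)" by (intro pr_intros assms)
  then show ?thesis by (rule back_subst[of prim_rec]) auto
qed

lemma pr_sum [pr_intros]:
  assumes F: "prim_rec (\<lambda>z. F (pfst z) (psnd z))" and b: "prim_rec b"
  shows "prim_rec (\<lambda>x. \<Sum>i<b x. F i x)"
proof -
  have "prim_rec (\<lambda>x. rec_nat 0 (\<lambda>m a. a + F m x) (b x))"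
    by (intro pr_rec_nat[where S="\<lambda>m a x. a + F m x"] pr_intros pr_comp2[of F, OF F] b)
  moreover have "rec_nat 0 (\<lambda>m a. a + F m x) k = (\<Sum>i<k. F i x)" for x k
    by (induction k) auto
  ultimately show ?thesis by simp
qed

lemma pr_card [pr_intros]:
  assumes "prim_rec_pred (\<lambda>z. P (pfst z) (psnd z))" and "prim_rec b"
  shows "prim_rec (\<lambda>x. card {i. i < b x \<and> P i x})"
proof -
  have "prim_rec (\<lambda>x. \<Sum>i<b x. of_bool (P i x))" by (intro pr_intros assms)
  moreover have "(\<Sum>i<b x. of_bool (P i x)) = card {i. i < b x \<and> P i x}" for x
    by (simp add: of_bool_def sum.If_cases Int_def lessThan_def)
  ultimately show ?thesis by simp
qed

lemma prp_ex [pr_intros]: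
  assumes "prim_rec_pred (\<lambda>z. P (pfst z) (psnd z))" and "prim_rec b"
  shows "prim_rec_pred (\<lambda>x. \<exists>i<b x. P i x)"
proof -
  have "prim_rec_pred (\<lambda>x. 0 < card {i. i < b x \<and> P i x})" by (intro pr_intros assms)
  then show ?thesis by (rule back_subst[of prim_rec_pred]) (auto simp: card_gt_0_iff)
qed

lemma prp_all [pr_intros]:
  assumes "prim_rec_pred (\<lambda>z. P (pfst z) (psnd z))" and "prim_rec b"
  shows "prim_rec_pred (\<lambda>x. \<forall>i<b x. P i x)"
proof -
  have "prim_rec_pred (\<lambda>x. \<not> (\<exists>i<b x. \<not> P i x))" by (intro pr_intros assms)
  then show ?thesis by (rule back_subst[of prim_rec_pred]) auto
qed

lemma prp_ball_const:
  assumes "\<And>i. i \<in> set is \<Longrightarrow> prim_rec_pred (P i)"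
  shows "prim_rec_pred (\<lambda>x. \<forall>i\<in>set is. P i x)"
  using assms by (induction "is") (auto intro!: pr_intros)

lemma pr_div [pr_intros]: assumes "prim_rec f" "prim_rec g" shows "prim_rec (\<lambda>x. f x div g x)"
proof -
  have *: "prim_rec (\<lambda>x. if g x = 0 then 0 else \<Sum>i<f x. of_bool (Suc i * g x \<le> f x))"
    by (intro pr_intros prim_rec.comp[OF assms(1)] prim_rec.comp[OF assms(2)] assms)
  moreover have "(\<Sum>i<m. of_bool (Suc i * n \<le> m)) = m div n" if "n \<noteq> 0" for m n :: nat
  proof -
    have "{i. i < m \<and> Suc i * n \<le> m} = {..<m div n}"
    proof (intro set_eqI)
      fix i
      have "Suc i * n \<le> m \<longleftrightarrow> Suc i \<le> m div n" using that by (simp add: less_eq_div_iff_mult_less_eq)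
      moreover have "m div n \<le> m" by simp
      ultimately show "i \<in> {i. i < m \<and> Suc i * n \<le> m} \<longleftrightarrow> i \<in> {..<m div n}"
        unfolding mem_Collect_eq lessThan_iff by linarith
    qed
    then show ?thesis by (simp add: of_bool_def sum.If_cases Int_def lessThan_def)
  qed
  ultimately have "(if g x = 0 then 0 else \<Sum>i<f x. of_bool (Suc i * g x \<le> f x)) = f x div g x" for x
    by (cases "g x = 0") (simp_all del: mult_Suc)
  then show ?thesis using * by simp
qed

lemma pr_mod [pr_intros]: assumes "prim_rec f" "prim_rec g" shows "prim_rec (\<lambda>x. f x mod g x)"
proof -
  have "prim_rec (\<lambda>x. f x - (f x div g x) * g x)" by (intro pr_intros assms)
  then show ?thesis by (simp add: minus_div_mult_eq_mod)
qed

text \<open>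
  This makes the transition table of a Turing machine primitive recursive.
\<close>

lemma pr_finite_support:
  assumes "finite A" and "\<And>x. x \<notin> A \<Longrightarrow> f x = c"
  shows "prim_rec f"
  using assms
proof (induction A arbitrary: f)
  case empty
  then have "f = (\<lambda>x. c)" by auto
  then show ?case by (simp add: pr_const)
next
  case (insert a A)
  have "prim_rec (f(a := c))" by (rule insert.IH) (use insert in auto)
  then have "prim_rec (\<lambda>x. if x = a then f a else (f(a := c)) x)" by (intro pr_intros)
  then show ?case by (rule back_subst[of prim_rec]) auto
qed


section \<open>A structured register language compiled to Turing machines\<close>

text \<open>
  \<open>Cond\<close> and \<open>While\<close> test whether a register is nonzero. \<open>Read c d\<close> consumes the rest of the
  input and runs \<open>c\<close> after each bit 1 and \<open>d\<close> after each bit 0.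
\<close>

datatype com =
    Inc nat | Dec nat | Out bool | Seq com com | Cond nat com com | While nat com | Read com com

type_synonym store = "(nat \<Rightarrow> nat) \<times> bool list \<times> bool list"

inductive exec :: "com \<Rightarrow> store \<Rightarrow> store \<Rightarrow> bool" where
  Inc: "exec (Inc i) (e, x, y) (e(i := Suc (e i)), x, y)"
| Dec: "exec (Dec i) (e, x, y) (e(i := e i - 1), x, y)"
| Out: "exec (Out b) (e, x, y) (e, x, y @ [b])"
| Seq: "exec c s s' \<Longrightarrow> exec d s' s'' \<Longrightarrow> exec (Seq c d) s s''"
| CondT: "fst s i \<noteq> 0 \<Longrightarrow> exec c s s' \<Longrightarrow> exec (Cond i c d) s s'"
| CondF: "fst s i = 0 \<Longrightarrow> exec d s s' \<Longrightarrow> exec (Cond i c d) s s'"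
| WhileT: "fst s i \<noteq> 0 \<Longrightarrow> exec c s s' \<Longrightarrow> exec (While i c) s' s'' \<Longrightarrow> exec (While i c) s s''"
| WhileF: "fst s i = 0 \<Longrightarrow> exec (While i c) s s"
| ReadB: "exec (if b then c else d) (e, x, y) s' \<Longrightarrow> exec (Read c d) s' s'' \<Longrightarrow>
          exec (Read c d) (e, b # x, y) s''"
| ReadE: "exec (Read c d) (e, [], y) (e, [], y)"

text \<open>
  Code with absolute jump targets, one machine step per instruction. \<open>IJz\<close> jumps if the register
  is zero. \<open>IRead\<close> falls through on a bit 1, jumps to its first target on a bit 0 and to its
  second target at the end of the input.
\<close>

datatype instr =
    IInc nat | IDec nat | IOut bool | IJz nat nat | IJmp nat | IRead nat nat

fun csize :: "com \<Rightarrow> nat" where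
  "csize (Seq c d) = csize c + csize d"
| "csize (Cond i c d) = csize c + csize d + 2"
| "csize (While i c) = csize c + 2"
| "csize (Read c d) = csize c + csize d + 3"
| "csize _ = 1"

fun compile :: "nat \<Rightarrow> com \<Rightarrow> instr list" where
  "compile p (Inc i) = [IInc i]"
| "compile p (Dec i) = [IDec i]"
| "compile p (Out b) = [IOut b]"
| "compile p (Seq c d) = compile p c @ compile (p + csize c) d"
| "compile p (Cond i c d) =
     IJz i (p + csize c + 2) # compile (p + 1) c @
     IJmp (p + csize c + csize d + 2) # compile (p + csize c + 2) d"
| "compile p (While i c) = IJz i (p + csize c + 2) # compile (p + 1) c @ [IJmp p]"
| "compile p (Read c d) =
     IRead (p + csize c + 2) (p + csize c + csize d + 3) # compile (p + 1) c @
     IJmp p # compile (p + csize c + 2) d @ [IJmp p]"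

lemma length_compile [simp]: "length (compile p c) = csize c"
  by (induction c arbitrary: p) auto

fun flat_step :: "instr \<Rightarrow> nat \<times> store \<Rightarrow> nat \<times> store" where
  "flat_step (IInc i) (p, e, x, y) = (Suc p, e(i := Suc (e i)), x, y)"
| "flat_step (IDec i) (p, e, x, y) = (Suc p, e(i := e i - 1), x, y)"
| "flat_step (IOut b) (p, e, x, y) = (Suc p, e, x, y @ [b])"
| "flat_step (IJz i l) (p, e, x, y) = (if e i = 0 then l else Suc p, e, x, y)"
| "flat_step (IJmp l) (p, e, x, y) = (l, e, x, y)"
| "flat_step (IRead lF lE) (p, e, x, y) =
     (case x of [] \<Rightarrow> (lE, e, x, y) | b # x' \<Rightarrow> (if b then Suc p else lF, e, x', y))"

definition flat_red :: "instr list \<Rightarrow> nat \<times> store \<Rightarrow> nat \<times> store \<Rightarrow> bool" where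
  "flat_red is k k' \<longleftrightarrow> fst k < length is \<and> k' = flat_step (is ! fst k) k"

lemma flat_red_at:
  assumes "is = pre @ i # post" and "p = length pre" and "flat_step i (p, s) = k"
  shows "flat_red is (p, s) k"
  using assms by (simp add: flat_red_def)

text \<open>
  The code around the command is arbitrary, so that the induction hypotheses apply to the parts
  of a command at their own addresses.
\<close>

lemma exec_compile:
  assumes "exec c s s'" and "is = pre @ compile (length pre) c @ post"
  shows "(flat_red is)\<^sup>*\<^sup>* (length pre, s) (length pre + csize c, s')"
  using assms
proof (induction arbitrary: "is" pre post rule: exec.induct)
  case (Inc i e x y)
  have "flat_red is (length pre, e, x, y) (length pre + 1, e(i := Suc (e i)), x, y)"
    by (rule flat_red_at[where i="IInc i"]) (use Inc in auto)
  then show ?case by auto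
next
  case (Dec i e x y)
  have "flat_red is (length pre, e, x, y) (length pre + 1, e(i := e i - 1), x, y)"
    by (rule flat_red_at[where i="IDec i"]) (use Dec in auto)
  then show ?case by auto
next
  case (Out b e x y)
  have "flat_red is (length pre, e, x, y) (length pre + 1, e, x, y @ [b])"
    by (rule flat_red_at[where i="IOut b"]) (use Out in auto)
  then show ?case by auto
next
  case (Seq c s s' d s'')
  have 1: "(flat_red is)\<^sup>*\<^sup>* (length pre, s) (length pre + csize c, s')"
    by (rule Seq.IH(1)) (use Seq.prems in simp)
  have "(flat_red is)\<^sup>*\<^sup>* (length (pre @ compile (length pre) c), s')
          (length (pre @ compile (length pre) c) + csize d, s'')"
    by (rule Seq.IH(2)) (use Seq.prems in simp)
  with 1 show ?case by (auto simp: add.assoc)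
next
  case (CondT s i c s' d)
  obtain e x y where s: "s = (e, x, y)" by (cases s)
  let ?p1 = "pre @ [IJz i (length pre + csize c + 2)]"
  have "flat_red is (length pre, s) (Suc (length pre), s)"
    by (rule flat_red_at[where i="IJz i (length pre + csize c + 2)"]) (use CondT in \<open>auto simp: s\<close>)
  moreover have "(flat_red is)\<^sup>*\<^sup>* (length ?p1, s) (length ?p1 + csize c, s')"
    by (rule CondT.IH) (use CondT.prems in simp)
  moreover have "flat_red is (length pre + 1 + csize c, s') (length pre + csize (Cond i c d), s')"
    by (rule flat_red_at[where pre="?p1 @ compile (length pre + 1) c"
          and i="IJmp (length pre + csize c + csize d + 2)"])
       (use CondT.prems in \<open>auto, cases s', auto\<close>)
  ultimately show ?case
    by (auto intro: converse_rtranclp_into_rtranclp rtranclp.rtrancl_into_rtrancl)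
next
  case (CondF s i d s' c)
  obtain e x y where s: "s = (e, x, y)" by (cases s)
  let ?p1 = "pre @ IJz i (length pre + csize c + 2) # compile (length pre + 1) c @
     [IJmp (length pre + csize c + csize d + 2)]"
  have "flat_red is (length pre, s) (length pre + csize c + 2, s)"
    by (rule flat_red_at[where i="IJz i (length pre + csize c + 2)"]) (use CondF in \<open>auto simp: s\<close>)
  moreover have "(flat_red is)\<^sup>*\<^sup>* (length ?p1, s) (length ?p1 + csize d, s')"
    by (rule CondF.IH) (use CondF.prems in simp)
  ultimately show ?case
    by (auto intro: converse_rtranclp_into_rtranclp simp: add_ac)
next
  case (WhileT s i c s' s'')
  obtain e x y where s: "s = (e, x, y)" by (cases s)
  let ?p1 = "pre @ [IJz i (length pre + csize c + 2)]"
  have "flat_red is (length pre, s) (Suc (length pre), s)"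
    by (rule flat_red_at[where i="IJz i (length pre + csize c + 2)"]) (use WhileT in \<open>auto simp: s\<close>)
  moreover have "(flat_red is)\<^sup>*\<^sup>* (length ?p1, s) (length ?p1 + csize c, s')"
    by (rule WhileT.IH(1)) (use WhileT.prems in simp)
  moreover have "flat_red is (length pre + 1 + csize c, s') (length pre, s')"
    by (rule flat_red_at[where pre="?p1 @ compile (length pre + 1) c" and i="IJmp (length pre)"])
       (use WhileT.prems in \<open>auto, cases s', auto\<close>)
  moreover have "(flat_red is)\<^sup>*\<^sup>* (length pre, s') (length pre + csize (While i c), s'')"
    by (rule WhileT.IH(2)) (use WhileT.prems in simp)
  ultimately show ?case
    by (auto intro: converse_rtranclp_into_rtranclp rtranclp_trans)
next
  case (WhileF s i c)
  obtain e x y where s: "s = (e, x, y)" by (cases s)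
  have "flat_red is (length pre, s) (length pre + csize (While i c), s)"
    by (rule flat_red_at[where i="IJz i (length pre + csize c + 2)"]) (use WhileF in \<open>auto simp: s\<close>)
  then show ?case by auto
next
  case (ReadB b c d e x y s' s'')
  let ?L = "IRead (length pre + csize c + 2) (length pre + csize c + csize d + 3)"
  let ?p1 = "pre @ [?L]"
  let ?p2 = "pre @ ?L # compile (length pre + 1) c @ [IJmp (length pre)]"
  have last: "(flat_red is)\<^sup>*\<^sup>* (length pre, s') (length pre + csize (Read c d), s'')"
    by (rule ReadB.IH(2)) (use ReadB.prems in simp)
  show ?case
  proof (cases b)
    case True
    have "flat_red is (length pre, e, b # x, y) (Suc (length pre), e, x, y)"
      by (rule flat_red_at[where i="?L"]) (use ReadB True in auto)
    moreover have "(flat_red is)\<^sup>*\<^sup>* (length ?p1, e, x, y) (length ?p1 + csize (if b then c else d), s')"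
      by (rule ReadB.IH(1)) (use ReadB.prems True in simp)
    moreover have "flat_red is (length pre + 1 + csize c, s') (length pre, s')"
      by (rule flat_red_at[where pre="?p1 @ compile (length pre + 1) c" and i="IJmp (length pre)"])
         (use ReadB.prems in \<open>auto, cases s', auto\<close>)
    ultimately show ?thesis using last True
      by (auto intro: converse_rtranclp_into_rtranclp rtranclp_trans)
  next
    case False
    have "flat_red is (length pre, e, b # x, y) (length pre + csize c + 2, e, x, y)"
      by (rule flat_red_at[where i="?L"]) (use ReadB False in auto)
    moreover have "(flat_red is)\<^sup>*\<^sup>* (length ?p2, e, x, y) (length ?p2 + csize (if b then c else d), s')"
      by (rule ReadB.IH(1)) (use ReadB.prems False in simp)
    moreover have "flat_red is (length pre + csize c + csize d + 2, s') (length pre, s')"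
      by (rule flat_red_at[where pre="?p2 @ compile (length pre + csize c + 2) d" and i="IJmp (length pre)"])
         (use ReadB.prems in \<open>auto, cases s', auto\<close>)
    ultimately show ?thesis using last False
      by (auto intro: converse_rtranclp_into_rtranclp rtranclp_trans simp: add_ac)
  qed
next
  case (ReadE c d e y)
  let ?L = "IRead (length pre + csize c + 2) (length pre + csize c + csize d + 3)"
  have "flat_red is (length pre, e, [], y) (length pre + csize (Read c d), e, [], y)"
    by (rule flat_red_at[where i="?L"]) (use ReadE in auto)
  then show ?case by auto
qed

text \<open>
  The round trip takes at least one step: a loop that never ends thus becomes a machine run that
  never halts (\<open>com_tm_diverges\<close>).
\<close>

lemma while_body_compile:
  assumes "exec c s s'" and "fst s i \<noteq> 0" and "is = pre @ compile (length pre) (While i c) @ post"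
  shows "(flat_red is)\<^sup>+\<^sup>+ (length pre, s) (length pre, s')"
proof -
  obtain e x y where s: "s = (e, x, y)" by (cases s)
  let ?p1 = "pre @ [IJz i (length pre + csize c + 2)]"
  have "flat_red is (length pre, s) (Suc (length pre), s)"
    by (rule flat_red_at[where i="IJz i (length pre + csize c + 2)"]) (use assms in \<open>auto simp: s\<close>)
  moreover have "(flat_red is)\<^sup>*\<^sup>* (length ?p1, s) (length ?p1 + csize c, s')"
    by (rule exec_compile[OF assms(1)]) (use assms(3) in simp)
  moreover have "flat_red is (length pre + 1 + csize c, s') (length pre, s')"
    by (rule flat_red_at[where pre="?p1 @ compile (length pre + 1) c" and i="IJmp (length pre)"])
       (use assms(3) in \<open>auto, cases s', auto\<close>)
  ultimately show ?thesis
    by (auto intro: rtranclp_into_tranclp2 rtranclp.rtrancl_into_rtrancl)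
qed

text \<open>
  One bound for registers and jump targets alike. With it every instruction list, compiled or
  not, gives a well-formed machine.
\<close>

fun ibound :: "instr \<Rightarrow> nat" where
  "ibound (IInc i) = Suc i"
| "ibound (IDec i) = Suc i"
| "ibound (IOut b) = 0"
| "ibound (IJz i l) = Suc i + l"
| "ibound (IJmp l) = l"
| "ibound (IRead l l') = l + l'"

definition nregs :: "instr list \<Rightarrow> nat" where "nregs is = sum_list (map ibound is)"

lemma ibound_le: "i \<in> set is \<Longrightarrow> ibound i \<le> nregs is"
  unfolding nregs_def by (simp add: member_le_sum_list)

fun itrans :: "instr \<Rightarrow> nat \<Rightarrow> nat list \<Rightarrow> nat \<times> (nat \<times> nat \<times> move) option" where
  "itrans (IInc i) p ss = (Suc p, Some (Suc i, ss ! Suc i, Move_Right))"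
| "itrans (IDec i) p ss =
     (Suc p, if ss ! Suc i = 3 then None else Some (Suc i, ss ! Suc i, Move_Left))"
| "itrans (IOut b) p ss = (Suc p, Some (length ss - 1, bit_symbol b, Move_Right))"
| "itrans (IJz i l) p ss = (if ss ! Suc i = 3 then l else Suc p, None)"
| "itrans (IJmp l) p ss = (l, None)"
| "itrans (IRead lF lE) p ss =
     (if ss ! 0 = 2 then (Suc p, Some (0, ss ! 0, Move_Right))
      else if ss ! 0 = 1 then (lF, Some (0, ss ! 0, Move_Right))
      else (lE, None))"

definition keep :: "nat list \<Rightarrow> (nat \<times> move) list" where
  "keep ss = map (\<lambda>s. (s, Stay)) ss"

definition acts_of :: "nat list \<Rightarrow> (nat \<times> nat \<times> move) option \<Rightarrow> (nat \<times> move) list" where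
  "acts_of ss u = (case u of None \<Rightarrow> keep ss | Some (j, a) \<Rightarrow> (keep ss)[j := a])"

text \<open>
  The first tape is the input, the last one the output, and tape \<open>i + 1\<close> holds register \<open>i\<close>.
  State 0 writes the marker 3 into cell 0 of each register tape, and state \<open>p + 1\<close> executes
  instruction \<open>p\<close>.
\<close>

definition machine :: "instr list \<Rightarrow> turing_machine" where
  "machine is =
     \<lparr>num_tapes = nregs is + 2, num_states = length is + nregs is + 2, num_symbols = 4,
      transition = (\<lambda>q ss.
        if q = 0 then Some (1, map (\<lambda>j. if 1 \<le> j \<and> j \<le> nregs is then (3, Stay) else (ss ! j, Stay))
                               [0..<length ss])
        else if q - 1 < length is then
          (case itrans (is ! (q - 1)) (q - 1) ss of (l, u) \<Rightarrow> Some (Suc l, acts_of ss u))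
        else None)\<rparr>"

lemma wf_machine: "wf_tm (machine is)"
proof -
  have "q' < num_states (machine is) \<and> length acts = num_tapes (machine is) \<and>
        (\<forall>a \<in> set acts. fst a < num_symbols (machine is))"
    if "q < num_states (machine is)" "length ss = num_tapes (machine is)"
      and ss: "\<forall>s \<in> set ss. s < num_symbols (machine is)"
      and tr: "transition (machine is) q ss = Some (q', acts)" for q ss q' acts
  proof (cases "q = 0")
    case True
    have len: "length ss = nregs is + 2" using that by (simp add: machine_def)
    have "q' = 1" and acts: "acts = map (\<lambda>j. if 1 \<le> j \<and> j \<le> nregs is then (3, Stay) else (ss ! j, Stay))
                               [0..<length ss]"
      using tr True by (auto simp: machine_def simp del: upt_Suc)
    moreover have "ss ! j < 4" if "j < length ss" for j
      using ss that by (simp add: machine_def)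
    then have "\<forall>a \<in> set acts. fst a < 4" by (auto simp: acts simp del: upt_Suc)
    ultimately show ?thesis using len by (simp add: machine_def)
  next
    case False
    let ?i = "is ! (q - 1)"
    have lt: "q - 1 < length is" using tr False by (auto simp: machine_def split: if_splits)
    obtain l u where lu: "itrans ?i (q - 1) ss = (l, u)" by (cases "itrans ?i (q - 1) ss")
    have q': "q' = Suc l" and acts: "acts = acts_of ss u"
      using tr lt lu False by (auto simp: machine_def)
    have b: "ibound ?i \<le> nregs is" by (rule ibound_le) (use lt in simp)
    have len: "length ss = nregs is + 2" and ss4: "\<And>j. j < nregs is + 2 \<Longrightarrow> ss ! j < 4"
      using that by (auto simp: machine_def)
    have kp: "\<forall>a \<in> set (keep ss). fst a < 4" using ss by (auto simp: keep_def machine_def)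
    have l: "l \<le> length is + nregs is"
      using lu lt b by (cases ?i) (auto split: if_splits)
    have u: "u = None \<or> (\<exists>j s m. u = Some (j, s, m) \<and> s < 4)"
      using lu b ss4 by (cases ?i) (auto split: if_splits simp: bit_symbol_def)
    have "\<forall>a \<in> set acts. fst a < 4"
      using u kp set_update_subset_insert[of "keep ss"] by (fastforce simp: acts acts_of_def)
    moreover have "length acts = nregs is + 2"
      using len by (auto simp: acts acts_of_def keep_def split: option.splits)
    ultimately show ?thesis using l by (simp add: q' machine_def)
  qed
  moreover have "num_tapes (machine is) \<ge> 1" "num_states (machine is) \<ge> 1" "num_symbols (machine is) \<ge> 3"
    by (simp_all add: machine_def)
  ultimately show ?thesis unfolding wf_tm_def by blast
qed

text \<open>
  The value of a register is the position of the head. The contents of the tape never change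
  after the start; the marker in cell 0 makes zero recognisable.
\<close>

definition reg_tape :: "nat \<Rightarrow> tape" where
  "reg_tape v = ((\<lambda>z. if z = 0 then 3 else 0), int v)"

definition out_tape :: "bool list \<Rightarrow> tape" where
  "out_tape y = (fst (input_tape y), int (length y))"

definition machine_config :: "nat \<Rightarrow> bool list \<Rightarrow> nat \<times> store \<Rightarrow> config" where
  "machine_config n inp k = (case k of (p, e, x, y) \<Rightarrow>
     (Suc p, (fst (input_tape inp), int (length inp - length x)) #
             map (\<lambda>i. reg_tape (e i)) [0..<n] @ [out_tape y]))"

lemma scanned_reg [simp]: "scanned (reg_tape v) = (if v = 0 then 3 else 0)"
  by (simp add: scanned_def reg_tape_def)

lemma scanned_input:
  assumes "suffix x inp"
  shows "scanned (fst (input_tape inp), int (length inp - length x)) =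
         (case x of [] \<Rightarrow> 0 | b # x' \<Rightarrow> bit_symbol b)"
  using assms by (auto simp: suffix_def scanned_def input_tape_def nth_append split: list.splits)

lemma act_stay [simp]: "act t (scanned t, Stay) = t"
  by (cases t) (simp add: act_def scanned_def)

lemma act_out: "act (out_tape y) (bit_symbol b, Move_Right) = out_tape (y @ [b])"
  by (auto simp: act_def out_tape_def input_tape_def fun_eq_iff nth_append nat_eq_iff2 less_Suc_eq)

lemma map2_act_keep: "map2 act ts (keep (map scanned ts)) = ts"
  by (rule nth_equalityI) (auto simp: keep_def)

lemma map2_act_update:
  "map2 act ts ((keep (map scanned ts))[j := a]) = ts[j := act (ts ! j) a]"
proof (rule nth_equalityI)
  fix i assume "i < length (map2 act ts ((keep (map scanned ts))[j := a]))"
  then show "map2 act ts ((keep (map scanned ts))[j := a]) ! i = ts[j := act (ts ! j) a] ! i"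
    by (cases "i = j") (simp_all add: keep_def)
qed (simp add: keep_def)

lemma step_machine:
  assumes "suffix (fst (snd s)) inp" and "p < length is"
  shows "step (machine is) (machine_config (nregs is) inp (p, s)) = Some (machine_config (nregs is) inp (flat_step (is ! p) (p, s)))
         \<and> suffix (fst (snd (snd (flat_step (is ! p) (p, s))))) inp"
proof -
  obtain e x y where s: "s = (e, x, y)" by (cases s)
  have suf: "suffix x inp" using assms(1) by (simp add: s)
  let ?n = "nregs is"
  define ts where "ts = (fst (input_tape inp), int (length inp - length x)) #
             map (\<lambda>i. reg_tape (e i)) [0..<?n] @ [out_tape y]"
  define ss where "ss = map scanned ts"
  have len: "length ss = ?n + 2" "length ts = ?n + 2" by (auto simp: ss_def ts_def)
  have reg: "ts ! Suc i = reg_tape (e i)" if "i < ?n" for i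
    using that by (simp add: ts_def nth_append)
  have sreg: "ss ! Suc i = (if e i = 0 then 3 else 0)" if "i < ?n" for i
    using that len reg by (simp add: ss_def)
  have out: "ts ! Suc ?n = out_tape y" by (simp add: ts_def nth_append)
  have s0: "ss ! 0 = (case x of [] \<Rightarrow> 0 | b # x' \<Rightarrow> bit_symbol b)"
    using scanned_input[OF suf] by (simp add: ss_def ts_def)
  have b: "ibound (is ! p) \<le> ?n" by (rule ibound_le) (use assms in simp)
  have upd: "ts[Suc i := reg_tape v] = (fst (input_tape inp), int (length inp - length x)) #
             map (\<lambda>j. reg_tape ((e(i := v)) j)) [0..<?n] @ [out_tape y]" if "i < ?n" for i v
  proof -
    have "(map (\<lambda>j. reg_tape (e j)) [0..<?n])[i := reg_tape v] =
          map (\<lambda>j. reg_tape ((e(i := v)) j)) [0..<?n]"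
      by (rule nth_equalityI) (auto simp: nth_list_update)
    then show ?thesis using that by (simp add: ts_def list_update_append)
  qed
  have updo: "ts[Suc ?n := t] = (fst (input_tape inp), int (length inp - length x)) #
             map (\<lambda>j. reg_tape (e j)) [0..<?n] @ [t]" for t
    by (auto simp: ts_def list_update_append)
  have st: "step (machine is) (machine_config ?n inp (p, s)) =
      (case itrans (is ! p) p ss of (l, u) \<Rightarrow> Some (Suc l, map2 act ts (acts_of ss u)))"
  proof -
    have machine_config: "machine_config ?n inp (p, s) = (Suc p, ts)" by (simp add: machine_config_def s ts_def)
    show ?thesis unfolding machine_config step_def ss_def using assms(2)
      by (cases "itrans (is ! p) p (map scanned ts)") (simp add: machine_def)
  qed
  have none: "map2 act ts (acts_of ss None) = ts"
    by (simp add: acts_of_def ss_def map2_act_keep)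
  have some: "map2 act ts (acts_of ss (Some (j, a))) = ts[j := act (ts ! j) a]" for j a
    by (simp add: acts_of_def ss_def map2_act_update)
  have fs: "flat_step i (p, s) = flat_step i (p, e, x, y)" for i by (simp add: s)
  have rp: "machine_config ?n inp (q, e', x', y') = (Suc q, (fst (input_tape inp), int (length inp - length x')) #
             map (\<lambda>i. reg_tape (e' i)) [0..<?n] @ [out_tape y'])" for q e' x' y'
    by (simp add: machine_config_def)
  show ?thesis
  proof (cases "is ! p")
    case (IInc i)
    then have i: "i < ?n" using b by simp
    have "act (ts ! Suc i) (ss ! Suc i, Move_Right) = reg_tape (Suc (e i))"
      using i by (auto simp: reg sreg act_def reg_tape_def fun_eq_iff)
    then show ?thesis using i suf by (simp add: st IInc some upd fs rp)
  next
    case (IDec i)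
    then have i: "i < ?n" using b by simp
    have "e i \<noteq> 0 \<Longrightarrow> act (ts ! Suc i) (0, Move_Left) = reg_tape (e i - 1)"
      using i by (auto simp: reg sreg act_def reg_tape_def fun_eq_iff)
    moreover have "e i = 0 \<Longrightarrow> e(i := 0) = e" by auto
    ultimately show ?thesis using i suf
      by (cases "e i = 0") (simp_all add: st IDec some none upd sreg fs rp ts_def[symmetric] del: fun_upd_apply)
  next
    case (IOut b)
    then show ?thesis using suf len by (simp add: st some out act_out updo fs rp)
  next
    case (IJz i l)
    then have i: "i < ?n" using b by simp
    then show ?thesis using suf by (simp add: st IJz none sreg fs rp ts_def[symmetric])
  next
    case (IJmp l)
    then show ?thesis using suf by (simp add: st none fs rp ts_def[symmetric])
  next
    case (IRead lF lE)
    show ?thesis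
    proof (cases x)
      case Nil
      then show ?thesis using suf s0 by (simp add: st IRead none fs rp) (simp add: ts_def)
    next
      case (Cons b x')
      have x': "suffix x' inp" "length x' < length inp"
        using suf by (auto simp: Cons suffix_def)
      have sc: "ss ! 0 = scanned (ts ! 0)" using len by (simp add: ss_def)
      have "act (ts ! 0) (ss ! 0, Move_Right) =
            (fst (input_tape inp), int (length inp - length x'))"
        unfolding sc using x' suffix_length_le[OF suf] Cons
        by (auto simp: ts_def act_def scanned_def)
      then have "ts[0 := act (ts ! 0) (ss ! 0, Move_Right)] =
          (fst (input_tape inp), int (length inp - length x')) #
             map (\<lambda>j. reg_tape (e j)) [0..<?n] @ [out_tape y]" by (simp add: ts_def)
      then show ?thesis using x' s0 Cons
        by (cases b) (simp_all add: st IRead some fs rp bit_symbol_def)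
    qed
  qed
qed

lemma step_machine_halt: "length is \<le> p \<Longrightarrow> step (machine is) (machine_config n inp (p, s)) = None"
  by (auto simp: step_def machine_config_def machine_def split: prod.splits)

abbreviation tm_reach :: "turing_machine \<Rightarrow> config \<Rightarrow> config \<Rightarrow> bool" where
  "tm_reach M \<equiv> (\<lambda>c c'. step M c = Some c')\<^sup>*\<^sup>*"

lemma flat_red_reach:
  assumes "(flat_red is)\<^sup>*\<^sup>* k k'" and "suffix (fst (snd (snd k))) inp"
  shows "tm_reach (machine is) (machine_config (nregs is) inp k) (machine_config (nregs is) inp k')
         \<and> suffix (fst (snd (snd k'))) inp"
  using assms
proof (induction rule: rtranclp_induct)
  case (step k' k'')
  then show ?case
    using step_machine[of "snd k'" inp "fst k'" "is"]
    by (auto simp: flat_red_def intro: rtranclp.rtrancl_into_rtrancl)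
qed auto

lemma tm_init:
  "step (machine is) (initial_config (machine is) inp) = Some (machine_config (nregs is) inp (0, (\<lambda>_. 0), inp, []))"
proof -
  let ?n = "nregs is"
  define ts where "ts = input_tape inp # replicate (?n + 1) (input_tape [])"
  define as where "as = map (\<lambda>j. if 1 \<le> j \<and> j \<le> ?n then (3, Stay)
                               else (map scanned ts ! j, Stay)) [0..<length (map scanned ts)]"
  have reg: "act (input_tape []) (3, Stay) = reg_tape 0"
    by (auto simp: act_def input_tape_def reg_tape_def fun_eq_iff)
  have out: "input_tape [] = out_tape []" by (simp add: out_tape_def input_tape_def)
  have inp: "(fst (input_tape inp), 0) = input_tape inp" by (simp add: input_tape_def)
  have len: "length ts = ?n + 2" "length as = ?n + 2" by (simp_all add: ts_def as_def)
  have "map2 act ts as = input_tape inp # map (\<lambda>i. reg_tape 0) [0..<?n] @ [out_tape []]"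
  proof (rule nth_equalityI)
    fix i assume "i < length (map2 act ts as)"
    then have i: "i < ?n + 2" using len by simp
    have m: "map2 act ts as ! i = act (ts ! i) (as ! i)" using i len by simp
    have a: "as ! i = (if 1 \<le> i \<and> i \<le> ?n then (3, Stay) else (scanned (ts ! i), Stay))"
      using i len by (simp add: as_def del: upt_Suc)
    consider "i = 0" | "1 \<le> i" "i \<le> ?n" | "i = ?n + 1" using i by linarith
    then show "map2 act ts as ! i = (input_tape inp # map (\<lambda>i. reg_tape 0) [0..<?n] @ [out_tape []]) ! i"
      unfolding m a by cases (auto simp: ts_def nth_Cons' nth_append reg[unfolded out] out simp del: upt_Suc)
  qed (use len in simp)
  moreover have "step (machine is) (initial_config (machine is) inp) = Some (1, map2 act ts as)"
  proof -
    have "initial_config (machine is) inp = (0, ts)"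
      by (simp add: initial_config_def machine_def ts_def)
    then show ?thesis by (simp add: step_def machine_def as_def del: upt_Suc)
  qed
  ultimately show ?thesis by (simp add: machine_config_def inp)
qed

lemma reach_halt_continue:
  assumes "tm_reach M a b" and ad: "tm_reach M a d" and d: "step M d = None"
  shows "tm_reach M b d"
  using assms(1)
proof (induction rule: rtranclp_induct)
  case (step b b')
  from step.IH show ?case
  proof (cases rule: converse_rtranclpE)
    case base
    then show ?thesis using step.hyps(2) d by simp
  next
    case (step z)
    then show ?thesis using \<open>step M b = Some b'\<close> by simp
  qed
qed (rule ad)

lemma reach_halt_unique:
  assumes "tm_reach M c d" and d: "step M d = None" and "tm_reach M c d'" and "step M d' = None"
  shows "d = d'"
  using reach_halt_continue[OF assms(1,3,4)]
  by (cases rule: converse_rtranclpE) (use d in auto)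

lemma tape_word_out_tape: "tape_word (out_tape y) z \<longleftrightarrow> z = y"
proof
  assume z: "tape_word (out_tape y) z"
  have cell: "fst (out_tape y) (int i) = (if i < length y then bit_symbol (y ! i) else 0)" for i
    by (simp add: out_tape_def input_tape_def)
  have zi: "\<And>i. i < length z \<Longrightarrow> fst (out_tape y) (int i) = bit_symbol (z ! i)"
    and ze: "fst (out_tape y) (int (length z)) \<notin> range bit_symbol"
    using z by (auto simp: tape_word_def)
  have inj: "bit_symbol a = bit_symbol b \<longleftrightarrow> a = b" "bit_symbol a \<noteq> 0" for a b
    by (auto simp: bit_symbol_def)
  have "length y \<le> length z" using ze by (auto simp: cell split: if_splits)
  moreover have "\<not> length y < length z" using zi[of "length y"] inj(2) by (auto simp: cell)
  ultimately have "length z = length y" by simp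
  moreover have "z ! i = y ! i" if "i < length z" for i
    using zi[OF that] that \<open>length z = length y\<close> inj by (simp add: cell)
  ultimately show "z = y" by (rule nth_equalityI)
next
  assume "z = y"
  then show "tape_word (out_tape y) z"
    by (auto simp: tape_word_def out_tape_def input_tape_def bit_symbol_def)
qed

definition com_tm :: "com \<Rightarrow> turing_machine" where
  "com_tm c = machine (compile 0 c)"

lemma com_tm_output:
  assumes "exec c ((\<lambda>_. 0), x, []) (e, x', y)"
  shows "tm_output (com_tm c) x z \<longleftrightarrow> z = y"
proof -
  let ?is = "compile 0 c"
  let ?d = "machine_config (nregs ?is) x (csize c, e, x', y)"
  have "(flat_red ?is)\<^sup>*\<^sup>* (0, (\<lambda>_. 0), x, []) (csize c, e, x', y)"
    using exec_compile[OF assms, of ?is "[]" "[]"] by simp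
  from flat_red_reach[OF this, of x]
  have "tm_reach (machine ?is) (machine_config (nregs ?is) x (0, (\<lambda>_. 0), x, [])) ?d" by simp
  then have r: "tm_reach (machine ?is) (initial_config (machine ?is) x) ?d"
    using tm_init[of ?is x] by (auto intro: converse_rtranclp_into_rtranclp)
  have h: "step (machine ?is) ?d = None" by (rule step_machine_halt) simp
  have "last (snd ?d) = out_tape y" by (simp add: machine_config_def)
  with r h show ?thesis
    unfolding tm_output_def com_tm_def by (metis reach_halt_unique tape_word_out_tape)
qed

text \<open>
  By determinism a halting run from \<open>c\<close> passes through the later configurations that satisfy \<open>I\<close>,
  with fewer and fewer steps left.
\<close>

lemma loop_never_halts:
  assumes inv: "I c" and "\<And>c. I c \<Longrightarrow> \<exists>c'. (\<lambda>c c'. step M c = Some c')\<^sup>+\<^sup>+ c c' \<and> I c'"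
    and "tm_reach M c d" and "step M d = None"
  shows False
proof -
  let ?R = "\<lambda>c c'. step M c = Some c'"
  have "\<not> I c" if "(?R ^^ n) c d" for n c
    using that
  proof (induction n arbitrary: c rule: less_induct)
    case (less n)
    show ?case
    proof
      assume "I c"
      from assms(2)[OF this] obtain c' where c': "?R\<^sup>+\<^sup>+ c c'" "I c'" by (elim exE conjE)
      obtain m where m: "m > 0" "(?R ^^ m) c c'"
        using c'(1)[unfolded tranclp_power] by (elim exE conjE)
      have det: "(?R ^^ i) a a' \<Longrightarrow> (?R ^^ j) a d \<Longrightarrow> i \<le> j \<and> (?R ^^ (j - i)) a' d" for i j a a'
      proof (induction i arbitrary: a j)
        case (Suc i)
        from Suc.prems(1) obtain b where b: "step M a = Some b" "(?R ^^ i) b a'"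
          using relpowp_Suc_D2[OF Suc.prems(1)] by blast
        obtain j' where j: "j = Suc j'"
          using Suc.prems(2) b(1) assms(4) by (cases j) auto
        have "(?R ^^ j') b d"
          using relpowp_Suc_D2[OF Suc.prems(2)[unfolded j]] b(1) by auto
        from Suc.IH[OF b(2) this] show ?case using j by simp
      qed simp
      from det[OF m(2) less.prems] have "m \<le> n" "(?R ^^ (n - m)) c' d" by auto
      with less.IH[of "n - m" c'] m(1) c'(2) show False by auto
    qed
  qed
  moreover obtain n where "(?R ^^ n) c d" using assms(3)[unfolded rtranclp_power] by (elim exE)
  ultimately show False using assms(1) by simp
qed

lemma com_tm_diverges:
  assumes pre: "exec c1 ((\<lambda>_. 0), x, []) s0" and I0: "I s0"
    and body: "\<And>s. I s \<Longrightarrow> fst s i \<noteq> 0 \<and> (\<exists>s'. exec c2 s s' \<and> I s')"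
  shows "\<not> tm_output (com_tm (Seq c1 (Seq (While i c2) c3))) x z"
proof
  let ?c = "Seq c1 (Seq (While i c2) c3)"
  let ?is = "compile 0 ?c"
  let ?M = "machine ?is" and ?n = "nregs (compile 0 ?c)"
  let ?pre = "compile 0 c1"
  let ?R = "\<lambda>c c'. step ?M c = Some c'"
  define J where "J k \<longleftrightarrow> (\<exists>s. k = machine_config ?n x (csize c1, s) \<and> I s \<and> suffix (fst (snd s)) x)" for k
  assume "tm_output (com_tm ?c) x z"
  then obtain d where d: "tm_reach ?M (initial_config ?M x) d" "step ?M d = None"
    by (auto simp: tm_output_def com_tm_def)
  have "(flat_red ?is)\<^sup>*\<^sup>* (0, (\<lambda>_. 0), x, []) (csize c1, s0)"
    using exec_compile[OF pre, of ?is "[]" "compile (csize c1) (Seq (While i c2) c3)"] by simp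
  from flat_red_reach[OF this, of x]
  have r: "tm_reach ?M (machine_config ?n x (0, (\<lambda>_. 0), x, [])) (machine_config ?n x (csize c1, s0))"
    and suf: "suffix (fst (snd s0)) x" by auto
  have "tm_reach ?M (machine_config ?n x (csize c1, s0)) d"
    using reach_halt_continue[OF converse_rtranclp_into_rtranclp[of ?R, OF tm_init r] d] .
  moreover have "J (machine_config ?n x (csize c1, s0))" using I0 suf unfolding J_def by blast
  moreover have "\<exists>k'. ?R\<^sup>+\<^sup>+ k k' \<and> J k'" if Jk: "J k" for k
  proof -
    obtain s where s: "k = machine_config ?n x (csize c1, s)" "I s" "suffix (fst (snd s)) x"
      using Jk unfolding J_def by blast
    obtain s' where s': "exec c2 s s'" "I s'" and nz: "fst s i \<noteq> 0" using body[OF s(2)] by auto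
    have "(flat_red ?is)\<^sup>+\<^sup>+ (length ?pre, s) (length ?pre, s')"
      by (rule while_body_compile[OF s'(1) nz]) simp
    then obtain k1 where k1: "flat_red ?is (csize c1, s) k1" "(flat_red ?is)\<^sup>*\<^sup>* k1 (csize c1, s')"
      by (auto dest: tranclpD)
    have "?R k (machine_config ?n x k1)" "suffix (fst (snd (snd k1))) x"
      using step_machine[of s x "csize c1" ?is] s(3) k1(1) unfolding s(1) flat_red_def fst_conv by metis+
    moreover from flat_red_reach[OF k1(2) this(2)]
    have "tm_reach ?M (machine_config ?n x k1) (machine_config ?n x (csize c1, s'))" "suffix (fst (snd s')) x" by auto
    moreover have "J (machine_config ?n x (csize c1, s'))"
      using s'(2) \<open>suffix (fst (snd s')) x\<close> unfolding J_def by blast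
    ultimately show ?thesis by (meson rtranclp_into_tranclp2)
  qed
  ultimately show False using loop_never_halts[of J _ ?M d] d(2) by blast
qed


section \<open>Running primitive recursive functions on registers\<close>

lemma exec_SeqI: "exec c s s' \<Longrightarrow> exec d s' s'' \<Longrightarrow> s'' = t \<Longrightarrow> exec (Seq c d) s t"
  by (auto intro: exec.Seq)

lemma exec_eqI: "exec c s t' \<Longrightarrow> t' = t \<Longrightarrow> exec c s t"
  by simp

lemma exec_while_count:
  assumes "\<And>k. k < n \<Longrightarrow> exec c (S (Suc k)) (S k)" and "\<And>k. k < n \<Longrightarrow> fst (S (Suc k)) i \<noteq> 0"
    and "fst (S 0) i = 0"
  shows "exec (While i c) (S n) (S 0)"
  using assms by (induction n) (auto intro: exec.WhileF exec.WhileT)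

definition clear :: "nat \<Rightarrow> com" where "clear a = While a (Dec a)"

lemma exec_clear: "exec (clear a) (e, x, y) (e(a := 0), x, y)"
  using exec_while_count[where n="e a" and c="Dec a" and S="\<lambda>k. (e(a := k), x, y)" and i=a]
    exec.Dec[of a "e(a := Suc _)" x y]
  by (simp add: clear_def)

definition move2 :: "nat \<Rightarrow> nat \<Rightarrow> nat \<Rightarrow> com" where
  "move2 a b c = While a (Seq (Dec a) (Seq (Inc b) (Inc c)))"

lemma exec_move2:
  assumes "a \<noteq> b" "a \<noteq> c" "b \<noteq> c"
  shows "exec (move2 a b c) (e, x, y) (e(a := 0, b := e b + e a, c := e c + e a), x, y)"
proof -
  define S where "S k = (e(a := k, b := e b + (e a - k), c := e c + (e a - k)), x, y)" for k
  have "exec (While a (Seq (Dec a) (Seq (Inc b) (Inc c)))) (S (e a)) (S 0)"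
  proof (rule exec_while_count)
    fix k assume "k < e a"
    then show "exec (Seq (Dec a) (Seq (Inc b) (Inc c))) (S (Suc k)) (S k)"
      unfolding S_def using assms
      by (intro exec_SeqI[OF exec.Dec exec_SeqI[OF exec.Inc exec.Inc refl]]) (auto simp: fun_eq_iff)
  qed (use assms in \<open>auto simp: S_def\<close>)
  then show ?thesis by (simp add: S_def move2_def)
qed

definition move :: "nat \<Rightarrow> nat \<Rightarrow> com" where
  "move a b = While a (Seq (Dec a) (Inc b))"

lemma exec_move:
  assumes "a \<noteq> b"
  shows "exec (move a b) (e, x, y) (e(a := 0, b := e b + e a), x, y)"
proof -
  define S where "S k = (e(a := k, b := e b + (e a - k)), x, y)" for k
  have "exec (While a (Seq (Dec a) (Inc b))) (S (e a)) (S 0)"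
  proof (rule exec_while_count)
    fix k assume "k < e a"
    then show "exec (Seq (Dec a) (Inc b)) (S (Suc k)) (S k)"
      unfolding S_def using assms
      by (intro exec_SeqI[OF exec.Dec exec.Inc]) (auto simp: fun_eq_iff)
  qed (use assms in \<open>auto simp: S_def\<close>)
  then show ?thesis by (simp add: S_def move_def)
qed

definition copy :: "nat \<Rightarrow> nat \<Rightarrow> nat \<Rightarrow> com" where
  "copy a b t = Seq (move2 a b t) (move t a)"

lemma exec_copy:
  assumes "a \<noteq> b" "a \<noteq> t" "b \<noteq> t" "e t = 0"
  shows "exec (copy a b t) (e, x, y) (e(b := e b + e a), x, y)"
  unfolding copy_def
  by (rule exec_SeqI[OF exec_move2 exec_move]) (use assms in \<open>auto simp: fun_eq_iff\<close>)

definition pairing :: "nat \<Rightarrow> com" where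
  "pairing N = Seq (move2 N (Suc N) (N + 2))
     (Seq (While (Suc N) (Seq (copy (Suc N) (N + 2) (N + 3)) (Dec (Suc N)))) (move (N + 2) N))"

lemma ppair_triangle: "ppair a b = triangle (a + b) + a"
  by (simp add: ppair_def prod_encode_def)

lemma triangle_mono: "m \<le> n \<Longrightarrow> triangle m \<le> triangle n"
  by (rule lift_Suc_mono_le[of triangle]) auto

text \<open>
  The loop adds \<open>s + (s - 1) + \<dots> + 1 = triangle s\<close> to the first component.
\<close>

lemma exec_pairing:
  assumes "e (N + 2) = 0" "e (N + 3) = 0"
  shows "exec (pairing N) (e, x, y) (e(N := ppair (e N) (e (Suc N)), Suc N := 0), x, y)"
proof -
  define m where "m = e N"
  define s where "s = e N + e (Suc N)"
  define S where "S k = (e(N := 0, Suc N := k, N + 2 := m + (triangle s - triangle k)), x, y)" for k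
  have "exec (While (Suc N) (Seq (copy (Suc N) (N + 2) (N + 3)) (Dec (Suc N)))) (S s) (S 0)"
  proof (rule exec_while_count)
    fix k assume "k < s"
    then have "triangle (Suc k) \<le> triangle s" by (intro triangle_mono) simp
    then show "exec (Seq (copy (Suc N) (N + 2) (N + 3)) (Dec (Suc N))) (S (Suc k)) (S k)"
      unfolding S_def using assms
      by (intro exec_SeqI[OF exec_copy exec.Dec]) (auto simp: fun_eq_iff)
  qed (auto simp: S_def)
  moreover have "exec (move2 N (Suc N) (N + 2)) (e, x, y) (S s)"
    using exec_move2[of N "Suc N" "N + 2" e x y] assms
    by (simp add: S_def s_def m_def add.commute)
  moreover have "exec (move (N + 2) N) (S 0) (e(N := ppair (e N) (e (Suc N)), Suc N := 0), x, y)"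
  proof -
    have "ppair (e N) (e (Suc N)) = triangle s + m" by (simp add: ppair_triangle s_def m_def)
    then show ?thesis
      using exec_move[of "N + 2" N "fst (S 0)" x y] assms(1)
      by (auto simp: S_def fun_upd_twist fun_upd_idem add.commute)
  qed
  ultimately show ?thesis unfolding pairing_def by (blast intro: exec.Seq)
qed

definition unpairing :: "nat \<Rightarrow> com" where
  "unpairing N = Seq (move N (N + 2)) (While (N + 2) (Seq (Dec (N + 2))
     (Cond (Suc N) (Seq (Dec (Suc N)) (Inc N)) (Seq (move N (Suc N)) (Inc (Suc N))))))"

text \<open>
  Unpairing walks along the Cantor enumeration; this is one step of the walk.
\<close>

lemma pfst_psnd_Suc:
  "pfst (Suc z) = (if psnd z = 0 then 0 else Suc (pfst z))"
  "psnd (Suc z) = (if psnd z = 0 then Suc (pfst z) else psnd z - 1)"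
proof -
  have "Suc (ppair m n) = (if n = 0 then ppair 0 (Suc m) else ppair (Suc m) (n - 1))" for m n
    by (cases n) (auto simp: ppair_triangle)
  from this[of "pfst z" "psnd z"]
  have "Suc z = (if psnd z = 0 then ppair 0 (Suc (pfst z)) else ppair (Suc (pfst z)) (psnd z - 1))"
    by simp
  then show "pfst (Suc z) = (if psnd z = 0 then 0 else Suc (pfst z))"
    "psnd (Suc z) = (if psnd z = 0 then Suc (pfst z) else psnd z - 1)"
    by (simp_all split: if_splits)
qed

lemma pfst_0 [simp]: "pfst 0 = 0" and psnd_0 [simp]: "psnd 0 = 0"
proof -
  have "ppair 0 0 = 0" by (simp add: ppair_triangle)
  then show "pfst 0 = 0" "psnd 0 = 0" by (metis pfst_ppair, metis psnd_ppair)
qed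

lemma exec_unpairing:
  assumes "e (Suc N) = 0" "e (N + 2) = 0"
  shows "exec (unpairing N) (e, x, y) (e(N := pfst (e N), Suc N := psnd (e N)), x, y)"
proof -
  define z where "z = e N"
  define S where "S k = (e(N := pfst (z - k), Suc N := psnd (z - k), N + 2 := k), x, y)" for k
  let ?B = "Seq (Dec (N + 2))
     (Cond (Suc N) (Seq (Dec (Suc N)) (Inc N)) (Seq (move N (Suc N)) (Inc (Suc N))))"
  have "exec (While (N + 2) ?B) (S z) (S 0)"
  proof (rule exec_while_count)
    fix k assume "k < z"
    then have k: "z - k = Suc (z - Suc k)" by simp
    let ?e = "e(N := pfst (z - Suc k), Suc N := psnd (z - Suc k), N + 2 := k)"
    have 1: "exec (Dec (N + 2)) (S (Suc k)) (?e, x, y)"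
      unfolding S_def by (rule exec_eqI[OF exec.Dec]) (auto simp: fun_eq_iff)
    have 2: "exec (Cond (Suc N) (Seq (Dec (Suc N)) (Inc N)) (Seq (move N (Suc N)) (Inc (Suc N))))
               (?e, x, y) (S k)"
    proof (cases "psnd (z - Suc k) = 0")
      case True
      show ?thesis
        by (rule exec.CondF, simp add: True, rule exec_SeqI[OF exec_move exec.Inc])
           (auto simp: S_def k pfst_psnd_Suc True fun_eq_iff)
    next
      case False
      show ?thesis
        by (rule exec.CondT, simp add: False, rule exec_SeqI[OF exec.Dec exec.Inc])
           (use False in \<open>auto simp: S_def k pfst_psnd_Suc fun_eq_iff\<close>)
    qed
    show "exec ?B (S (Suc k)) (S k)" by (rule exec.Seq[OF 1 2])
  qed (auto simp: S_def)
  moreover have "exec (move N (N + 2)) (e, x, y) (S z)"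
    by (rule exec_eqI[OF exec_move]) (use assms in \<open>auto simp: S_def z_def fun_eq_iff\<close>)
  moreover have "S 0 = (e(N := pfst (e N), Suc N := psnd (e N)), x, y)"
    using assms by (auto simp: S_def z_def fun_eq_iff)
  ultimately show ?thesis unfolding unpairing_def by (metis exec.Seq)
qed

text \<open>
  The registers above \<open>N\<close> are scratch space that is zero before and after, so programs can be
  composed without keeping track of free registers.
\<close>

definition computes :: "com \<Rightarrow> nat \<Rightarrow> (nat \<Rightarrow> nat) \<Rightarrow> bool" where
  "computes c N f \<longleftrightarrow>
     (\<forall>e x y. (\<forall>i>N. e i = 0) \<longrightarrow> exec c (e, x, y) (e(N := f (e N)), x, y))"

lemma computesD: "computes c N f \<Longrightarrow> (\<And>i. i > N \<Longrightarrow> e i = 0) \<Longrightarrow> exec c (e, x, y) (e(N := f (e N)), x, y)"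
  by (simp add: computes_def)

lemma computesI:
  "(\<And>e x y. (\<And>i. i > N \<Longrightarrow> e i = 0) \<Longrightarrow> exec c (e, x, y) (e(N := f (e N)), x, y)) \<Longrightarrow> computes c N f"
  by (simp add: computes_def)

lemma pr_computes:
  assumes "prim_rec f"
  shows "\<exists>c. computes c N f"
  using assms
proof (induction arbitrary: N)
  case zero
  have "computes (clear N) N (\<lambda>x. 0)" by (intro computesI exec_clear)
  then show ?case by blast
next
  case Suc
  have "computes (Inc N) N Suc" by (intro computesI exec.Inc)
  then show ?case by blast
next
  case fst
  have "computes (Seq (unpairing N) (clear (Suc N))) N pfst"
    by (intro computesI exec_SeqI[OF exec_unpairing exec_clear]) (auto simp: fun_eq_iff)
  then show ?case by blast
next
  case snd
  have "computes (Seq (unpairing N) (Seq (clear N) (move (Suc N) N))) N psnd"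
    by (intro computesI exec_SeqI[OF exec_unpairing exec_SeqI[OF exec_clear exec_move refl]])
       (auto simp: fun_eq_iff)
  then show ?case by blast
next
  case (pair f g)
  obtain cf cg where cf: "computes cf (Suc N) f" and cg: "computes cg (Suc N) g"
    using pair.IH by blast
  let ?c = "Seq (copy N (Suc N) (N + 2)) (Seq cf (Seq (move (Suc N) (N + 2)) (Seq (move N (Suc N))
       (Seq (move (N + 2) N) (Seq cg (pairing N))))))"
  have "computes ?c N (\<lambda>x. ppair (f x) (g x))"
  proof (rule computesI)
    fix e :: "nat \<Rightarrow> nat" and x y :: "bool list" assume z: "\<And>i. i > N \<Longrightarrow> e i = 0"
    let ?v = "e N"
    have 1: "exec (copy N (Suc N) (N + 2)) (e, x, y) (e(Suc N := ?v), x, y)"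
      by (rule exec_eqI[OF exec_copy]) (auto simp: z fun_eq_iff)
    have 2: "exec cf (e(Suc N := ?v), x, y) (e(Suc N := f ?v), x, y)"
      by (rule exec_eqI[OF computesD[OF cf]]) (auto simp: z)
    have 3: "exec (move (Suc N) (N + 2)) (e(Suc N := f ?v), x, y) (e(N + 2 := f ?v), x, y)"
      by (rule exec_eqI[OF exec_move]) (auto simp: z fun_eq_iff)
    have 4: "exec (move N (Suc N)) (e(N + 2 := f ?v), x, y) (e(N := 0, Suc N := ?v, N + 2 := f ?v), x, y)"
      by (rule exec_eqI[OF exec_move]) (auto simp: z fun_eq_iff)
    have 5: "exec (move (N + 2) N) (e(N := 0, Suc N := ?v, N + 2 := f ?v), x, y) (e(N := f ?v, Suc N := ?v), x, y)"
      by (rule exec_eqI[OF exec_move]) (auto simp: z fun_eq_iff)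
    have 6: "exec cg (e(N := f ?v, Suc N := ?v), x, y) (e(N := f ?v, Suc N := g ?v), x, y)"
      by (rule exec_eqI[OF computesD[OF cg]]) (auto simp: z)
    have 7: "exec (pairing N) (e(N := f ?v, Suc N := g ?v), x, y) (e(N := ppair (f ?v) (g ?v)), x, y)"
      by (rule exec_eqI[OF exec_pairing]) (auto simp: z fun_eq_iff)
    show "exec ?c (e, x, y) (e(N := ppair (f ?v) (g ?v)), x, y)"
      by (rule exec.Seq 1 2 3 4 5 6 7)+
  qed
  then show ?case by blast
next
  case (comp f g)
  obtain cf cg where cf: "computes cf N f" and cg: "computes cg N g" using comp.IH by blast
  have "computes (Seq cg cf) N (\<lambda>x. f (g x))"
    by (intro computesI exec_SeqI[OF computesD[OF cg] computesD[OF cf]]) auto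
  then show ?case by blast
next
  case (iter f)
  obtain cf where cf: "computes cf (Suc N) f" using iter.IH by blast
  let ?c = "Seq (unpairing N) (Seq (While N (Seq (Dec N) cf)) (move (Suc N) N))"
  have "computes ?c N (\<lambda>x. (f ^^ pfst x) (psnd x))"
  proof (rule computesI)
    fix e :: "nat \<Rightarrow> nat" and x y :: "bool list" assume z: "\<And>i. i > N \<Longrightarrow> e i = 0"
    let ?n = "pfst (e N)" and ?v = "psnd (e N)"
    define S where "S k = (e(N := k, Suc N := (f ^^ (?n - k)) ?v), x, y)" for k
    have 1: "exec (unpairing N) (e, x, y) (S ?n)"
      by (rule exec_eqI[OF exec_unpairing]) (auto simp: z fun_eq_iff S_def)
    have 2: "exec (While N (Seq (Dec N) cf)) (S ?n) (S 0)"
    proof (rule exec_while_count)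
      fix k assume "k < ?n"
      then have k: "?n - k = Suc (?n - Suc k)" by simp
      show "exec (Seq (Dec N) cf) (S (Suc k)) (S k)"
        unfolding S_def k by (rule exec_SeqI[OF exec.Dec computesD[OF cf]]) (auto simp: z fun_eq_iff)
    qed (auto simp: S_def)
    have 3: "exec (move (Suc N) N) (S 0) (e(N := (f ^^ ?n) ?v), x, y)"
      unfolding S_def by (rule exec_eqI[OF exec_move]) (auto simp: z fun_eq_iff)
    show "exec ?c (e, x, y) (e(N := (f ^^ ?n) ?v), x, y)" by (rule exec.Seq 1 2 3)+
  qed
  then show ?case by blast
qed


section \<open>Search machines\<close>

text \<open>
  Bijective base two, least significant digit first. Unlike ordinary binary notation this is a
  bijection between bit strings and numbers.
\<close>

fun num :: "bool list \<Rightarrow> nat" where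
  "num [] = 0"
| "num (b # bs) = (if b then 2 else 1) + 2 * num bs"

lemma num_append: "num (xs @ ys) = num xs + 2 ^ length xs * num ys"
  by (induction xs) auto

lemma num_length: "2 ^ length xs \<le> num xs + 1" "num xs + 1 < 2 ^ (length xs + 1)"
  by (induction xs) auto

lemma num_inj: "num xs = num ys \<Longrightarrow> xs = ys"
proof (induction xs arbitrary: ys)
  case Nil
  then show ?case by (cases ys) (auto split: if_splits)
next
  case (Cons b bs)
  obtain b' bs' where ys: "ys = b' # bs'" using Cons.prems by (cases ys) (auto split: if_splits)
  have eq: "(if b then 2 else 1) + 2 * num bs = (if b' then 2 else 1) + 2 * num bs'"
    using Cons.prems by (simp add: ys)
  have "b = b'" using arg_cong[OF eq, of even] by (auto split: if_splits)
  moreover from this have "num bs = num bs'" using eq by simp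
  ultimately show ?case using Cons.IH ys by simp
qed

lemma num_surj: "\<exists>xs. num xs = n"
proof (induction n rule: less_induct)
  case (less n)
  show ?case
  proof (cases "n = 0")
    case True
    then show ?thesis by (intro exI[of _ "[]"]) simp
  next
    case False
    then have "(n - 1) div 2 < n" by arith
    then obtain xs where xs: "num xs = (n - 1) div 2" using less by blast
    have "num (even n # xs) = n" using False xs by (auto elim!: evenE oddE)
    then show ?thesis by blast
  qed
qed


definition read_com :: com where
  "read_com = Read
     (Seq (move2 1 0 2) (Seq (move2 2 0 1) (Seq (move2 1 2 3) (Seq (move 2 1) (move 3 1)))))
     (Seq (move2 1 0 2) (Seq (move2 2 1 3) (move 3 1)))"

lemma exec_read_com:
  assumes "e 2 = 0" "e 3 = 0"
  shows "exec read_com (e, x, y) (e(0 := e 0 + e 1 * num x, 1 := e 1 * 2 ^ length x), [], y)"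
  using assms
proof (induction x arbitrary: e)
  case Nil
  then show ?case unfolding read_com_def using exec.ReadE by auto
next
  case (Cons b x)
  let ?T = "Seq (move2 1 0 2) (Seq (move2 2 0 1) (Seq (move2 1 2 3) (Seq (move 2 1) (move 3 1))))"
  let ?F = "Seq (move2 1 0 2) (Seq (move2 2 1 3) (move 3 1))"
  let ?e = "e(0 := e 0 + e 1 * (if b then 2 else 1), 1 := 2 * e 1)"
  have T: "exec ?T (e, x, y) (e(0 := e 0 + e 1 * 2, 1 := 2 * e 1), x, y)"
    by (intro exec_SeqI[OF exec_move2 exec_SeqI[OF exec_move2 exec_SeqI[OF exec_move2
          exec_SeqI[OF exec_move exec_move refl] refl] refl]])
       (use Cons.prems in \<open>auto simp: fun_eq_iff\<close>)
  have F: "exec ?F (e, x, y) (e(0 := e 0 + e 1, 1 := 2 * e 1), x, y)"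
    by (intro exec_SeqI[OF exec_move2 exec_SeqI[OF exec_move2 exec_move refl]])
       (use Cons.prems in \<open>auto simp: fun_eq_iff\<close>)
  have "exec (if b then ?T else ?F) (e, x, y) (?e, x, y)"
    using T F by (cases b) simp_all
  moreover have "exec read_com (?e, x, y)
      (?e(0 := ?e 0 + ?e 1 * num x, 1 := ?e 1 * 2 ^ length x), [], y)"
    by (rule Cons.IH) (use Cons.prems in auto)
  ultimately have "exec read_com (e, b # x, y)
      (?e(0 := ?e 0 + ?e 1 * num x, 1 := ?e 1 * 2 ^ length x), [], y)"
    unfolding read_com_def by (rule exec.ReadB)
  moreover have "?e(0 := ?e 0 + ?e 1 * num x, 1 := ?e 1 * 2 ^ length x) =
     e(0 := e 0 + e 1 * num (b # x), 1 := e 1 * 2 ^ length (b # x))"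
    by (auto simp: fun_eq_iff algebra_simps)
  ultimately show ?case by (simp only:)
qed

lemma print_program:
  "\<exists>c. \<forall>w e x y. e 0 = num w \<longrightarrow> (\<forall>i>0. e i = 0) \<longrightarrow> exec c (e, x, y) (e(0 := 0), x, y @ w)"
proof -
  have "prim_rec (\<lambda>v. v mod 2)" "prim_rec (\<lambda>v. (v - 1) div 2)" by (intro pr_intros)+
  then obtain cp ch where cp: "computes cp 1 (\<lambda>v. v mod 2)" and ch: "computes ch 0 (\<lambda>v. (v - 1) div 2)"
    using pr_computes by meson
  let ?B = "Seq (copy 0 1 2) (Seq cp (Seq (Cond 1 (Seq (Out False) (Dec 1)) (Out True)) ch))"
  have "exec (While 0 ?B) (e, x, y) (e(0 := 0), x, y @ w)"
    if "e 0 = num w" "\<forall>i>0. e i = 0" for w e x y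
    using that
  proof (induction w arbitrary: e y)
    case Nil
    then show ?case by (intro exec_eqI[OF exec.WhileF]) (auto simp: fun_upd_idem)
  next
    case (Cons b w)
    let ?v = "e 0"
    have z: "e i = 0" if "i > 0" for i using Cons.prems(2) that by blast
    have par: "?v mod 2 = (if b then 0 else 1)" and half: "(?v - 1) div 2 = num w" and nz: "?v \<noteq> 0"
      using Cons.prems(1) by (auto split: if_splits)
    have 1: "exec (copy 0 1 2) (e, x, y) (e(1 := ?v), x, y)"
      by (rule exec_eqI[OF exec_copy]) (auto simp: z fun_eq_iff)
    have 2: "exec cp (e(1 := ?v), x, y) (e(1 := ?v mod 2), x, y)"
      by (rule exec_eqI[OF computesD[OF cp]]) (auto simp: z)
    have 3: "exec (Cond 1 (Seq (Out False) (Dec 1)) (Out True)) (e(1 := ?v mod 2), x, y) (e, x, y @ [b])"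
    proof (cases b)
      case True
      have "exec (Out True) (e(1 := ?v mod 2), x, y) (e, x, y @ [b])"
        by (rule exec_eqI[OF exec.Out]) (use True in \<open>auto simp: par z fun_eq_iff\<close>)
      then show ?thesis by (intro exec.CondF) (use True par in auto)
    next
      case False
      have "exec (Seq (Out False) (Dec 1)) (e(1 := ?v mod 2), x, y) (e, x, y @ [b])"
        by (rule exec_SeqI[OF exec.Out exec.Dec]) (use False in \<open>auto simp: par z fun_eq_iff\<close>)
      then show ?thesis by (intro exec.CondT) (use False par in auto)
    qed
    have 4: "exec ch (e, x, y @ [b]) (e(0 := num w), x, y @ [b])"
      by (rule exec_eqI[OF computesD[OF ch]]) (use half in \<open>auto simp: z\<close>)
    have B: "exec ?B (e, x, y) (e(0 := num w), x, y @ [b])"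
      by (rule exec.Seq 1 2 3 4)+
    have W: "exec (While 0 ?B) (e(0 := num w), x, y @ [b]) (e(0 := num w, 0 := 0), x, (y @ [b]) @ w)"
      by (rule Cons.IH) (auto simp: z)
    show ?case by (rule exec_eqI[OF exec.WhileT[OF _ B W]]) (use nz in auto)
  qed
  then show ?thesis by blast
qed

text \<open>
  The machine halts only if the search succeeds. This is how its domain is controlled, and in
  particular made prefix-free, by the choice of \<open>R\<close>.
\<close>

lemma search_machine:
  assumes R: "prim_rec_pred (\<lambda>z. R (pfst z) (psnd z))" and g: "prim_rec g"
  shows "\<exists>M. wf_tm M \<and>
     (\<forall>x. (\<exists>y. R (num x) y) \<longrightarrow>
        (\<forall>z. tm_output M x z \<longleftrightarrow> num z = g (ppair (num x) (LEAST y. R (num x) y)))) \<and>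
     (\<forall>x z. tm_output M x z \<longrightarrow> (\<exists>y. R (num x) y))"
proof -
  have "prim_rec (\<lambda>z. of_bool (\<not> R (pfst z) (psnd z)))" by (intro pr_intros R)
  then obtain ct where ct: "computes ct 2 (\<lambda>z. of_bool (\<not> R (pfst z) (psnd z)))"
    using pr_computes by blast
  obtain cg where cg: "computes cg 0 g" using pr_computes[OF g] by blast
  obtain cp where cp: "\<And>w e x y. e 0 = num w \<Longrightarrow> (\<And>i. i > 0 \<Longrightarrow> e i = 0) \<Longrightarrow>
      exec cp (e, x, y) (e(0 := 0), x, y @ w)"
    using print_program by metis
  define T where "T = Seq (copy 0 2 4) (Seq (copy 1 3 4) (Seq (pairing 2) ct))"
  define c1 where "c1 = Seq (Inc 1) (Seq read_com (Seq (clear 1) T))"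
  define c2 where "c2 = Seq (Dec 2) (Seq (Inc 1) T)"
  define c3 where "c3 = Seq (pairing 0) (Seq cg cp)"
  define E where "E N y f = (\<lambda>i::nat. 0::nat)(0 := N, 1 := y, 2 := f)" for N y f
  define F where "F N y = (of_bool (\<not> R N y) :: nat)" for N y
  have T: "exec T (E N y 0, x, o') (E N y (F N y), x, o')" for N y x o'
  proof -
    have 1: "exec (copy 0 2 4) (E N y 0, x, o') (E N y N, x, o')"
      by (rule exec_eqI[OF exec_copy]) (auto simp: E_def fun_eq_iff)
    have 2: "exec (copy 1 3 4) (E N y N, x, o') ((E N y N)(3 := y), x, o')"
      by (rule exec_eqI[OF exec_copy]) (auto simp: E_def fun_eq_iff)
    have 3: "exec (pairing 2) ((E N y N)(3 := y), x, o') (E N y (ppair N y), x, o')"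
      by (rule exec_eqI[OF exec_pairing]) (auto simp: E_def fun_eq_iff)
    have 4: "exec ct (E N y (ppair N y), x, o') (E N y (F N y), x, o')"
      by (rule exec_eqI[OF computesD[OF ct]]) (auto simp: E_def F_def fun_eq_iff)
    show ?thesis unfolding T_def by (rule exec.Seq 1 2 3 4)+
  qed
  have c1: "exec c1 ((\<lambda>_. 0), x, []) (E (num x) 0 (F (num x) 0), [], [])" for x
  proof -
    have 1: "exec (Inc 1) ((\<lambda>_. 0), x, []) (E 0 1 0, x, [])"
      by (rule exec_eqI[OF exec.Inc]) (auto simp: E_def fun_eq_iff)
    have 2: "exec read_com (E 0 1 0, x, []) (E (num x) (2 ^ length x) 0, [], [])"
      by (rule exec_eqI[OF exec_read_com]) (auto simp: E_def fun_eq_iff)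
    have 3: "exec (clear 1) (E (num x) (2 ^ length x) 0, [], []) (E (num x) 0 0, [], [])"
      by (rule exec_eqI[OF exec_clear]) (auto simp: E_def fun_eq_iff)
    show ?thesis unfolding c1_def by (rule exec.Seq 1 2 3 T)+
  qed
  have c2: "exec c2 (E N y (F N y), x, o') (E N (Suc y) (F N (Suc y)), x, o')" if "\<not> R N y" for N y x o'
  proof -
    have 1: "exec (Dec 2) (E N y (F N y), x, o') (E N y 0, x, o')"
      by (rule exec_eqI[OF exec.Dec]) (use that in \<open>auto simp: E_def F_def fun_eq_iff\<close>)
    have 2: "exec (Inc 1) (E N y 0, x, o') (E N (Suc y) 0, x, o')"
      by (rule exec_eqI[OF exec.Inc]) (auto simp: E_def fun_eq_iff)
    show ?thesis unfolding c2_def by (rule exec.Seq 1 2 T)+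
  qed
  let ?c = "Seq c1 (Seq (While 2 c2) c3)"
  have div: "\<exists>y. R (num x) y" if out: "tm_output (com_tm ?c) x z" for x z
  proof (rule ccontr)
    assume no: "\<not> (\<exists>y. R (num x) y)"
    define I where "I s \<longleftrightarrow> (\<exists>y. s = (E (num x) y (F (num x) y), [] :: bool list, [] :: bool list))" for s
    have "\<not> tm_output (com_tm ?c) x z"
    proof (rule com_tm_diverges[OF c1, where I=I])
      show "I (E (num x) 0 (F (num x) 0), [], [])" by (auto simp: I_def)
      fix s assume "I s"
      then obtain y where s: "s = (E (num x) y (F (num x) y), [], [])" by (auto simp: I_def)
      have "fst s 2 \<noteq> 0" using no by (simp add: s E_def F_def)
      moreover have "exec c2 s (E (num x) (Suc y) (F (num x) (Suc y)), [], [])"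
        unfolding s by (rule c2) (use no in blast)
      moreover have "I (E (num x) (Suc y) (F (num x) (Suc y)), [], [])" by (auto simp: I_def)
      ultimately show "fst s 2 \<noteq> 0 \<and> (\<exists>s'. exec c2 s s' \<and> I s')" by blast
    qed
    with out show False by blast
  qed
  have con: "tm_output (com_tm ?c) x z \<longleftrightarrow> num z = g (ppair (num x) (LEAST y. R (num x) y))"
    if ex: "\<exists>y. R (num x) y" for x z
  proof -
    let ?N = "num x"
    define m where "m = (LEAST y. R ?N y)"
    have m: "R ?N m" unfolding m_def using ex by (rule LeastI_ex)
    have lt: "\<not> R ?N y" if "y < m" for y using that unfolding m_def by (rule not_less_Least)
    obtain w where w: "num w = g (ppair ?N m)" using num_surj by blast
    define S where "S k = (E ?N (m - k) (F ?N (m - k)), [] :: bool list, [] :: bool list)" for k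
    have W: "exec (While 2 c2) (S m) (S 0)"
    proof (rule exec_while_count)
      fix k assume k: "k < m"
      then have Sk: "m - k = Suc (m - Suc k)" by simp
      show "exec c2 (S (Suc k)) (S k)" unfolding S_def Sk by (rule c2, rule lt) (use k in simp)
      show "fst (S (Suc k)) 2 \<noteq> 0" using lt[of "m - Suc k"] k by (simp add: S_def E_def F_def)
    qed (use m in \<open>simp add: S_def E_def F_def\<close>)
    have 1: "exec (pairing 0) (S 0) (E (ppair ?N m) 0 0, [], [])"
      unfolding S_def by (rule exec_eqI[OF exec_pairing]) (use m in \<open>auto simp: E_def F_def fun_eq_iff\<close>)
    have 2: "exec cg (E (ppair ?N m) 0 0, [], []) (E (num w) 0 0, [], [])"
      by (rule exec_eqI[OF computesD[OF cg]]) (auto simp: E_def w fun_eq_iff)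
    have 3: "exec cp (E (num w) 0 0, [], []) (E 0 0 0, [], w)"
      by (rule exec_eqI[OF cp[of _ w]]) (auto simp: E_def fun_eq_iff)
    have c1': "exec c1 ((\<lambda>_. 0), x, []) (S m)" using c1[of x] by (simp add: S_def)
    have "exec ?c ((\<lambda>_. 0), x, []) (E 0 0 0, [], w)"
      unfolding c3_def by (rule exec.Seq c1' W 1 2 3)+
    from com_tm_output[OF this] show ?thesis
      using w num_inj by (auto simp: m_def)
  qed
  have wf: "wf_tm (com_tm ?c)" by (simp add: com_tm_def wf_machine)
  from wf con div show ?thesis by blast
qed


section \<open>Self-delimiting programs\<close>

text \<open>
  The unary number \<open>k\<close> announces a payload of \<open>k\<^sup>2\<close> bits. Marking the end of the payload hence costs
  only about the square root of its length.
\<close>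

definition self_delim :: "nat \<Rightarrow> bool list \<Rightarrow> bool list" where
  "self_delim k w = replicate k True @ False # w"

lemma num_self_delim: "num (self_delim k w) + 2 = 2 ^ k * (2 * num w + 3)"
proof -
  have "num (replicate k True) + 2 = 2 * 2 ^ k" by (induction k) auto
  then show ?thesis by (simp add: self_delim_def num_append algebra_simps)
qed

lemma length_num:
  assumes "2 ^ L \<le> num w + 1" "num w + 1 < 2 ^ (L + 1)"
  shows "length w = L"
proof -
  have "2 ^ L < (2::nat) ^ (length w + 1)" using assms(1) num_length(2)[of w] by linarith
  moreover have "2 ^ length w < (2::nat) ^ (L + 1)" using assms(2) num_length(1)[of w] by linarith
  ultimately have "L < length w + 1" "length w < L + 1" by (simp_all only: power_strict_increasing_iff)
  then show ?thesis by simp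
qed

lemma payload_word:
  assumes "v < 2 ^ L"
  obtains w where "length w = L" "num w + 1 = 2 ^ L + v"
proof -
  obtain w where w: "num w = 2 ^ L + v - 1" using num_surj by blast
  then have "num w + 1 = 2 ^ L + v" by simp
  moreover from this have "length w = L" using assms by (intro length_num) auto
  ultimately show ?thesis by (rule that[rotated])
qed

lemma self_delim_inj: "self_delim k w = self_delim k' w' \<Longrightarrow> k = k' \<and> w = w'"
proof (induction k arbitrary: k')
  case 0
  then show ?case by (cases k') (auto simp: self_delim_def)
next
  case (Suc k)
  then show ?case by (cases k') (auto simp: self_delim_def)
qed

lemma self_delim_prefix:
  assumes "prefix (self_delim k w) (self_delim k' w')" "length w = k\<^sup>2" "length w' = k'\<^sup>2"
  shows "self_delim k w = self_delim k' w'"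
proof -
  let ?x = "self_delim k w" and ?y = "self_delim k' w'"
  have nth: "self_delim k w ! i = (i < k)" if "i \<le> k" for i k w
    using that by (auto simp: self_delim_def nth_append)
  have len: "length (self_delim k w) = k + 1 + length w" for k w by (simp add: self_delim_def)
  obtain z where z: "?y = ?x @ z" using assms(1) by (auto simp: prefix_def)
  have same: "?y ! i = ?x ! i" if "i < length ?x" for i using z that by (simp add: nth_append)
  have "\<not> k < k'" using same[of k] nth[of k k' w'] nth[of k k w] by (auto simp: len)
  moreover have "\<not> k' < k" using same[of k'] nth[of k' k' w'] nth[of k' k w] by (auto simp: len)
  ultimately have "k = k'" by simp
  then have "length ?x = length ?y" using assms by (simp add: len)
  then show ?thesis using z by simp
qed

text \<open>
  The machine searches for \<open>y\<close> with \<open>R k v y\<close> and prints \<open>g k v y\<close>, where \<open>v\<close> is a number of \<open>k\<^sup>2\<close>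
  bits. Its search also decodes the input, so that it diverges on all inputs that are not
  self-delimiting; this makes it a prefix machine, which \<open>U\<close> simulates with a constant overhead.
\<close>

lemma payload_program:
  assumes U: "universal_prefix_tm U"
    and R: "prim_rec_pred (\<lambda>z. R (pfst z) (pfst (psnd z)) (psnd (psnd z)))"
    and g: "prim_rec (\<lambda>z. g (pfst z) (pfst (psnd z)) (psnd (psnd z)))"
  shows "\<exists>C. \<forall>k v y0 w. v < 2 ^ k\<^sup>2 \<longrightarrow> R k v y0 \<longrightarrow> (\<forall>y. R k v y \<longrightarrow> g k v y = num w) \<longrightarrow>
           (\<exists>\<pi>. tm_output U \<pi> w \<and> length \<pi> \<le> k\<^sup>2 + k + C)"
proof -
  \<comment> \<open>By \<open>num_self_delim\<close> and \<open>payload_word\<close> the equation says that the input is \<open>self_delim k w\<close>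
    for the word \<open>w\<close> of length \<open>k\<^sup>2\<close> that carries the payload \<open>v\<close>.\<close>
  define Q where "Q N y \<longleftrightarrow> N + 2 = 2 ^ pfst y * (2 * 2 ^ (pfst y)\<^sup>2 + 2 * pfst (psnd y) + 1) \<and>
    pfst (psnd y) < 2 ^ (pfst y)\<^sup>2 \<and> R (pfst y) (pfst (psnd y)) (psnd (psnd y))" for N y
  define h where "h z = g (pfst (psnd z)) (pfst (psnd (psnd z))) (psnd (psnd (psnd z)))" for z
  have "prim_rec_pred (\<lambda>z. Q (pfst z) (psnd z))"
    unfolding Q_def by (intro pr_intros prp_comp[OF R])
  moreover have "prim_rec h" unfolding h_def by (rule prim_rec.comp[OF g prim_rec.snd])
  ultimately obtain M where wf: "wf_tm M"
    and out: "\<And>x z. \<exists>y. Q (num x) y \<Longrightarrow>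
          tm_output M x z \<longleftrightarrow> num z = h (ppair (num x) (LEAST y. Q (num x) y))"
    and dom: "\<And>x z. tm_output M x z \<Longrightarrow> \<exists>y. Q (num x) y"
    using search_machine[of Q h] by metis
  have valid: "\<exists>w. x = self_delim (pfst y) w \<and> length w = (pfst y)\<^sup>2 \<and>
      num w + 1 = 2 ^ (pfst y)\<^sup>2 + pfst (psnd y)" if "Q (num x) y" for x y
  proof -
    let ?k = "pfst y" and ?v = "pfst (psnd y)"
    have v: "?v < 2 ^ ?k\<^sup>2" and x: "num x + 2 = 2 ^ ?k * (2 * 2 ^ ?k\<^sup>2 + 2 * ?v + 1)"
      using that by (auto simp: Q_def)
    obtain w where w: "length w = ?k\<^sup>2" "num w + 1 = 2 ^ ?k\<^sup>2 + ?v" by (rule payload_word[OF v])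
    have "2 * num w + 3 = 2 * 2 ^ ?k\<^sup>2 + 2 * ?v + 1" using w(2) by simp
    then have "num x + 2 = num (self_delim ?k w) + 2" unfolding num_self_delim x by (simp only:)
    then have "x = self_delim ?k w" by (intro num_inj) simp
    then show ?thesis using w by blast
  qed
  have shape: "\<exists>k w. x = self_delim k w \<and> length w = k\<^sup>2" if "x \<in> tm_domain M" for x
    using that dom valid unfolding tm_domain_def by blast
  have "prefix_free (tm_domain M)"
    unfolding prefix_free_def
  proof (intro ballI impI)
    fix x y assume "x \<in> tm_domain M" "y \<in> tm_domain M" and xy: "prefix x y"
    then obtain k w k' w' where "x = self_delim k w" "length w = k\<^sup>2"
      "y = self_delim k' w'" "length w' = k'\<^sup>2" using shape by meson
    then show "x = y" using self_delim_prefix xy by blast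
  qed
  then have "prefix_tm M" using wf by (simp add: prefix_tm_def)
  then obtain \<sigma> where \<sigma>: "\<And>\<pi> y. tm_output U (\<sigma> @ \<pi>) y \<longleftrightarrow> tm_output M \<pi> y"
    using U unfolding universal_prefix_tm_def by blast
  have "\<exists>\<pi>. tm_output U \<pi> w \<and> length \<pi> \<le> k\<^sup>2 + k + (length \<sigma> + 1)"
    if v: "v < 2 ^ k\<^sup>2" and y0: "R k v y0" and all: "\<And>y. R k v y \<Longrightarrow> g k v y = num w" for k v y0 w
  proof -
    obtain p where p: "length p = k\<^sup>2" "num p + 1 = 2 ^ k\<^sup>2 + v" by (rule payload_word[OF v])
    let ?x = "self_delim k p"
    have "2 * num p + 3 = 2 * 2 ^ k\<^sup>2 + 2 * v + 1" using p(2) by simp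
    then have "num ?x + 2 = 2 ^ k * (2 * 2 ^ k\<^sup>2 + 2 * v + 1)"
      unfolding num_self_delim by (simp only:)
    then have "Q (num ?x) (ppair k (ppair v y0))"
      using v y0 unfolding Q_def pfst_ppair psnd_ppair by blast
    then have ex: "\<exists>y. Q (num ?x) y" by blast
    define y where "y = (LEAST y. Q (num ?x) y)"
    have y: "Q (num ?x) y" unfolding y_def using ex by (rule LeastI_ex)
    from valid[OF this] obtain p' where p': "?x = self_delim (pfst y) p'" "length p' = (pfst y)\<^sup>2"
      "num p' + 1 = 2 ^ (pfst y)\<^sup>2 + pfst (psnd y)" by blast
    have len: "length (self_delim k w) = k + 1 + length w" for k w by (simp add: self_delim_def)
    have "k = pfst y" "p = p'" using self_delim_inj[OF p'(1)] by auto
    then have "pfst (psnd y) = v" using p p' by simp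
    then have "R k v (psnd (psnd y))" using y \<open>k = pfst y\<close> by (simp add: Q_def)
    then have "h (ppair (num ?x) y) = num w"
      using all \<open>k = pfst y\<close> \<open>pfst (psnd y) = v\<close> by (simp add: h_def)
    then have "tm_output M ?x w" using out[OF ex] by (simp add: y_def)
    then have "tm_output U (\<sigma> @ ?x) w" by (simp add: \<sigma>)
    moreover have "length (\<sigma> @ ?x) \<le> k\<^sup>2 + k + (length \<sigma> + 1)" using p(1) by (simp add: len)
    ultimately show ?thesis by blast
  qed
  then show ?thesis by blast
qed

lemma tape_word_unique:
  assumes "tape_word t y" "tape_word t z"
  shows "y = z"
proof -
  have inj: "bit_symbol a = bit_symbol b \<longleftrightarrow> a = b" for a b by (auto simp: bit_symbol_def)
  have "\<not> length y < length z" if "tape_word t y" "tape_word t z" for y z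
    using that by (auto simp: tape_word_def)
  then have "length y = length z" using assms by (metis linorder_neqE_nat)
  moreover have "y ! i = z ! i" if "i < length y" for i
    using assms that calculation inj by (auto simp: tape_word_def)
  ultimately show ?thesis by (rule nth_equalityI)
qed

lemma tm_output_unique:
  assumes "tm_output M x y" "tm_output M x z"
  shows "y = z"
  using assms unfolding tm_output_def by (metis reach_halt_unique tape_word_unique)

lemma every_word_printable:
  assumes U: "universal_prefix_tm U"
  shows "\<exists>\<pi>. tm_output U \<pi> w"
proof -
  have "prim_rec_pred (\<lambda>z. True)" "prim_rec (\<lambda>z. pfst (psnd z))" by (intro pr_intros)+
  from payload_program[OF U, of "\<lambda>k v y. True" "\<lambda>k v y. v", OF this]
  obtain C where C: "\<And>k v w. v < 2 ^ k\<^sup>2 \<Longrightarrow> v = num w \<Longrightarrow>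
      \<exists>\<pi>. tm_output U \<pi> w \<and> length \<pi> \<le> k\<^sup>2 + k + C" by metis
  have "num w < 2 ^ num w" by (rule less_exp)
  also have "\<dots> \<le> 2 ^ (num w)\<^sup>2" by (intro power_increasing) (auto simp: power2_eq_square)
  finally show ?thesis using C[OF _ refl] by blast
qed

lemma kolmogorov_le: "tm_output U \<pi> (tuple_code q) \<Longrightarrow> kolmogorov U q \<le> length \<pi>"
  unfolding kolmogorov_def by (rule Least_le) blast

lemma kolmogorov_program:
  assumes "universal_prefix_tm U"
  shows "\<exists>\<pi>. tm_output U \<pi> (tuple_code q) \<and> length \<pi> = kolmogorov U q"
proof -
  have "\<exists>n \<pi>. tm_output U \<pi> (tuple_code q) \<and> n = length \<pi>"
    using every_word_printable[OF assms] by blast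
  from LeastI_ex[OF this] show ?thesis unfolding kolmogorov_def by metis
qed


section \<open>Numeric codes of pairs of rationals\<close>

text \<open>
  \<open>nat_code\<close> recurses along \<open>n div 2\<close>. The closed forms below, in terms of the number of binary
  digits, show that its length and its code are primitive recursive.
\<close>

definition bitlen :: "nat \<Rightarrow> nat" where "bitlen n = card {i. i < n \<and> 2 ^ i \<le> n}"

lemma bitlen_rec: "n > 0 \<Longrightarrow> bitlen n = Suc (bitlen (n div 2))"
proof -
  assume n: "n > 0"
  have drop: "{i. i < m \<and> 2 ^ i \<le> m} = {i. 2 ^ i \<le> m}" for m :: nat
    using less_exp order.strict_trans2 by blast
  have "{i. (2::nat) ^ i \<le> n} = insert 0 (Suc ` {i. 2 ^ i \<le> n div 2})"
  proof (intro set_eqI)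
    fix i
    show "i \<in> {i. (2::nat) ^ i \<le> n} \<longleftrightarrow> i \<in> insert 0 (Suc ` {i. 2 ^ i \<le> n div 2})"
      using n by (cases i) (auto simp: less_eq_div_iff_mult_less_eq mult.commute)
  qed
  moreover have "finite {i. (2::nat) ^ i \<le> n div 2}" unfolding drop[symmetric] by simp
  ultimately show ?thesis unfolding bitlen_def drop by (simp add: card_image)
qed

lemma length_nat_code: "length (nat_code n) = 2 * bitlen n + 1"
proof (induction n rule: less_induct)
  case (less n)
  show ?case
  proof (cases "n = 0")
    case True
    then show ?thesis by (simp add: nat_code.simps bitlen_def)
  next
    case False
    then show ?thesis using less[of "n div 2"] bitlen_rec[of n] by (simp add: nat_code.simps[of n])
  qed
qed

lemma num_nat_code:
  "num (nat_code n) = (\<Sum>i<bitlen n. 4 ^ i * (4 + 2 * (n div 2 ^ i mod 2))) + 4 ^ bitlen n"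
proof (induction n rule: less_induct)
  case (less n)
  show ?case
  proof (cases "n = 0")
    case True
    then show ?thesis by (simp add: nat_code.simps bitlen_def)
  next
    case False
    then have IH: "num (nat_code (n div 2)) = (\<Sum>i<bitlen (n div 2). 4 ^ i * (4 + 2 * (n div 2 div 2 ^ i mod 2)))
       + 4 ^ bitlen (n div 2)" by (intro less) simp
    have "n div 2 ^ Suc i = n div 2 div 2 ^ i" for i by (simp add: div_mult2_eq)
    then show ?thesis using False unfolding bitlen_rec[of n, simplified] sum.lessThan_Suc_shift
      by (subst nat_code.simps)
         (simp add: IH bitlen_rec sum.lessThan_Suc_shift sum_distrib_left mult.assoc mod2_eq_if del: power_Suc sum.lessThan_Suc, simp add: mult.assoc)
  qed
qed

lemma pr_bitlen: "prim_rec bitlen"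
  unfolding bitlen_def by (intro pr_intros)

lemma pr_length_nat_code: "prim_rec (\<lambda>n. length (nat_code n))"
  unfolding length_nat_code by (intro pr_intros pr_bitlen)

lemma pr_num_nat_code: "prim_rec (\<lambda>n. num (nat_code n))"
  unfolding num_nat_code by (intro pr_intros pr_bitlen)

definition rat_bits :: "nat \<Rightarrow> bool list" where
  "rat_bits p = (pfst p \<noteq> 0) # nat_code (pfst (psnd p)) @ nat_code (psnd (psnd p))"

definition pair_bits :: "nat \<Rightarrow> bool list" where
  "pair_bits z = rat_bits (pfst z) @ rat_bits (psnd z)"

lemma pr_num_pair_bits: "prim_rec (\<lambda>z. num (pair_bits z))"
proof -
  note nc = prim_rec.comp[OF pr_num_nat_code] prim_rec.comp[OF pr_length_nat_code]
  have n: "prim_rec (\<lambda>p. num (rat_bits p))"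
    unfolding rat_bits_def num_append num.simps by (intro pr_intros nc)
  have l: "prim_rec (\<lambda>p. length (rat_bits p))"
    unfolding rat_bits_def length_append list.size by (intro pr_intros nc)
  show ?thesis
    unfolding pair_bits_def num_append by (intro pr_intros prim_rec.comp[OF n] prim_rec.comp[OF l])
qed

lemma nat_code_append_inj: "nat_code a @ xs = nat_code b @ ys \<Longrightarrow> a = b \<and> xs = ys"
proof (induction a arbitrary: b rule: less_induct)
  case (less a)
  show ?case
  proof (cases "a = 0 \<or> b = 0")
    case True
    then show ?thesis using less.prems by (auto simp: nat_code.simps[of a] nat_code.simps[of b] split: if_splits)
  next
    case False
    then have "odd a = odd b" "nat_code (a div 2) @ xs = nat_code (b div 2) @ ys"
      using less.prems by (auto simp: nat_code.simps[of a] nat_code.simps[of b])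
    then have "a div 2 = b div 2 \<and> xs = ys" using False by (intro less.IH) auto
    moreover have "a mod 2 = b mod 2" using \<open>odd a = odd b\<close> by (simp add: mod2_eq_if)
    ultimately show ?thesis by (metis div_mult_mod_eq)
  qed
qed

text \<open>
  The sign of a rational is a single bit, so codes with a sign digit above 1 have to be excluded.
\<close>

lemma pair_bits_inj:
  assumes "pair_bits z = pair_bits z'"
    and "pfst (pfst z) \<le> 1" "pfst (psnd z) \<le> 1" "pfst (pfst z') \<le> 1" "pfst (psnd z') \<le> 1"
  shows "z = z'"
proof -
  have rat: "p = p' \<and> xs = ys" if "rat_bits p @ xs = rat_bits p' @ ys" "pfst p \<le> 1" "pfst p' \<le> 1" for p p' xs ys
  proof -
    have 1: "(pfst p \<noteq> 0) = (pfst p' \<noteq> 0)"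
      and 2: "nat_code (pfst (psnd p)) @ nat_code (psnd (psnd p)) @ xs =
          nat_code (pfst (psnd p')) @ nat_code (psnd (psnd p')) @ ys"
      using that(1) by (auto simp: rat_bits_def)
    have "pfst p = pfst p'" using 1 that(2,3) by auto
    moreover have "pfst (psnd p) = pfst (psnd p')" "psnd (psnd p) = psnd (psnd p')" "xs = ys"
      using nat_code_append_inj[OF 2] nat_code_append_inj by blast+
    ultimately show ?thesis by (metis ppair_collapse)
  qed
  have "pfst z = pfst z'" "rat_bits (psnd z) = rat_bits (psnd z')"
    using assms rat[of "pfst z" "rat_bits (psnd z)" "pfst z'"] by (auto simp: pair_bits_def)
  moreover have "psnd z = psnd z'"
    using rat[of "psnd z" "[]" "psnd z'" "[]"] calculation(2) assms by simp
  ultimately show ?thesis by (metis ppair_collapse)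
qed

definition rat_num :: "rat \<Rightarrow> nat" where
  "rat_num q = (let (a, b) = quotient_of q in ppair (of_bool (a < 0)) (ppair (nat \<bar>a\<bar>) (nat b)))"

definition vec_num :: "rat ^ 2 \<Rightarrow> nat" where
  "vec_num q = ppair (rat_num (q $ 2)) (rat_num (q $ 1))"

text \<open>
  A denominator 0, which no rational has, is read as 1. The value is thereby a quotient with a
  visibly positive denominator.
\<close>

definition rat_val :: "nat \<Rightarrow> rat" where
  "rat_val p = (if pfst p = 0 then 1 else - 1) * of_nat (pfst (psnd p)) / of_nat (Suc (psnd (psnd p) - 1))"

lemma rat_bits_rat_num: "rat_bits (rat_num q) = rat_code q"
  by (cases "quotient_of q") (simp add: rat_bits_def rat_num_def rat_code_def)

lemma pfst_rat_num: "pfst (rat_num q) \<le> 1"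
  by (cases "quotient_of q") (simp add: rat_num_def)

lemma rat_val_rat_num: "rat_val (rat_num q) = q"
proof -
  obtain a b where q: "quotient_of q = (a, b)" by (cases "quotient_of q")
  have b: "b > 0" using quotient_of_denom_pos[OF q] .
  have "q = of_int a / of_int b" by (rule quotient_of_div[OF q])
  moreover have "Suc (nat b - 1) = nat b" using b by simp
  then have "(of_nat (Suc (nat b - 1)) :: rat) = of_int b" using b by simp
  ultimately show ?thesis
    unfolding rat_val_def rat_num_def q by (cases "a < 0") (simp_all del: of_nat_Suc)
qed

lemma tuple_code_2: "tuple_code (q :: rat ^ 2) = pair_bits (vec_num q)"
proof -
  have "(UNIV :: 2 set) = {2, 1}" by (simp add: UNIV_2 insert_commute)
  moreover have "(2 :: 2) < 1"
    by (simp add: less_bit0_def bit0.Rep_numeral bit0.Rep_1)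
  then have "sorted_list_of_set {2, 1 :: 2} = [2, 1]" by (simp add: less_imp_le)
  ultimately have "sorted_list_of_set (UNIV :: 2 set) = [2, 1]" by (simp only:)
  then show ?thesis by (simp add: tuple_code_def pair_bits_def vec_num_def rat_bits_rat_num)
qed

lemma vec_num_sign: "pfst (pfst (vec_num q)) \<le> 1" "pfst (psnd (vec_num q)) \<le> 1"
  unfolding vec_num_def pfst_ppair psnd_ppair by (rule pfst_rat_num)+


section \<open>Simulating a Turing machine primitive recursively\<close>

text \<open>
  A tape over \<open>B\<close> symbols is stored as a number in base \<open>B\<close>, the contents of cell \<open>i\<close> being its digit
  at position \<open>int_encode i\<close>. Writing a cell is \<open>digit_update\<close>.
\<close>

definition digit :: "nat \<Rightarrow> nat \<Rightarrow> nat \<Rightarrow> nat" where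
  "digit B C j = C div B ^ j mod B"

lemma digit_split:
  assumes "lo < B ^ h" "s < B"
  shows "digit B (lo + B ^ h * (s + B * hi)) j =
     (if j < h then digit B lo j else if j = h then s else digit B hi (j - Suc h))"
proof -
  have B: "B > 0" using assms(2) by simp
  consider "j < h" | "j = h" | "j > h" by linarith
  then show ?thesis
  proof cases
    case 1
    define i where "i = h - Suc j"
    have h: "h = j + Suc i" using 1 by (simp add: i_def)
    have "(lo + B ^ j * X) div B ^ j = lo div B ^ j + X" for X using B by simp
    moreover have "(lo + B ^ h * (s + B * hi)) = lo + B ^ j * (B * (B ^ i * (s + B * hi)))"
      by (simp add: h power_add mult.assoc)
    ultimately have "(lo + B ^ h * (s + B * hi)) div B ^ j = lo div B ^ j + B * (B ^ i * (s + B * hi))"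
      by (simp only:)
    then show ?thesis using 1 by (simp add: digit_def)
  next
    case 2
    then show ?thesis using assms B by (simp add: digit_def)
  next
    case 3
    define i where "i = j - Suc h"
    have j: "j = h + Suc i" using 3 by (simp add: i_def)
    have "(lo + B ^ h * (s + B * hi)) div B ^ h = s + B * hi" using assms B by simp
    moreover have "(s + B * hi) div B = hi" using assms B by simp
    ultimately have "(lo + B ^ h * (s + B * hi)) div B ^ j = hi div B ^ i"
      unfolding j power_add power_Suc by (simp add: div_mult2_eq)
    then show ?thesis using 3 by (simp add: digit_def i_def)
  qed
qed

lemma digit_update:
  assumes "s < B"
  shows "digit B (C + s * B ^ h - digit B C h * B ^ h) j = (if j = h then s else digit B C j)"
proof -
  have B: "B > 0" using assms by simp
  define lo hi where "lo = C mod B ^ h" and "hi = C div B ^ Suc h"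
  let ?d = "digit B C h"
  have lo: "lo < B ^ h" and d: "?d < B" using B by (simp_all add: lo_def digit_def)
  have "C div B ^ h = ?d + B * hi"
    using mult_div_mod_eq[of B "C div B ^ h"]
    by (simp add: digit_def hi_def div_mult2_eq mult.commute[of B] add.commute)
  then have C: "C = lo + B ^ h * (?d + B * hi)"
    using mult_div_mod_eq[of "B ^ h" C] by (simp add: lo_def)
  have "C + s * B ^ h = (lo + B ^ h * (s + B * hi)) + ?d * B ^ h"
    by (subst C) (simp add: algebra_simps)
  then have "C + s * B ^ h - ?d * B ^ h = lo + B ^ h * (s + B * hi)" by simp
  moreover have "digit B C j = digit B (lo + B ^ h * (?d + B * hi)) j" using C by simp
  ultimately show ?thesis
    using digit_split[OF lo assms] digit_split[OF lo d] by simp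
qed

lemma digit_sum:
  assumes "\<And>i. d i < B"
  shows "digit B (\<Sum>i<n. d i * B ^ i) m = (if m < n then d m else 0)"
  using assms
proof (induction n arbitrary: d m)
  case 0
  then show ?case by (simp add: digit_def)
next
  case (Suc n)
  have B: "B > 0" using Suc.prems[of 0] by simp
  have "(\<Sum>i<Suc n. d i * B ^ i) = d 0 + B * (\<Sum>i<n. d (Suc i) * B ^ i)"
    unfolding sum.lessThan_Suc_shift by (simp add: sum_distrib_left algebra_simps)
  then have "digit B (\<Sum>i<Suc n. d i * B ^ i) m =
      (if m = 0 then d 0 else digit B (\<Sum>i<n. d (Suc i) * B ^ i) (m - 1))"
    using digit_split[of 0 B 0 "d 0" "\<Sum>i<n. d (Suc i) * B ^ i" m] Suc.prems[of 0] by simp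
  then show ?case using Suc.IH[of "\<lambda>i. d (Suc i)" "m - 1"] Suc.prems by auto
qed

fun tup :: "nat list \<Rightarrow> nat" where
  "tup [] = 0"
| "tup (x # xs) = ppair x (tup xs)"

definition comp_at :: "nat \<Rightarrow> nat \<Rightarrow> nat" where
  "comp_at j v = pfst ((psnd ^^ j) v)"

lemma comp_at_tup: "j < length xs \<Longrightarrow> comp_at j (tup xs) = xs ! j"
proof (induction xs arbitrary: j)
  case (Cons x xs)
  then show ?case by (cases j) (auto simp: comp_at_def funpow_Suc_right simp del: funpow.simps(2))
qed simp

lemma tup_inj: "length xs = length ys \<Longrightarrow> tup xs = tup ys \<Longrightarrow> xs = ys"
  by (induction xs ys rule: list_induct2) auto

lemma pr_comp_at [pr_intros]: assumes "prim_rec f" shows "prim_rec (\<lambda>x. comp_at j (f x))"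
proof -
  have "prim_rec (\<lambda>x. (psnd ^^ j) (f x))" using assms by (induction j) (auto intro: pr_intros)
  then show ?thesis unfolding comp_at_def by (rule pr_pfst)
qed

lemma pr_tup [pr_intros]:
  assumes "\<And>j. j \<in> set js \<Longrightarrow> prim_rec (f j)"
  shows "prim_rec (\<lambda>x. tup (map (\<lambda>j. f j x) js))"
  using assms by (induction js) (auto intro!: pr_intros)

definition move_code :: "nat \<Rightarrow> nat \<Rightarrow> nat" where
  "move_code m h =
     (if m = 0 then (if h = 0 then 1 else if h mod 2 = 0 then h - 2 else h + 2)
      else if m = 1 then h
      else (if h mod 2 = 0 then h + 2 else if h = 1 then 0 else h - 2))"

fun move_num :: "move \<Rightarrow> nat" where
  "move_num Move_Left = 0" | "move_num Stay = 1" | "move_num Move_Right = 2"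

lemma int_encode_simps: "int_encode i = (if 0 \<le> i then 2 * nat i else Suc (2 * nat (- i - 1)))"
  by (simp add: int_encode_def sum_encode_def)

lemma move_code_correct: "move_code (move_num m) (int_encode i) = int_encode (i + shift m)"
proof (cases m)
  case Move_Left
  then show ?thesis by (auto simp: move_code_def int_encode_simps mod_Suc nat_eq_iff)
next
  case Stay
  then show ?thesis by (simp add: move_code_def)
next
  case Move_Right
  then show ?thesis by (auto simp: move_code_def int_encode_simps mod_Suc nat_eq_iff)
qed

lemma pr_move_code [pr_intros]: "prim_rec f \<Longrightarrow> prim_rec g \<Longrightarrow> prim_rec (\<lambda>x. move_code (f x) (g x))"
  unfolding move_code_def by (intro pr_intros)

definition tape_rep :: "nat \<Rightarrow> nat \<Rightarrow> tape \<Rightarrow> bool" where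
  "tape_rep B c t \<longleftrightarrow> (\<forall>i. fst t i = digit B (pfst c) (int_encode i)) \<and> psnd c = int_encode (snd t)"

definition sym_at :: "nat \<Rightarrow> nat \<Rightarrow> nat" where
  "sym_at B c = digit B (pfst c) (psnd c)"

lemma scanned_rep: "tape_rep B c t \<Longrightarrow> scanned t = sym_at B c"
  by (simp add: tape_rep_def scanned_def sym_at_def)

definition act_code :: "nat \<Rightarrow> nat \<Rightarrow> nat \<Rightarrow> nat" where
  "act_code B c a = ppair (pfst c + pfst a * B ^ psnd c - sym_at B c * B ^ psnd c) (move_code (psnd a) (psnd c))"

lemma act_rep:
  assumes "tape_rep B c t" "fst a < B"
  shows "tape_rep B (act_code B c (ppair (fst a) (move_num (snd a)))) (act t a)"
  using assms
  by (auto simp: tape_rep_def act_def act_code_def sym_at_def digit_update move_code_correct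
       inj_eq[OF inj_int_encode])

locale tm_sim =
  fixes M :: turing_machine
  assumes wf: "wf_tm M"
begin

abbreviation "B \<equiv> num_symbols M"
abbreviation "k \<equiv> num_tapes M"

lemma B3: "B \<ge> 3" and k1: "k \<ge> 1" and ns1: "num_states M \<ge> 1"
  using wf by (auto simp: wf_tm_def)

definition key :: "nat \<Rightarrow> nat" where
  "key c = ppair (pfst c) (tup (map (\<lambda>j. sym_at B (comp_at j (psnd c))) [0..<k]))"

text \<open>
  The finitely many arguments at which the transition function is consulted.
\<close>

definition keys :: "nat set" where
  "keys = (\<lambda>(q, ss). ppair q (tup ss)) ` ({..<num_states M} \<times> {ss. set ss \<subseteq> {..<B} \<and> length ss = k})"

definition lookup :: "nat \<Rightarrow> (nat \<times> (nat \<times> move) list) option" where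
  "lookup x = (if x \<in> keys then transition M (pfst x) (map (\<lambda>j. comp_at j (psnd x)) [0..<k]) else None)"

definition next_state :: "nat \<Rightarrow> nat" where
  "next_state x = (case lookup x of None \<Rightarrow> 0 | Some (q, acts) \<Rightarrow> Suc q)"

definition next_act :: "nat \<Rightarrow> nat \<Rightarrow> nat" where
  "next_act j x = (case lookup x of None \<Rightarrow> 0 | Some (q, acts) \<Rightarrow>
     ppair (fst (acts ! j)) (move_num (snd (acts ! j))))"

lemma finite_keys: "finite keys"
  unfolding keys_def by (intro finite_imageI finite_cartesian_product finite_lists_length_eq) auto

lemma pr_next: "prim_rec next_state" "prim_rec (next_act j)"
  by (rule pr_finite_support[OF finite_keys, where c=0], simp add: next_state_def next_act_def lookup_def)+

definition cstep :: "nat \<Rightarrow> nat" where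
  "cstep c = (if next_state (key c) = 0 then c else
     ppair (next_state (key c) - 1)
       (tup (map (\<lambda>j. act_code B (comp_at j (psnd c)) (next_act j (key c))) [0..<k])))"

lemma pr_sym_at: "prim_rec f \<Longrightarrow> prim_rec (\<lambda>x. sym_at B (f x))"
  unfolding sym_at_def digit_def by (intro pr_intros)

lemma pr_key: "prim_rec key"
  unfolding key_def by (intro pr_intros pr_sym_at)

lemma pr_cstep: "prim_rec cstep"
  unfolding cstep_def act_code_def
  by (intro pr_intros pr_sym_at prim_rec.comp[OF pr_next(1)] prim_rec.comp[OF pr_next(2)] pr_key)

definition cfg_rep :: "nat \<Rightarrow> config \<Rightarrow> bool" where
  "cfg_rep c C \<longleftrightarrow> pfst c = fst C \<and> fst C < num_states M \<and> length (snd C) = k \<and>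
     (\<forall>j<k. tape_rep B (comp_at j (psnd c)) (snd C ! j))"

lemma cfg_rep_lookup:
  assumes "cfg_rep c C"
  shows "lookup (key c) = transition M (fst C) (map scanned (snd C))"
    and "\<And>s. s \<in> set (map scanned (snd C)) \<Longrightarrow> s < B"
proof -
  have len: "length (snd C) = k" using assms by (simp add: cfg_rep_def)
  have ss: "map scanned (snd C) = map (\<lambda>j. sym_at B (comp_at j (psnd c))) [0..<k]"
    using assms by (intro nth_equalityI) (auto simp: cfg_rep_def scanned_rep)
  have lt: "sym_at B c' < B" for c' using B3 by (simp add: sym_at_def digit_def)
  then show "s < B" if "s \<in> set (map scanned (snd C))" for s using that unfolding ss by auto
  have key: "key c = ppair (fst C) (tup (map scanned (snd C)))"
    using assms unfolding key_def ss by (simp add: cfg_rep_def)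
  have "set (map scanned (snd C)) \<subseteq> {..<B}" using lt unfolding ss by auto
  then have "key c \<in> keys"
    unfolding key keys_def
    by (intro image_eqI[of _ _ "(fst C, map scanned (snd C))"]) (use assms in \<open>auto simp: cfg_rep_def\<close>)
  moreover have "map (\<lambda>j. comp_at j (psnd (key c))) [0..<k] = map scanned (snd C)"
    unfolding key using len by (intro nth_equalityI) (auto simp: comp_at_tup)
  ultimately show "lookup (key c) = transition M (fst C) (map scanned (snd C))"
    unfolding lookup_def by (simp add: key)
qed

lemma cfg_rep_step:
  assumes "cfg_rep c C"
  shows "next_state (key c) = 0 \<longleftrightarrow> step M C = None"
    and "step M C = Some C' \<Longrightarrow> cfg_rep (cstep c) C'"
proof -
  note lk = cfg_rep_lookup[OF assms]
  show "next_state (key c) = 0 \<longleftrightarrow> step M C = None"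
    by (auto simp: next_state_def lk(1) step_def split: option.splits)
  assume "step M C = Some C'"
  then obtain q' acts where tr: "transition M (fst C) (map scanned (snd C)) = Some (q', acts)"
    and C': "C' = (q', map2 act (snd C) acts)" by (auto simp: step_def split: option.splits)
  have len: "length (snd C) = k" "fst C < num_states M" using assms by (auto simp: cfg_rep_def)
  have w: "q' < num_states M" "length acts = k" "\<And>a. a \<in> set acts \<Longrightarrow> fst a < B"
    using wf tr len lk(2) unfolding wf_tm_def by (metis length_map)+
  have "next_state (key c) = Suc q'" by (simp add: next_state_def lk(1) tr)
  then have st: "cstep c = ppair q'
       (tup (map (\<lambda>j. act_code B (comp_at j (psnd c)) (next_act j (key c))) [0..<k]))"
    by (simp add: cstep_def)
  have "tape_rep B (comp_at j (psnd (cstep c))) (snd C' ! j)" if "j < k" for j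
  proof -
    have "comp_at j (psnd (cstep c)) = act_code B (comp_at j (psnd c)) (ppair (fst (acts ! j)) (move_num (snd (acts ! j))))"
      using that by (simp add: st comp_at_tup next_act_def lk(1) tr)
    moreover have "snd C' ! j = act (snd C ! j) (acts ! j)" using that len w by (simp add: C')
    moreover have "fst (acts ! j) < B" using that w by (intro w(3)) simp
    ultimately show ?thesis using assms that by (simp add: cfg_rep_def act_rep)
  qed
  then show "cfg_rep (cstep c) C'" using w len by (simp add: cfg_rep_def st C')
qed

text \<open>
  The input symbol in cell \<open>i\<close> for the program with number \<open>p\<close>, see \<open>bit_at_num\<close>.
\<close>

definition bit_at :: "nat \<Rightarrow> nat \<Rightarrow> nat" where
  "bit_at p i = (let v = ((\<lambda>v. (v - 1) div 2) ^^ i) p in if v = 0 then 0 else if v mod 2 = 0 then 2 else 1)"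

lemma bit_at_num: "bit_at (num x) i = (if i < length x then bit_symbol (x ! i) else 0)"
proof (induction x arbitrary: i)
  case Nil
  have "((\<lambda>v::nat. (v - 1) div 2) ^^ i) 0 = 0" by (induction i) auto
  then show ?case by (simp add: bit_at_def)
next
  case (Cons b x)
  have "(num (b # x) - 1) div 2 = num x" by simp
  then have "bit_at (num (b # x)) (Suc i) = bit_at (num x) i" for i
    unfolding bit_at_def funpow_Suc_right by simp
  moreover have "bit_at (num (b # x)) 0 = bit_symbol b"
    by (auto simp: bit_at_def bit_symbol_def mod_Suc)
  ultimately show ?case using Cons.IH by (cases i) auto
qed

lemma bit_at_less: "bit_at p i < B"
  using B3 by (auto simp: bit_at_def Let_def)

definition init_code :: "nat \<Rightarrow> nat" where
  "init_code p = ppair 0 (tup (map (\<lambda>j. ppair (if j = 0 then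
      \<Sum>i<2 * p. (if i mod 2 = 0 then bit_at p (i div 2) else 0) * B ^ i else 0) 0) [0..<k]))"

lemma pr_bit_at: "prim_rec f \<Longrightarrow> prim_rec g \<Longrightarrow> prim_rec (\<lambda>x. bit_at (f x) (g x))"
  unfolding bit_at_def Let_def
  by (intro pr_intros pr_funpow[where F="\<lambda>v x. (v - 1) div 2"]; assumption)

lemma pr_init_code: "prim_rec init_code"
  unfolding init_code_def by (intro pr_intros pr_bit_at)

lemma length_le_num: "length x \<le> num x"
  by (induction x) auto

lemma init_rep: "cfg_rep (init_code (num x)) (initial_config M x)"
proof -
  have tape: "tape_rep B (ppair (\<Sum>i<2 * num x. (if i mod 2 = 0 then bit_at (num x) (i div 2) else 0) * B ^ i) 0)
      (input_tape x)"
  proof -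
    have "digit B (\<Sum>i<2 * num x. (if i mod 2 = 0 then bit_at (num x) (i div 2) else 0) * B ^ i) m =
       (if m < 2 * num x then if m mod 2 = 0 then bit_at (num x) (m div 2) else 0 else 0)" for m
      by (rule digit_sum) (use bit_at_less B3 in auto)
    then show ?thesis using length_le_num[of x]
      by (auto simp: tape_rep_def input_tape_def int_encode_simps bit_at_num mod_Suc)
  qed
  have "tape_rep B (ppair 0 0) (input_tape [])"
    by (auto simp: tape_rep_def input_tape_def int_encode_simps digit_def)
  then have "tape_rep B (comp_at j (psnd (init_code (num x)))) (snd (initial_config M x) ! j)" if "j < k" for j
    using that tape by (cases j) (simp_all add: init_code_def comp_at_tup initial_config_def)
  then show ?thesis using ns1 k1 by (simp add: cfg_rep_def init_code_def initial_config_def)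
qed

definition cell :: "nat \<Rightarrow> nat \<Rightarrow> nat" where
  "cell c i = digit B (pfst (comp_at (k - 1) (psnd c))) (2 * i)"

definition out_len :: "nat \<Rightarrow> nat" where
  "out_len c = card {i. i < pfst (comp_at (k - 1) (psnd c)) \<and> (\<forall>j<Suc i. cell c j = 1 \<or> cell c j = 2)}"

definition out_num :: "nat \<Rightarrow> nat" where
  "out_num c = (\<Sum>i<out_len c. cell c i * 2 ^ i)"

lemma pr_out_num: "prim_rec out_num"
proof -
  have cell: "prim_rec f \<Longrightarrow> prim_rec g \<Longrightarrow> prim_rec (\<lambda>x. cell (f x) (g x))" for f g
    unfolding cell_def digit_def by (intro pr_intros)
  have "prim_rec out_len" unfolding out_len_def by (intro pr_intros cell)
  then show ?thesis unfolding out_num_def by (intro pr_intros cell)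
qed

lemma num_eq_sum: "num y = (\<Sum>i<length y. bit_symbol (y ! i) * 2 ^ i)"
proof (induction y)
  case (Cons b y)
  then show ?case
    by (simp add: sum.lessThan_Suc_shift bit_symbol_def sum_distrib_left mult_ac del: sum.lessThan_Suc)
qed simp

lemma out_num_rep:
  assumes "cfg_rep c C" "tape_word (last (snd C)) y"
  shows "out_num c = num y"
proof -
  let ?t = "last (snd C)" and ?c = "comp_at (k - 1) (psnd c)"
  have len: "length (snd C) = k" using assms by (simp add: cfg_rep_def)
  then have "?t = snd C ! (k - 1)" using k1 by (intro trans[OF last_conv_nth]) auto
  then have t: "tape_rep B ?c ?t" using assms(1) k1 by (simp add: cfg_rep_def)
  have cell: "cell c i = fst ?t (int i)" for i
    using t by (simp add: cell_def tape_rep_def int_encode_simps)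
  have bit: "cell c i = bit_symbol (y ! i)" if "i < length y" for i
    using assms(2) that by (simp add: cell tape_word_def)
  have bs: "v = 1 \<or> v = 2 \<longleftrightarrow> v \<in> range bit_symbol" for v
    by (auto simp: bit_symbol_def image_iff)
  have fin: "i < pfst ?c" if "cell c i \<noteq> 0" for i
  proof -
    have "B ^ (2 * i) \<le> pfst ?c"
      using that by (metis cell_def digit_def div_less mod_0 not_le)
    moreover have "i < 2 ^ i" by (rule less_exp)
    moreover have "(2::nat) ^ i \<le> B ^ i" using B3 by (intro power_mono) auto
    moreover have "B ^ i \<le> B ^ (2 * i)" using B3 by (intro power_increasing) auto
    ultimately show ?thesis by linarith
  qed
  have "{i. i < pfst ?c \<and> (\<forall>j<Suc i. cell c j = 1 \<or> cell c j = 2)} = {..<length y}"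
  proof (intro set_eqI iffI)
    fix i assume "i \<in> {i. i < pfst ?c \<and> (\<forall>j<Suc i. cell c j = 1 \<or> cell c j = 2)}"
    then have "\<forall>j\<le>i. cell c j \<in> range bit_symbol" using bs by (simp add: less_Suc_eq_le)
    moreover have "cell c (length y) \<notin> range bit_symbol" using assms(2) by (simp add: cell tape_word_def)
    ultimately show "i \<in> {..<length y}" by (metis lessThan_iff not_le)
  next
    fix i assume "i \<in> {..<length y}"
    then have "\<forall>j<Suc i. cell c j = 1 \<or> cell c j = 2" using bit bs by (simp add: less_Suc_eq_le)
    moreover from this have "i < pfst ?c" by (intro fin) auto
    ultimately show "i \<in> {i. i < pfst ?c \<and> (\<forall>j<Suc i. cell c j = 1 \<or> cell c j = 2)}" by simp
  qed
  then have "out_len c = length y" by (simp add: out_len_def)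
  then show ?thesis using bit by (simp add: out_num_def num_eq_sum)
qed

text \<open>
  The value is 0 as long as the machine runs. Since a halted configuration is a fixed point of
  \<open>cstep\<close>, the value never changes afterwards.
\<close>

definition sim :: "nat \<Rightarrow> nat \<Rightarrow> nat" where
  "sim p t = (let c = (cstep ^^ t) (init_code p) in if next_state (key c) = 0 then Suc (out_num c) else 0)"

lemma pr_sim: "prim_rec (\<lambda>z. sim (pfst z) (psnd z))"
proof -
  have "prim_rec (\<lambda>z. (cstep ^^ psnd z) (init_code (pfst z)))"
    by (intro pr_funpow[where F="\<lambda>v x. cstep v"] prim_rec.comp[OF pr_cstep] prim_rec.comp[OF pr_init_code] pr_intros)
  then show ?thesis unfolding sim_def Let_def
    by (intro pr_intros prim_rec.comp[OF pr_next(1)] prim_rec.comp[OF pr_key] prim_rec.comp[OF pr_out_num])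
qed

lemma sim_stable:
  assumes "sim p t \<noteq> 0" "t \<le> t'"
  shows "sim p t' = sim p t"
proof -
  have "(cstep ^^ n) c = c" if "next_state (key c) = 0" for n c
    using that by (induction n) (auto simp: cstep_def)
  moreover have "(cstep ^^ t') (init_code p) = (cstep ^^ (t' - t)) ((cstep ^^ t) (init_code p))"
    using assms(2) by (simp flip: funpow_add[THEN fun_cong, unfolded comp_def])
  moreover have "next_state (key ((cstep ^^ t) (init_code p))) = 0"
    using assms(1) by (simp add: sim_def Let_def split: if_splits)
  ultimately show ?thesis by (simp add: sim_def)
qed

lemma sim_output:
  assumes "tm_output M x y"
  shows "\<exists>t. sim (num x) t = Suc (num y)"
proof -
  obtain C where C: "tm_reach M (initial_config M x) C" "step M C = None" "tape_word (last (snd C)) y"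
    using assms by (auto simp: tm_output_def)
  from C(1) have "\<exists>t. cfg_rep ((cstep ^^ t) (init_code (num x))) C"
  proof (induction rule: rtranclp_induct)
    case base
    show ?case by (rule exI[of _ 0]) (simp add: init_rep)
  next
    case (step C C')
    then obtain t where "cfg_rep ((cstep ^^ t) (init_code (num x))) C" by blast
    from cfg_rep_step(2)[OF this step.hyps(2)] show ?case by (intro exI[of _ "Suc t"]) simp
  qed
  then obtain t where t: "cfg_rep ((cstep ^^ t) (init_code (num x))) C" by blast
  then have "sim (num x) t = Suc (num y)"
    using cfg_rep_step(1)[OF t] C(2) out_num_rep[OF t C(3)] by (simp add: sim_def)
  then show ?thesis by blast
qed

end


section \<open>Primitive recursive rational arithmetic\<close>

definition prim_rec_rat :: "(nat \<Rightarrow> rat) \<Rightarrow> bool" where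
  "prim_rec_rat f \<longleftrightarrow> (\<exists>a b c. prim_rec a \<and> prim_rec b \<and> prim_rec c \<and>
     (\<forall>x. f x = (of_nat (a x) - of_nat (b x)) / of_nat (Suc (c x))))"

lemma prqI:
  assumes "prim_rec a" "prim_rec b" "prim_rec c" "\<And>x. f x = (of_nat (a x) - of_nat (b x)) / of_nat (Suc (c x))"
  shows "prim_rec_rat f"
  using assms unfolding prim_rec_rat_def by blast

lemma prqE:
  assumes "prim_rec_rat f"
  obtains a b c where "prim_rec a" "prim_rec b" "prim_rec c" "\<And>x. f x = (of_nat (a x) - of_nat (b x)) / of_nat (Suc (c x))"
  using assms unfolding prim_rec_rat_def by blast

lemma prq_of_nat [pr_intros]: "prim_rec f \<Longrightarrow> prim_rec_rat (\<lambda>x. of_nat (f x))"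
  by (rule prqI[of f "\<lambda>_. 0" "\<lambda>_. 0"]) (auto intro: pr_intros)

lemma prq_one [pr_intros]: "prim_rec_rat (\<lambda>x. 1)"
  using prq_of_nat[OF pr_const, of 1] by simp

lemma prq_zero [pr_intros]: "prim_rec_rat (\<lambda>x. 0)"
  using prq_of_nat[OF pr_const, of 0] by simp

lemma prq_add [pr_intros]:
  assumes "prim_rec_rat f" "prim_rec_rat g" shows "prim_rec_rat (\<lambda>x. f x + g x)"
proof -
  obtain a b c where 1: "prim_rec a" "prim_rec b" "prim_rec c" "\<And>x. f x = (of_nat (a x) - of_nat (b x)) / of_nat (Suc (c x))"
    using assms(1) by (rule prqE) (rule that)
  obtain a' b' c' where 2: "prim_rec a'" "prim_rec b'" "prim_rec c'" "\<And>x. g x = (of_nat (a' x) - of_nat (b' x)) / of_nat (Suc (c' x))"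
    using assms(2) by (rule prqE) (rule that)
  show ?thesis
  proof (rule prqI)
    show "prim_rec (\<lambda>x. a x * Suc (c' x) + a' x * Suc (c x))" "prim_rec (\<lambda>x. b x * Suc (c' x) + b' x * Suc (c x))"
      "prim_rec (\<lambda>x. Suc (c x) * Suc (c' x) - 1)" by (intro pr_intros 1 2)+
    show "f x + g x = (of_nat (a x * Suc (c' x) + a' x * Suc (c x)) -
        of_nat (b x * Suc (c' x) + b' x * Suc (c x))) / of_nat (Suc (Suc (c x) * Suc (c' x) - 1))" for x
    proof -
      have "of_nat (Suc (c x)) \<noteq> (0::rat)" "of_nat (Suc (c' x)) \<noteq> (0::rat)" by (simp_all only: of_nat_eq_0_iff)
      moreover have "Suc (Suc (c x) * Suc (c' x) - 1) = Suc (c x) * Suc (c' x)" by simp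
      ultimately show ?thesis unfolding 1(4) 2(4)
        by (simp only: of_nat_mult of_nat_add) (simp add: divide_simps del: of_nat_Suc, simp add: algebra_simps)
    qed
  qed
qed

lemma prq_uminus [pr_intros]:
  assumes "prim_rec_rat f" shows "prim_rec_rat (\<lambda>x. - f x)"
proof -
  obtain a b c where 1: "prim_rec a" "prim_rec b" "prim_rec c" "\<And>x. f x = (of_nat (a x) - of_nat (b x)) / of_nat (Suc (c x))"
    using assms by (rule prqE) (rule that)
  show ?thesis by (rule prqI[OF 1(2,1,3)]) (simp add: 1(4) minus_divide_left)
qed

lemma prq_diff [pr_intros]: "prim_rec_rat f \<Longrightarrow> prim_rec_rat g \<Longrightarrow> prim_rec_rat (\<lambda>x. f x - g x)"
  using prq_add[OF _ prq_uminus, of f g] by simp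

lemma prq_mult [pr_intros]:
  assumes "prim_rec_rat f" "prim_rec_rat g" shows "prim_rec_rat (\<lambda>x. f x * g x)"
proof -
  obtain a b c where 1: "prim_rec a" "prim_rec b" "prim_rec c" "\<And>x. f x = (of_nat (a x) - of_nat (b x)) / of_nat (Suc (c x))"
    using assms(1) by (rule prqE) (rule that)
  obtain a' b' c' where 2: "prim_rec a'" "prim_rec b'" "prim_rec c'" "\<And>x. g x = (of_nat (a' x) - of_nat (b' x)) / of_nat (Suc (c' x))"
    using assms(2) by (rule prqE) (rule that)
  show ?thesis
  proof (rule prqI)
    show "prim_rec (\<lambda>x. a x * a' x + b x * b' x)" "prim_rec (\<lambda>x. a x * b' x + b x * a' x)"
      "prim_rec (\<lambda>x. Suc (c x) * Suc (c' x) - 1)" by (intro pr_intros 1 2)+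
    show "f x * g x = (of_nat (a x * a' x + b x * b' x) - of_nat (a x * b' x + b x * a' x)) /
        of_nat (Suc (Suc (c x) * Suc (c' x) - 1))" for x
    proof -
      have "Suc (Suc (c x) * Suc (c' x) - 1) = Suc (c x) * Suc (c' x)" by simp
      then show ?thesis unfolding 1(4) 2(4)
        by (simp only: of_nat_mult of_nat_add) (simp add: algebra_simps del: of_nat_Suc)
    qed
  qed
qed

lemma prq_inverse [pr_intros]:
  assumes "prim_rec_rat f" shows "prim_rec_rat (\<lambda>x. inverse (f x))"
proof -
  obtain a b c where 1: "prim_rec a" "prim_rec b" "prim_rec c" "\<And>x. f x = (of_nat (a x) - of_nat (b x)) / of_nat (Suc (c x))"
    using assms by (rule prqE) (rule that)
  define D where "D x = ((a x - b x) + (b x - a x)) ^ 2" for x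
  show ?thesis
  proof (rule prqI)
    show "prim_rec (\<lambda>x. Suc (c x) * a x)" "prim_rec (\<lambda>x. Suc (c x) * b x)" "prim_rec (\<lambda>x. D x - 1)"
      unfolding D_def by (intro pr_intros 1)+
    show "inverse (f x) = (of_nat (Suc (c x) * a x) - of_nat (Suc (c x) * b x)) / of_nat (Suc (D x - 1))" for x
    proof (cases "a x = b x")
      case True
      then show ?thesis by (simp add: 1(4))
    next
      case False
      then have "D x > 0" by (auto simp: D_def)
      then have "Suc (D x - 1) = D x" by simp
      moreover have "of_nat (D x) = (of_nat (a x) - of_nat (b x) :: rat) ^ 2"
        by (cases "a x \<le> b x") (simp_all add: D_def of_nat_diff power2_commute)
      ultimately show ?thesis using False unfolding 1(4)
        by (simp add: power2_eq_square divide_simps del: of_nat_Suc) (simp add: algebra_simps)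
    qed
  qed
qed

lemma prq_divide [pr_intros]: "prim_rec_rat f \<Longrightarrow> prim_rec_rat g \<Longrightarrow> prim_rec_rat (\<lambda>x. f x / g x)"
  unfolding divide_inverse by (intro pr_intros)

lemma prq_abs [pr_intros]:
  assumes "prim_rec_rat f" shows "prim_rec_rat (\<lambda>x. \<bar>f x\<bar>)"
proof -
  obtain a b c where 1: "prim_rec a" "prim_rec b" "prim_rec c" "\<And>x. f x = (of_nat (a x) - of_nat (b x)) / of_nat (Suc (c x))"
    using assms by (rule prqE) (rule that)
  have "prim_rec (\<lambda>x. (a x - b x) + (b x - a x))" by (intro pr_intros 1)
  moreover have "\<bar>f x\<bar> = (of_nat ((a x - b x) + (b x - a x)) - of_nat 0) / of_nat (Suc (c x))" for x
    by (cases "a x \<le> b x") (simp_all add: 1(4) of_nat_diff abs_divide del: of_nat_Suc)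
  ultimately show ?thesis by (rule prqI[OF _ pr_const 1(3)])
qed

lemma prq_sum [pr_intros]:
  assumes "\<And>i. i \<in> set is \<Longrightarrow> prim_rec_rat (f i)"
  shows "prim_rec_rat (\<lambda>x. \<Sum>i\<leftarrow>is. f i x)"
  using assms by (induction "is") (auto intro!: pr_intros)

lemma prq_prod [pr_intros]:
  assumes "\<And>i. i \<in> set is \<Longrightarrow> prim_rec_rat (f i)"
  shows "prim_rec_rat (\<lambda>x. \<Prod>i\<leftarrow>is. f i x)"
  using assms by (induction "is") (auto intro!: pr_intros)

lemma prp_rat_le [pr_intros]:
  assumes "prim_rec_rat f" "prim_rec_rat g" shows "prim_rec_pred (\<lambda>x. f x \<le> g x)"
proof -
  obtain a b c where 1: "prim_rec a" "prim_rec b" "prim_rec c" "\<And>x. g x - f x = (of_nat (a x) - of_nat (b x)) / of_nat (Suc (c x))"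
    using prq_diff[OF assms(2,1)] by (rule prqE) (rule that)
  have "f x \<le> g x \<longleftrightarrow> b x \<le> a x" for x
  proof -
    have "f x \<le> g x \<longleftrightarrow> 0 \<le> g x - f x" by simp
    also have "\<dots> \<longleftrightarrow> b x \<le> a x" unfolding 1(4) by (simp add: zero_le_divide_iff)
    finally show ?thesis .
  qed
  then show ?thesis using prp_le[OF 1(2,1)] by simp
qed

lemma prp_rat_less [pr_intros]:
  assumes "prim_rec_rat f" "prim_rec_rat g" shows "prim_rec_pred (\<lambda>x. f x < g x)"
proof -
  have "prim_rec_pred (\<lambda>x. \<not> g x \<le> f x)" by (intro pr_intros assms)
  then show ?thesis by (simp add: not_le)
qed

lemma prq_if:
  assumes "prim_rec_pred P" "prim_rec_rat f" "prim_rec_rat g" shows "prim_rec_rat (\<lambda>x. if P x then f x else g x)"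
proof -
  have "prim_rec_rat (\<lambda>x. of_nat (of_bool (P x)) * f x + of_nat (1 - of_bool (P x)) * g x)"
    by (intro pr_intros assms)
  then show ?thesis by (rule back_subst[of prim_rec_rat]) auto
qed

lemma prq_rat_val [pr_intros]:
  assumes "prim_rec f" shows "prim_rec_rat (\<lambda>x. rat_val (f x))"
proof -
  have "prim_rec_rat (\<lambda>x. if pfst (f x) = 0 then 1 else - 1)"
    by (intro prq_if pr_intros assms)
  then show ?thesis unfolding rat_val_def by (intro pr_intros assms)
qed


section \<open>Members of small enumerable sets have short programs\<close>

text \<open>
  Suppose that the members of a finite set appear in stages \<open>t\<close>. Whoever knows their total number
  can recognise a stage at which all of them have appeared, and can then pick out one of them by
  its rank. A member is therefore described by \<open>n\<close>, its rank and the total number; the Cantor code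
  of three numbers of \<open>L\<close> bits has at most \<open>4 * L + 6\<close> bits.
\<close>

lemma enumeration_program:
  assumes U: "universal_prefix_tm U"
    and pop: "prim_rec_pred (\<lambda>z. pop (pfst z) (pfst (psnd z)) (psnd (psnd z)))"
    and h: "prim_rec (\<lambda>z. h (pfst z) (psnd z))"
    and mono: "\<And>n b t t'. t \<le> t' \<Longrightarrow> pop n b t \<Longrightarrow> pop n b t'"
  shows "\<exists>C. \<forall>n L k b t w. n < 2 ^ L \<longrightarrow> finite {b. \<exists>t. pop n b t} \<longrightarrow>
           card {b. \<exists>t. pop n b t} < 2 ^ L \<longrightarrow> pop n b t \<longrightarrow> h n b = num w \<longrightarrow> 4 * L + 6 \<le> k\<^sup>2 \<longrightarrow>
           (\<exists>\<pi>. tm_output U \<pi> w \<and> length \<pi> \<le> k\<^sup>2 + k + C)"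
proof -
  define R where "R k v y \<longleftrightarrow> pfst y < psnd y \<and> pop (pfst v) (pfst y) (psnd y) \<and>
    card {b'. b' < pfst y \<and> pop (pfst v) b' (psnd y)} = pfst (psnd v) \<and>
    card {b'. b' < psnd y \<and> pop (pfst v) b' (psnd y)} = psnd (psnd v)" for k v y :: nat
  define g where "g k v y = h (pfst v) (pfst y)" for k v y :: nat
  have pop3: "prim_rec f1 \<Longrightarrow> prim_rec f2 \<Longrightarrow> prim_rec f3 \<Longrightarrow> prim_rec_pred (\<lambda>x. pop (f1 x) (f2 x) (f3 x))" for f1 f2 f3
    using prp_comp[OF pop pr_ppair[OF _ pr_ppair]] by simp
  have "prim_rec_pred (\<lambda>z. R (pfst z) (pfst (psnd z)) (psnd (psnd z)))"
    unfolding R_def by (intro pr_intros pop3)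
  moreover have "prim_rec (\<lambda>z. g (pfst z) (pfst (psnd z)) (psnd (psnd z)))"
    unfolding g_def by (intro pr_comp2[of h, OF h] pr_intros)
  ultimately have "\<exists>C. \<forall>k v y0 w. v < 2 ^ k\<^sup>2 \<longrightarrow> R k v y0 \<longrightarrow> (\<forall>y. R k v y \<longrightarrow> g k v y = num w) \<longrightarrow>
           (\<exists>\<pi>. tm_output U \<pi> w \<and> length \<pi> \<le> k\<^sup>2 + k + C)" by (rule payload_program[OF U])
  then obtain C where C: "\<forall>k v y0 w. v < 2 ^ k\<^sup>2 \<longrightarrow> R k v y0 \<longrightarrow> (\<forall>y. R k v y \<longrightarrow> g k v y = num w) \<longrightarrow>
           (\<exists>\<pi>. tm_output U \<pi> w \<and> length \<pi> \<le> k\<^sup>2 + k + C)" by (rule exE)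
  have "\<exists>\<pi>. tm_output U \<pi> w \<and> length \<pi> \<le> k\<^sup>2 + k + C"
    if n: "n < 2 ^ L" and fin: "finite {b. \<exists>t. pop n b t}" and c: "card {b. \<exists>t. pop n b t} < 2 ^ L"
      and b: "pop n b t0" and w: "h n b = num w" and k: "4 * L + 6 \<le> k\<^sup>2" for n L k b t0 w
  proof -
    let ?S = "{b. \<exists>t. pop n b t}"
    define i where "i = card {b'. b' < b \<and> b' \<in> ?S}"
    define v where "v = ppair n (ppair i (card ?S))"
    have "i \<le> card ?S" unfolding i_def by (intro card_mono fin) auto
    then have pc: "ppair i (card ?S) < 2 ^ (2 * L + 2)" using c by (intro ppair_less) auto
    have nL: "n < 2 ^ (2 * L + 2)"
      using n by (rule less_le_trans) (intro power_increasing, auto)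
    have "v < 2 ^ (2 * (2 * L + 2) + 2)" unfolding v_def by (rule ppair_less[OF nL pc])
    also have "\<dots> \<le> 2 ^ k\<^sup>2" using k by (intro power_increasing) auto
    finally have v: "v < 2 ^ k\<^sup>2" .
    have "\<exists>t. \<forall>b'\<in>?S. b' < t \<and> pop n b' t"
    proof -
      have "\<forall>b'. \<exists>t. b' \<in> ?S \<longrightarrow> pop n b' t" by blast
      from choice[OF this] obtain T where T: "\<forall>b'. b' \<in> ?S \<longrightarrow> pop n b' (T b')" by blast
      define t where "t = (\<Sum>b'\<in>?S. Suc b' + T b')"
      have "Suc b' + T b' \<le> t" if "b' \<in> ?S" for b'
        unfolding t_def by (rule member_le_sum[OF that _ fin]) simp
      then have "b' < t \<and> T b' \<le> t" if "b' \<in> ?S" for b' using that by fastforce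
      then have "b' < t \<and> pop n b' t" if "b' \<in> ?S" for b' using T mono that by blast
      then show ?thesis by blast
    qed
    then obtain t where t: "\<And>b'. b' \<in> ?S \<Longrightarrow> b' < t \<and> pop n b' t" by blast
    have "{b'. b' < t \<and> pop n b' t} = ?S" using t by blast
    moreover have "{b'. b' < b \<and> pop n b' t} = {b'. b' < b \<and> b' \<in> ?S}" using t by blast
    moreover have "b \<in> ?S" using b by blast
    ultimately have "R k v (ppair b t)"
      using t[of b] by (simp add: R_def v_def i_def)
    moreover have "g k v y = num w" if y: "R k v y" for y
    proof -
      let ?b = "pfst y" and ?t = "psnd y"
      have y': "?b < ?t" "pop n ?b ?t" "card {b'. b' < ?b \<and> pop n b' ?t} = i"
        "card {b'. b' < ?t \<and> pop n b' ?t} = card ?S"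
        using y by (auto simp: R_def v_def)
      have all: "{b'. b' < ?t \<and> pop n b' ?t} = ?S"
        by (rule card_subset_eq[OF fin]) (use y'(4) in auto)
      have "{b'. b' < ?b \<and> pop n b' ?t} = {b'. b' < ?b \<and> b' \<in> ?S}" using all y'(1) by auto
      then have rank: "card {b'. b' < ?b \<and> b' \<in> ?S} = card {b'. b' < b \<and> b' \<in> ?S}"
        using y'(3) by (simp add: i_def)
      have lt: "card {b'. b' < a \<and> b' \<in> ?S} < card {b'. b' < a' \<and> b' \<in> ?S}"
        if "a < a'" "a \<in> ?S" for a a'
        using that fin by (intro psubset_card_mono) auto
      have S: "b \<in> ?S" "?b \<in> ?S" using y'(2) b by blast+
      have "?b = b"
        using lt[OF _ S(1), of ?b] lt[OF _ S(2), of b] rank by (cases ?b b rule: linorder_cases) simp_all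
      then show ?thesis using w by (simp add: g_def v_def)
    qed
    ultimately show ?thesis using C[rule_format, OF v] by blast
  qed
  then show ?thesis by blast
qed


section \<open>Interpolating low-complexity points\<close>

text \<open>
  The value at 0 of the polynomial of degree at most \<open>d\<close> that takes the values \<open>v i\<close> at \<open>u i\<close>.
\<close>

definition lagrange0 :: "nat \<Rightarrow> (nat \<Rightarrow> 'a::field) \<Rightarrow> (nat \<Rightarrow> 'a) \<Rightarrow> 'a" where
  "lagrange0 d u v = (\<Sum>i\<leftarrow>[0..<Suc d]. v i * (\<Prod>j\<leftarrow>[0..<Suc d]. if j = i then 1 else u j / (u j - u i)))"

definition first_coord :: "nat \<Rightarrow> rat" where "first_coord z = rat_val (psnd z)"
definition second_coord :: "nat \<Rightarrow> rat" where "second_coord z = rat_val (pfst z)"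

locale low_points =
  fixes d a :: nat and sim :: "nat \<Rightarrow> nat \<Rightarrow> nat"
  assumes pr_sim: "prim_rec (\<lambda>z. sim (pfst z) (psnd z))"
    and sim_stable: "\<And>p t t'. sim p t \<noteq> 0 \<Longrightarrow> t \<le> t' \<Longrightarrow> sim p t' = sim p t"
begin

text \<open>
  By stage \<open>t\<close> the point with number \<open>z\<close> has been printed by a program whose number is below the given
  power of two. These programs include all those of length at most \<open>(a + 1) * n\<close>.
\<close>

definition low :: "nat \<Rightarrow> nat \<Rightarrow> nat \<Rightarrow> bool" where
  "low n z t \<longleftrightarrow> (\<exists>p<2 ^ ((a + 1) * n + 1). sim p t = Suc (num (pair_bits z))) \<and>
     pfst (pfst z) \<le> 1 \<and> pfst (psnd z) \<le> 1"

text \<open>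
  The list of points \<open>w\<close> votes for the integer part \<open>b\<close> of its interpolated value at 0, taken
  without its sign and scaled by \<open>2 ^ s\<close> with \<open>s = (a - 2 * d - 3) * n\<close>. The points are known with
  precision \<open>a * n\<close>. Interpolating points whose distance is only \<open>2 ^ - (2 * n)\<close> loses up to
  \<open>2 * n * (d + 1)\<close> bits, and another \<open>n\<close> bits absorb the constants.
\<close>

definition votes :: "nat \<Rightarrow> nat \<Rightarrow> nat \<Rightarrow> nat \<Rightarrow> bool" where
  "votes n b w t \<longleftrightarrow>
     (\<forall>i\<in>set [0..<Suc d]. low n (comp_at i w) t) \<and> (psnd ^^ Suc d) w = 0 \<and>
     (\<forall>i\<in>set [0..<Suc d]. \<forall>j\<in>set [0..<Suc d]. i = j \<or>
        1 \<le> of_nat (2 ^ (2 * n)) * \<bar>first_coord (comp_at i w) - first_coord (comp_at j w)\<bar>) \<and>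
     of_nat b \<le> of_nat (2 ^ ((a - 2 * d - 3) * n)) *
       \<bar>lagrange0 d (\<lambda>i. first_coord (comp_at i w)) (\<lambda>i. second_coord (comp_at i w))\<bar> \<and>
     of_nat (2 ^ ((a - 2 * d - 3) * n)) *
       \<bar>lagrange0 d (\<lambda>i. first_coord (comp_at i w)) (\<lambda>i. second_coord (comp_at i w))\<bar> < of_nat (Suc b)"

text \<open>
  If at least \<open>2 ^ ((a - 1) * n)\<close> columns are low, then at least about \<open>2 ^ ((a - 1) * n * Suc d)\<close>
  lists lie near the graph. The smaller threshold makes up for the constant factors.
\<close>

definition popular :: "nat \<Rightarrow> nat \<Rightarrow> nat \<Rightarrow> bool" where
  "popular n b t \<longleftrightarrow> 2 ^ ((a - 2) * n * Suc d) \<le> card {w. w < t \<and> votes n b w t}"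

lemma prp_low: "prim_rec f1 \<Longrightarrow> prim_rec f2 \<Longrightarrow> prim_rec f3 \<Longrightarrow> prim_rec_pred (\<lambda>x. low (f1 x) (f2 x) (f3 x))"
  unfolding low_def
  by (intro pr_intros pr_comp2[of sim, OF pr_sim] prim_rec.comp[OF pr_num_pair_bits] prim_rec.comp[of f1, OF _ prim_rec.snd]
      prim_rec.comp[of f2, OF _ prim_rec.snd] prim_rec.comp[of f3, OF _ prim_rec.snd]; assumption)

lemma prp_votes:
  assumes "prim_rec f1" "prim_rec f2" "prim_rec f3" "prim_rec f4"
  shows "prim_rec_pred (\<lambda>x. votes (f1 x) (f2 x) (f3 x) (f4 x))"
proof -
  have tail: "prim_rec (\<lambda>x. (psnd ^^ m) (f3 x))" for m
    using assms(3) by (induction m) (auto intro: pr_intros)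
  have lag: "prim_rec_rat (\<lambda>x. lagrange0 d (\<lambda>i. first_coord (comp_at i (f3 x))) (\<lambda>i. second_coord (comp_at i (f3 x))))"
    unfolding lagrange0_def first_coord_def second_coord_def
    by (intro prq_sum prq_mult prq_prod prq_if prq_divide prq_diff prq_rat_val pr_pfst pr_psnd pr_comp_at
        prp_const prq_one assms)
  show ?thesis
    unfolding votes_def first_coord_def[symmetric]
    by (intro prp_conj prp_ball_const prp_disj prp_const prp_low prp_eq tail pr_const pr_comp_at assms
        prp_rat_le prp_rat_less prq_one prq_mult prq_of_nat prq_abs lag prq_diff pr_power pr_mult pr_Suc
        prq_rat_val[folded first_coord_def] prq_rat_val[OF pr_psnd, folded first_coord_def])
qed

lemma prp_popular: "prim_rec_pred (\<lambda>z. popular (pfst z) (pfst (psnd z)) (psnd (psnd z)))"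
  unfolding popular_def by (intro pr_intros prp_votes)

lemma low_mono:
  assumes "low n z t" "t \<le> t'"
  shows "low n z t'"
proof -
  obtain p where "p < 2 ^ ((a + 1) * n + 1)" and p: "sim p t = Suc (num (pair_bits z))"
    using assms(1) unfolding low_def by blast
  moreover have "sim p t' = Suc (num (pair_bits z))" using sim_stable[of p t t'] p assms(2) by simp
  ultimately show ?thesis using assms(1) unfolding low_def by blast
qed

lemma votes_mono:
  assumes v: "votes n b w t" and t: "t \<le> t'"
  shows "votes n b w t'"
proof -
  have "\<forall>i\<in>set [0..<Suc d]. low n (comp_at i w) t"
    using v unfolding votes_def by (rule conjunct1)
  then have "\<forall>i\<in>set [0..<Suc d]. low n (comp_at i w) t'" using low_mono[OF _ t] by blast
  then show ?thesis
    using conjunct2[OF v[unfolded votes_def]] unfolding votes_def by (rule conjI)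
qed

lemma popular_mono:
  assumes "t \<le> t'" "popular n b t"
  shows "popular n b t'"
proof -
  have "card {w. w < t \<and> votes n b w t} \<le> card {w. w < t' \<and> votes n b w t'}"
  proof (rule card_mono)
    show "{w. w < t \<and> votes n b w t} \<subseteq> {w. w < t' \<and> votes n b w t'}"
      using assms(1) votes_mono by (blast intro: less_le_trans)
  qed simp
  with assms(2) show ?thesis unfolding popular_def by (rule le_trans)
qed

definition lows :: "nat \<Rightarrow> nat set" where "lows n = {z. \<exists>t. low n z t}"

lemma card_lows: "finite (lows n)" "card (lows n) \<le> 2 ^ ((a + 1) * n + 1)"
proof -
  let ?N = "2 ^ ((a + 1) * n + 1) :: nat"
  have "\<exists>p<?N. \<exists>t. sim p t = Suc (num (pair_bits z))" if "z \<in> lows n" for z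
    using that unfolding lows_def low_def by blast
  then have "\<forall>z\<in>lows n. \<exists>p. p < ?N \<and> (\<exists>t. sim p t = Suc (num (pair_bits z)))" by blast
  from bchoice[OF this] obtain p where
    p: "\<And>z. z \<in> lows n \<Longrightarrow> p z < ?N \<and> (\<exists>t. sim (p z) t = Suc (num (pair_bits z)))" by blast
  have "inj_on p (lows n)"
  proof (rule inj_onI)
    fix z z' assume z: "z \<in> lows n" "z' \<in> lows n" "p z = p z'"
    obtain t t' where t: "sim (p z) t = Suc (num (pair_bits z))" "sim (p z) t' = Suc (num (pair_bits z'))"
      using p[OF z(1)] p[OF z(2)] z(3) by auto
    have "sim (p z) (max t t') = Suc (num (pair_bits z))" "sim (p z) (max t t') = Suc (num (pair_bits z'))"
      using sim_stable[of "p z" t "max t t'"] sim_stable[of "p z" t' "max t t'"] t by auto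
    then have "pair_bits z = pair_bits z'" by (intro num_inj) simp
    moreover have "pfst (pfst u) \<le> 1 \<and> pfst (psnd u) \<le> 1" if "u \<in> lows n" for u
      using that unfolding lows_def low_def by blast
    ultimately show "z = z'" using z(1,2) by (intro pair_bits_inj) blast+
  qed
  then have I: "inj_on p (lows n)" .
  have S: "p ` lows n \<subseteq> {..<?N}" using p by blast
  show "finite (lows n)" by (rule inj_on_finite[OF I S finite_lessThan])
  have "card (lows n) \<le> card {..<?N}" by (rule card_inj_on_le[OF I S finite_lessThan])
  then show "card (lows n) \<le> ?N" by (simp only: card_lessThan)
qed

text \<open>
  The condition on the tail makes the coding of lists of a fixed length injective.
\<close>

lemma comp_at_determines:
  assumes "(psnd ^^ m) w = 0" "(psnd ^^ m) w' = 0" "\<And>i. i < m \<Longrightarrow> comp_at i w = comp_at i w'"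
  shows "w = w'"
  using assms
proof (induction m arbitrary: w w')
  case (Suc m)
  have "psnd w = psnd w'"
  proof (rule Suc.IH)
    show "(psnd ^^ m) (psnd w) = 0" "(psnd ^^ m) (psnd w') = 0"
      using Suc.prems by (simp_all only: funpow_Suc_right comp_def)
    show "comp_at i (psnd w) = comp_at i (psnd w')" if "i < m" for i
      using Suc.prems(3)[of "Suc i"] that by (simp only: comp_at_def funpow_Suc_right comp_def Suc_less_eq)
  qed
  moreover have "pfst w = pfst w'" using Suc.prems(3)[of 0] by (simp add: comp_at_def)
  ultimately show ?case by (metis ppair_collapse)
qed simp

text \<open>
  Each list votes for one value only, and there are at most \<open>card (lows n) ^ Suc d\<close> lists.
\<close>

lemma card_popular:
  assumes a: "a \<ge> 2"
  shows "finite {b. \<exists>t. popular n b t}"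
    and "card {b. \<exists>t. popular n b t} \<le> 2 ^ ((3 * n + 1) * Suc d)"
proof -
  define V where "V b = {w. \<exists>t. votes n b w t}" for b
  define Z where "Z = {xs. set xs \<subseteq> lows n \<and> length xs = Suc d}"
  define \<theta> :: nat where "\<theta> = 2 ^ ((a - 2) * n * Suc d)"
  have Z: "finite Z" "card Z \<le> 2 ^ (((a + 1) * n + 1) * Suc d)"
  proof -
    show "finite Z" unfolding Z_def by (rule finite_lists_length_eq[OF card_lows(1)])
    have "card Z = card (lows n) ^ Suc d" unfolding Z_def by (rule card_lists_length_eq[OF card_lows(1)])
    also have "\<dots> \<le> (2 ^ ((a + 1) * n + 1)) ^ Suc d" by (intro power_mono card_lows) simp
    finally show "card Z \<le> 2 ^ (((a + 1) * n + 1) * Suc d)" by (simp only: power_mult)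
  qed
  let ?f = "\<lambda>w. map (\<lambda>i. comp_at i w) [0..<Suc d]"
  have inj: "inj_on ?f (\<Union>b. V b)"
  proof (rule inj_onI)
    fix w w' assume "w \<in> (\<Union>b. V b)" "w' \<in> (\<Union>b. V b)" and eq: "?f w = ?f w'"
    then have "(psnd ^^ Suc d) w = 0" "(psnd ^^ Suc d) w' = 0" by (auto simp: V_def votes_def simp del: funpow.simps)
    moreover have "comp_at i w = comp_at i w'" if "i < Suc d" for i
      using arg_cong[OF eq, of "\<lambda>l. l ! i"] that by (simp del: upt_Suc)
    ultimately show "w = w'" by (rule comp_at_determines)
  qed
  have im: "?f ` (\<Union>b. V b) \<subseteq> Z"
  proof (rule image_subsetI)
    fix w assume "w \<in> (\<Union>b. V b)"
    then obtain b t where "votes n b w t" by (auto simp: V_def)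
    then have "low n (comp_at i w) t" if "i \<in> set [0..<Suc d]" for i
      using that unfolding votes_def by blast
    then have "\<forall>i\<in>set [0..<Suc d]. comp_at i w \<in> lows n" unfolding lows_def by blast
    then show "?f w \<in> Z" unfolding Z_def by (auto simp del: upt_Suc)
  qed
  have finV: "finite (\<Union>b. V b)" by (rule inj_on_finite[OF inj im Z(1)])
  have cardV: "card (\<Union>b. V b) \<le> card Z" by (rule card_inj_on_le[OF inj im Z(1)])
  have finVb: "finite (V b)" for b by (rule finite_subset[OF _ finV]) auto
  have disj: "V b \<inter> V b' = {}" if "b \<noteq> b'" for b b'
  proof (rule ccontr)
    assume "V b \<inter> V b' \<noteq> {}"
    then obtain w t t' where "votes n b w t" "votes n b' w t'" by (auto simp: V_def)
    then have "(of_nat b :: rat) < of_nat (Suc b')" "(of_nat b' :: rat) < of_nat (Suc b)"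
      unfolding votes_def by linarith+
    then have "b < Suc b'" "b' < Suc b" by (simp_all only: of_nat_less_iff)
    then show False using that by simp
  qed
  have pop: "\<theta> \<le> card (V b)" if "popular n b t" for b t
  proof -
    have "card {w. w < t \<and> votes n b w t} \<le> card (V b)"
      by (rule card_mono[OF finVb]) (auto simp: V_def)
    with that show ?thesis unfolding popular_def \<theta>_def by (rule le_trans)
  qed
  have bound: "card F \<le> 2 ^ ((3 * n + 1) * Suc d)" if F: "F \<subseteq> {b. \<exists>t. popular n b t}" "finite F" for F
  proof -
    have "card F * \<theta> = (\<Sum>b\<in>F. \<theta>)" by simp
    also have "\<dots> \<le> (\<Sum>b\<in>F. card (V b))" using F(1) pop by (intro sum_mono) blast
    also have "\<dots> = card (\<Union>b\<in>F. V b)"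
      using F disj finVb by (intro card_UN_disjoint[symmetric]) auto
    also have "\<dots> \<le> card (\<Union>b. V b)" using finV by (intro card_mono) auto
    also have "\<dots> \<le> 2 ^ (((a + 1) * n + 1) * Suc d)" by (rule order.trans[OF cardV Z(2)])
    also have "\<dots> = 2 ^ ((3 * n + 1) * Suc d) * \<theta>"
    proof -
      obtain a' where "a = 2 + a'" using a le_Suc_ex by blast
      then have e: "((a + 1) * n + 1) * Suc d = (3 * n + 1) * Suc d + (a - 2) * n * Suc d"
        by (simp add: algebra_simps)
      show ?thesis unfolding e power_add \<theta>_def by (rule refl)
    qed
    finally have "card F * \<theta> \<le> 2 ^ ((3 * n + 1) * Suc d) * \<theta>" .
    moreover have "0 < \<theta>" unfolding \<theta>_def by simp
    ultimately show ?thesis by (rule mult_right_le_imp_le)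
  qed
  have "finite {b. \<exists>t. popular n b t} \<and> card {b. \<exists>t. popular n b t} \<le> 2 ^ ((3 * n + 1) * Suc d)"
    by (rule finite_if_finite_subsets_card_bdd) (rule bound)
  then show "finite {b. \<exists>t. popular n b t}" "card {b. \<exists>t. popular n b t} \<le> 2 ^ ((3 * n + 1) * Suc d)"
    by (rule conjunct1, rule conjunct2)
qed

end


section \<open>Complexity at a given precision\<close>

lemma in_ball_2:
  fixes q :: "rat ^ 2" and z :: "real ^ 2"
  assumes "\<bar>of_rat (q $ 1) - z $ 1\<bar> + \<bar>of_rat (q $ 2) - z $ 2\<bar> < e"
  shows "real_vec q \<in> ball z e"
proof -
  have "dist z (real_vec q) = norm (real_vec q - z)" by (simp add: dist_norm norm_minus_commute)
  also have "\<dots> \<le> (\<Sum>i\<in>UNIV. \<bar>(real_vec q - z) $ i\<bar>)" by (rule norm_le_l1_cart)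
  also have "\<dots> < e" using assms by (simp add: UNIV_2 real_vec_def)
  finally show ?thesis by simp
qed

lemma ball_component:
  assumes "real_vec q \<in> ball z e"
  shows "\<bar>of_rat (q $ i) - z $ i\<bar> < e"
proof -
  have "\<bar>(real_vec q - z) $ i\<bar> \<le> norm (real_vec q - z)" by (rule component_le_norm_cart)
  then show ?thesis using assms by (simp add: real_vec_def dist_norm norm_minus_commute)
qed

lemma rational_point_in_ball:
  fixes z :: "real ^ 2"
  assumes "e > 0"
  shows "\<exists>q. real_vec q \<in> ball z e"
proof -
  obtain a b where a: "z $ 1 < of_rat a" "of_rat a < z $ 1 + e / 2"
    and b: "z $ 2 < of_rat b" "of_rat b < z $ 2 + e / 2"
    using of_rat_dense[of "z $ 1" "z $ 1 + e / 2"] of_rat_dense[of "z $ 2" "z $ 2 + e / 2"] assms by auto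
  have "real_vec (vector [a, b]) \<in> ball z e"
    by (rule in_ball_2) (use a b in simp)
  then show ?thesis by blast
qed

lemma kolmogorov_at_le:
  assumes "real_vec q \<in> ball z (1 / 2 ^ r)"
  shows "kolmogorov_at U r z \<le> kolmogorov U q"
  unfolding kolmogorov_at_def by (rule Least_le) (use assms in blast)

lemma kolmogorov_at_attained:
  fixes z :: "real ^ 2"
  shows "\<exists>q. real_vec q \<in> ball z (1 / 2 ^ r) \<and> kolmogorov_at U r z = kolmogorov U q"
proof -
  have "\<exists>n q. real_vec q \<in> ball z (1 / 2 ^ r) \<and> n = kolmogorov U q"
    using rational_point_in_ball[of "1 / 2 ^ r" z] by auto
  from LeastI_ex[OF this] show ?thesis unfolding kolmogorov_at_def .
qed

lemma kolmogorov_at_mono: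
  fixes z :: "real ^ 2"
  assumes "r \<le> r'"
  shows "kolmogorov_at U r z \<le> kolmogorov_at U r' z"
proof -
  obtain q where q: "real_vec q \<in> ball z (1 / 2 ^ r')" "kolmogorov_at U r' z = kolmogorov U q"
    using kolmogorov_at_attained by blast
  have "(1::real) / 2 ^ r' \<le> 1 / 2 ^ r" using assms by (intro divide_left_mono power_increasing) auto
  then have "real_vec q \<in> ball z (1 / 2 ^ r)" using q(1) by (meson subset_ball subsetD)
  then show ?thesis using kolmogorov_at_le q(2) by simp
qed

text \<open>
  Complexity is monotone in the precision, so it suffices to bound it at multiples of \<open>a\<close>. The
  term 1/2 absorbs the rounding of the precision to such a multiple.
\<close>

lemma eff_dim_ge:
  fixes z :: "real ^ 2"
  assumes a: "a > 0" and m: "m > 0" and K: "\<And>n. n \<ge> n0 \<Longrightarrow> m * n < kolmogorov_at U (a * n) z"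
  shows "eff_dim U z \<ge> ereal ((real m - 1/2) / real a)"
  unfolding eff_dim_def
proof (rule Liminf_bounded, unfold eventually_sequentially, intro exI allI impI)
  fix r assume r: "a * (n0 + 2 * m + 1) \<le> r"
  define n where "n = r div a"
  have "n0 + 2 * m + 1 \<le> n"
    unfolding n_def using div_le_mono[OF r, of a] a by simp
  then have n: "n \<ge> n0" "n \<ge> 2 * m" "n \<ge> 1" by auto
  have "r = a * n + r mod a" unfolding n_def by simp
  moreover have "r mod a < a" using a by simp
  ultimately have r1: "a * n \<le> r" "r \<le> a * (n + 1)" by auto
  have "m * n \<le> kolmogorov_at U r z"
    using K[OF n(1)] kolmogorov_at_mono[OF r1(1)] by (meson less_imp_le order_trans)
  then have k: "real m * real n \<le> real (kolmogorov_at U r z)"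
    by (metis of_nat_le_iff of_nat_mult)
  have r0: "real r > 0" using r1 a n(3) by (cases r) auto
  have "(real m - 1/2) * real r \<le> (real m - 1/2) * (real a * (real n + 1))"
    using r1(2) m by (intro mult_left_mono) (auto simp flip: of_nat_mult of_nat_Suc of_nat_1 of_nat_add)
  also have "\<dots> = real a * ((real m - 1/2) * (real n + 1))" by simp
  also have "\<dots> \<le> real a * (real m * real n)"
    using n(2) by (intro mult_left_mono) (auto simp: algebra_simps)
  also have "\<dots> \<le> real a * real (kolmogorov_at U r z)" using k by (intro mult_left_mono) auto
  finally have "(real m - 1/2) / real a \<le> real (kolmogorov_at U r z) / real r"
    using a r0 by (simp add: divide_simps mult_ac)
  then show "ereal ((real m - 1/2) / real a) \<le> ereal (real (kolmogorov_at U r z) / real r)" by simp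
qed

lemma eff_dim_le:
  fixes z :: "real ^ 2"
  assumes "\<And>N. \<exists>r\<ge>N. r > 0 \<and> real (kolmogorov_at U r z) \<le> c * real r"
  shows "eff_dim U z \<le> ereal c"
proof (rule ccontr)
  assume "\<not> eff_dim U z \<le> ereal c"
  then have "ereal c < Liminf sequentially (\<lambda>r. ereal (real (kolmogorov_at U r z) / real r))"
    by (simp add: eff_dim_def)
  from less_LiminfD[OF this] obtain N where
    N: "\<And>r. r \<ge> N \<Longrightarrow> ereal c < ereal (real (kolmogorov_at U r z) / real r)"
    by (auto simp: eventually_sequentially)
  obtain r where "r \<ge> N" "r > 0" "real (kolmogorov_at U r z) \<le> c * real r" using assms by blast
  with N[of r] show False by (simp add: divide_simps)
qed

lemma vec_num_inj:
  assumes "vec_num p = vec_num q"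
  shows "p = q"
proof -
  have "rat_num (p $ 1) = rat_num (q $ 1)" "rat_num (p $ 2) = rat_num (q $ 2)"
    using assms by (simp_all add: vec_num_def)
  then have "p $ 1 = q $ 1" "p $ 2 = q $ 2" by (metis rat_val_rat_num)+
  then show ?thesis by (simp add: vec_eq_iff forall_2)
qed

lemma low_complexity_program:
  fixes q :: "rat ^ 2"
  assumes "universal_prefix_tm U" "kolmogorov U q \<le> m"
  shows "\<exists>\<pi>. tm_output U \<pi> (pair_bits (vec_num q)) \<and> num \<pi> < 2 ^ (m + 1)"
proof -
  obtain \<pi> where "tm_output U \<pi> (tuple_code q)" "length \<pi> = kolmogorov U q"
    using kolmogorov_program[OF assms(1)] by blast
  moreover have "num \<pi> < 2 ^ (length \<pi> + 1)" using num_length(2)[of \<pi>] by simp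
  moreover have "(2::nat) ^ (length \<pi> + 1) \<le> 2 ^ (m + 1)"
    using assms(2) calculation(2) by (intro power_increasing) auto
  ultimately show ?thesis unfolding tuple_code_2 by (meson less_le_trans)
qed

lemma card_low_complexity:
  assumes U: "universal_prefix_tm U"
  shows "finite {q :: rat ^ 2. kolmogorov U q \<le> m}" "card {q :: rat ^ 2. kolmogorov U q \<le> m} \<le> 2 ^ (m + 1)"
proof -
  let ?Q = "{q :: rat ^ 2. kolmogorov U q \<le> m}" and ?N = "2 ^ (m + 1) :: nat"
  have "\<forall>q\<in>?Q. \<exists>\<pi>. tm_output U \<pi> (pair_bits (vec_num q)) \<and> num \<pi> < ?N"
    using low_complexity_program[OF U] by blast
  from bchoice[OF this] obtain p where
    p: "\<And>q. q \<in> ?Q \<Longrightarrow> tm_output U (p q) (pair_bits (vec_num q)) \<and> num (p q) < ?N" by blast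
  have I: "inj_on (\<lambda>q. num (p q)) ?Q"
  proof (rule inj_onI)
    fix q q' assume q: "q \<in> ?Q" "q' \<in> ?Q" "num (p q) = num (p q')"
    have "p q = p q'" using q(3) by (rule num_inj)
    then have "pair_bits (vec_num q) = pair_bits (vec_num q')"
      using p[OF q(1)] p[OF q(2)] tm_output_unique by metis
    then have "vec_num q = vec_num q'" by (intro pair_bits_inj vec_num_sign)
    then show "q = q'" by (rule vec_num_inj)
  qed
  have S: "(\<lambda>q. num (p q)) ` ?Q \<subseteq> {..<?N}" using p by blast
  show "finite ?Q" by (rule inj_on_finite[OF I S finite_lessThan])
  have "card ?Q \<le> card {..<?N}" by (rule card_inj_on_le[OF I S finite_lessThan])
  then show "card ?Q \<le> ?N" by (simp only: card_lessThan)
qed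


section \<open>Avoiding small neighbourhoods\<close>

text \<open>
  The neighbourhoods have total length at most \<open>8 / 2 ^ n0\<close>, which is less than the length of the
  interval.
\<close>

lemma avoid_neighbourhoods:
  fixes F :: "nat \<Rightarrow> real set"
  assumes fin: "\<And>n. n \<ge> n0 \<Longrightarrow> finite (F n)" and pos: "\<And>n. \<rho> n \<ge> 0"
    and small: "\<And>n. n \<ge> n0 \<Longrightarrow> real (card (F n)) * \<rho> n \<le> 2 / 2 ^ n" and n0: "n0 \<ge> 4"
  shows "\<exists>x\<in>{1..2}. \<forall>n\<ge>n0. \<forall>u\<in>F n. \<bar>x - u\<bar> > \<rho> n"
proof (rule ccontr)
  assume no: "\<not> ?thesis"
  define A where "A i = (\<Union>u\<in>F (n0 + i). {u - \<rho> (n0 + i)..u + \<rho> (n0 + i)})" for i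
  have meas: "A i \<in> sets lborel" for i
    unfolding A_def by (intro sets.finite_UN fin) auto
  have "{1..2} \<subseteq> (\<Union>i. A i)"
  proof
    fix x :: real assume "x \<in> {1..2}"
    with no obtain n u where "n \<ge> n0" "u \<in> F n" "\<not> \<bar>x - u\<bar> > \<rho> n" by blast
    then have "x \<in> A (n - n0)" unfolding A_def by (intro UN_I[of u]) (auto simp: abs_le_iff)
    then show "x \<in> (\<Union>i. A i)" by blast
  qed
  then have "emeasure lborel {1..2::real} \<le> emeasure lborel (\<Union>i. A i)"
    using meas by (intro emeasure_mono) auto
  also have "\<dots> \<le> (\<Sum>i. emeasure lborel (A i))"
    using meas by (intro emeasure_subadditive_countably) auto
  also have "\<dots> \<le> (\<Sum>i. ennreal (4 / 2 ^ n0 * (1/2) ^ i))"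
  proof (rule suminf_le)
    fix i
    let ?n = "n0 + i"
    have "emeasure lborel (A i) \<le> (\<Sum>u\<in>F ?n. emeasure lborel {u - \<rho> ?n..u + \<rho> ?n})"
      unfolding A_def by (intro emeasure_subadditive_finite fin) auto
    also have "\<dots> = (\<Sum>u\<in>F ?n. ennreal (2 * \<rho> ?n))"
      using pos by (intro sum.cong) (auto simp: emeasure_lborel_Icc)
    also have "\<dots> = ennreal (real (card (F ?n)) * (2 * \<rho> ?n))"
      using pos[of ?n] by (simp add: ennreal_mult ennreal_of_nat_eq_real_of_nat)
    also have "\<dots> \<le> ennreal (4 / 2 ^ n0 * (1/2) ^ i)"
      using small[of ?n] by (intro ennreal_leI) (simp add: power_add power_divide)
    finally show "emeasure lborel (A i) \<le> ennreal (4 / 2 ^ n0 * (1/2) ^ i)" .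
  qed auto
  also have "\<dots> = ennreal (4 / 2 ^ n0 * 2)"
  proof (rule suminf_ennreal_eq)
    have "(\<lambda>i. (1/2 :: real) ^ i) sums 2" using geometric_sums[of "1/2 :: real"] by simp
    then show "(\<lambda>i. 4 / 2 ^ n0 * (1/2) ^ i) sums (4 / 2 ^ n0 * 2 :: real)" by (rule sums_mult)
  qed simp
  finally have "1 \<le> ennreal (4 / 2 ^ n0 * 2)" by simp
  then have "1 \<le> (4 / 2 ^ n0 * 2 :: real)" by (simp add: ennreal_ge_1)
  moreover have "(2::real) ^ 4 \<le> 2 ^ n0" using n0 by (intro power_increasing) auto
  ultimately show False by (simp add: divide_simps)
qed

text \<open>
  At precision \<open>4 * n\<close> the rational points of complexity at most \<open>3 * n\<close> are too few to come close to
  every \<open>x\<close>.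
\<close>

lemma generic_dimension:
  assumes U: "universal_prefix_tm U"
  shows "\<exists>x. eff_dim U (vector [x, f x] :: real ^ 2) \<ge> ereal (5/8)"
proof -
  define F where "F n = (\<lambda>q :: rat ^ 2. of_rat (q $ 1) :: real) ` {q. kolmogorov U q \<le> 3 * n}" for n
  have "finite (F n)" for n unfolding F_def using card_low_complexity(1)[OF U] by blast
  moreover have "real (card (F n)) * (1 / 2 ^ (4 * n)) \<le> 2 / 2 ^ n" for n
  proof -
    have "card (F n) \<le> 2 ^ (3 * n + 1)"
      unfolding F_def using card_image_le[OF card_low_complexity(1)[OF U]] card_low_complexity(2)[OF U]
      by (rule order_trans)
    then have "real (card (F n)) \<le> 2 ^ (3 * n + 1)" by (metis of_nat_le_iff of_nat_numeral of_nat_power)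
    then have "real (card (F n)) * (1 / 2 ^ (4 * n)) \<le> 2 ^ (3 * n + 1) * (1 / 2 ^ (4 * n))"
      by (intro mult_right_mono) auto
    also have "\<dots> = 2 / 2 ^ n"
    proof -
      have "(2::real) ^ (4 * n) = 2 ^ (3 * n) * 2 ^ n" by (simp flip: power_add)
      then show ?thesis by (simp add: field_simps)
    qed
    finally show ?thesis .
  qed
  ultimately have "\<exists>x\<in>{1..2}. \<forall>n\<ge>4. \<forall>u\<in>F n. \<bar>x - u\<bar> > 1 / 2 ^ (4 * n)"
    by (intro avoid_neighbourhoods) auto
  then obtain x where x: "\<And>n u. n \<ge> 4 \<Longrightarrow> u \<in> F n \<Longrightarrow> \<bar>x - u\<bar> > 1 / 2 ^ (4 * n)"
    by blast
  let ?z = "vector [x, f x] :: real ^ 2"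
  have "3 * n < kolmogorov_at U (4 * n) ?z" if n: "n \<ge> 4" for n
  proof (rule ccontr)
    assume *: "\<not> 3 * n < kolmogorov_at U (4 * n) ?z"
    obtain q where q: "real_vec q \<in> ball ?z (1 / 2 ^ (4 * n))" "kolmogorov_at U (4 * n) ?z = kolmogorov U q"
      using kolmogorov_at_attained by blast
    have "of_rat (q $ 1) \<in> F n" unfolding F_def using * q(2) by auto
    with x[OF n this] ball_component[OF q(1), of 1] show False by (simp add: abs_minus_commute)
  qed
  then have "eff_dim U ?z \<ge> ereal ((real 3 - 1/2) / real 4)"
    by (intro eff_dim_ge) auto
  then show ?thesis by (intro exI[of _ x]) simp
qed


section \<open>Lagrange interpolation\<close>

lemma lagrange0_sum:
  "lagrange0 d u v = (\<Sum>i\<le>d. v i * (\<Prod>j\<le>d. if j = i then 1 else u j / (u j - u i)))"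
proof -
  have "set [0..<Suc d] = {..d}" by auto
  then show ?thesis
    unfolding lagrange0_def prod.distinct_set_conv_list[OF distinct_upt, symmetric]
      sum_list_distinct_conv_sum_set[OF distinct_upt] by (simp only:)
qed

lemma of_rat_lagrange0:
  "(of_rat (lagrange0 d u v) :: real) = lagrange0 d (\<lambda>i. of_rat (u i)) (\<lambda>i. of_rat (v i))"
  unfolding lagrange0_sum
  by (simp add: of_rat_sum of_rat_mult of_rat_prod if_distrib of_rat_divide of_rat_diff cong: if_cong)

lemma lagrange0_exact:
  fixes P :: "real poly"
  assumes deg: "degree P \<le> d" and inj: "inj_on u {..d}"
  shows "lagrange0 d u (\<lambda>i. poly P (u i)) = poly P 0"
proof -
  define l where "l i = (\<Prod>j\<in>{..d} - {i}. smult (1 / (u i - u j)) [:- u j, 1:])" for i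
  define Q where "Q = (\<Sum>i\<le>d. smult (poly P (u i)) (l i))"
  have l: "poly (l i) x = (\<Prod>j\<le>d. if j = i then 1 else (x - u j) / (u i - u j))" if "i \<le> d" for i x
  proof -
    have f: "poly (smult (1 / c) [:- b, 1:]) x = (x - b) / c" for b c :: real
      by (cases "c = 0") (simp_all add: field_simps)
    show ?thesis unfolding l_def poly_prod f using that
      by (subst prod.remove[of "{..d}" i]) (auto intro!: prod.cong)
  qed
  have lu: "poly (l i) (u k) = (if k = i then 1 else 0)" if "i \<le> d" "k \<le> d" for i k
  proof (cases "k = i")
    case True
    have "poly (l i) (u k) = (\<Prod>j\<le>d. 1)"
      unfolding l[OF that(1)] using True inj that by (intro prod.cong) (auto dest: inj_onD)
    then show ?thesis using True by simp
  next
    case False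
    then show ?thesis unfolding l[OF that(1)] using that by (auto intro!: prod_zero bexI[of _ k])
  qed
  have "degree (l i) \<le> d" if "i \<le> d" for i
  proof -
    have "degree (l i) \<le> (\<Sum>j\<in>{..d} - {i}. degree (smult (1 / (u i - u j)) [:- u j, 1:]))"
      unfolding l_def by (rule order_trans[OF degree_prod_sum_le]) (simp_all add: o_def)
    also have "\<dots> \<le> (\<Sum>j\<in>{..d} - {i}. 1)" by (intro sum_mono) (simp add: degree_smult_le[THEN order_trans])
    also have "\<dots> = d" using that by simp
    finally show ?thesis .
  qed
  then have degQ: "degree Q \<le> d" unfolding Q_def
    by (intro degree_sum_le) (auto intro: order_trans[OF degree_smult_le])
  have "P = Q"
  proof (rule poly_eqI_degree)
    show "poly P x = poly Q x" if xu: "x \<in> u ` {..d}" for x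
    proof -
      obtain k where k: "k \<le> d" "x = u k" using xu by auto
      have "poly Q (u k) = (\<Sum>i\<le>d. if k = i then poly P (u i) else 0)"
        unfolding Q_def poly_sum using k(1) lu by (intro sum.cong) auto
      also have "\<dots> = poly P (u k)" using k(1) by simp
      finally show ?thesis using k(2) by simp
    qed
    have "card (u ` {..d}) = d + 1" using inj by (simp add: card_image)
    then show "degree P < card (u ` {..d})" "degree Q < card (u ` {..d})" using deg degQ by auto
  qed
  then have "poly P 0 = poly Q 0" by (rule arg_cong)
  also have "\<dots> = (\<Sum>i\<le>d. poly P (u i) * poly (l i) 0)" unfolding Q_def by (simp add: poly_sum)
  also have "\<dots> = lagrange0 d u (\<lambda>i. poly P (u i))"
    unfolding lagrange0_sum
  proof (intro sum.cong refl arg_cong2[where f="(*)"])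
    fix i assume "i \<in> {..d}"
    then show "poly (l i) 0 = (\<Prod>j\<le>d. if j = i then 1 else u j / (u j - u i))"
    proof -
      have "(0 - b) / (c - b) = b / (b - c)" for b c :: real
        by (metis diff_0 minus_diff_eq minus_divide_divide)
      then show ?thesis using l[of i 0] \<open>i \<in> {..d}\<close> by (auto intro!: prod.cong)
    qed
  qed
  finally show ?thesis by simp
qed

lemma poly_Lipschitz:
  fixes P :: "real poly"
  shows "\<exists>L\<ge>0. \<forall>x\<in>{0..3}. \<bar>poly P x\<bar> \<le> L \<and> (\<forall>u\<in>{0..3}. \<bar>poly P x - poly P u\<bar> \<le> L * \<bar>x - u\<bar>)"
proof (induction P)
  case 0
  show ?case by (rule exI[of _ 0]) simp
next
  case (pCons c P)
  then obtain L where L: "L \<ge> 0" "\<And>x. x \<in> {0..3} \<Longrightarrow> \<bar>poly P x\<bar> \<le> L"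
    "\<And>x u. x \<in> {0..3} \<Longrightarrow> u \<in> {0..3} \<Longrightarrow> \<bar>poly P x - poly P u\<bar> \<le> L * \<bar>x - u\<bar>" by blast
  have "\<bar>poly (pCons c P) x\<bar> \<le> \<bar>c\<bar> + 4 * L" if x: "x \<in> {0..3}" for x
  proof -
    have "\<bar>x * poly P x\<bar> \<le> 3 * L" unfolding abs_mult using x L by (intro mult_mono) auto
    then show ?thesis using L(1) by simp
  qed
  moreover have "\<bar>poly (pCons c P) x - poly (pCons c P) u\<bar> \<le> (\<bar>c\<bar> + 4 * L) * \<bar>x - u\<bar>"
    if x: "x \<in> {0..3}" and u: "u \<in> {0..3}" for x u
  proof -
    have "poly (pCons c P) x - poly (pCons c P) u = x * (poly P x - poly P u) + (x - u) * poly P u"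
      by (simp add: algebra_simps)
    also have "\<bar>\<dots>\<bar> \<le> \<bar>x\<bar> * \<bar>poly P x - poly P u\<bar> + \<bar>x - u\<bar> * \<bar>poly P u\<bar>"
      by (metis abs_mult abs_triangle_ineq)
    also have "\<dots> \<le> 3 * (L * \<bar>x - u\<bar>) + \<bar>x - u\<bar> * L"
      using x u L by (intro add_mono mult_mono) auto
    also have "\<dots> \<le> (\<bar>c\<bar> + 4 * L) * \<bar>x - u\<bar>" by (simp add: algebra_simps)
    finally show ?thesis .
  qed
  ultimately show ?case using L(1) by (intro exI[of _ "\<bar>c\<bar> + 4 * L"]) auto
qed

lemma lagrange0_error:
  fixes P :: "real poly"
  assumes deg: "degree P \<le> d" and M: "M \<ge> 1"
    and u: "\<And>i. i \<le> d \<Longrightarrow> \<bar>u i\<bar> \<le> 3"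
    and sep: "\<And>i j. i \<le> d \<Longrightarrow> j \<le> d \<Longrightarrow> i \<noteq> j \<Longrightarrow> 1 \<le> M * \<bar>u i - u j\<bar>"
    and v: "\<And>i. i \<le> d \<Longrightarrow> \<bar>v i - poly P (u i)\<bar> \<le> e"
  shows "\<bar>lagrange0 d u v - poly P 0\<bar> \<le> real (Suc d) * e * (3 * M) ^ Suc d"
proof -
  define c where "c i = (\<Prod>j\<le>d. if j = i then 1 else u j / (u j - u i))" for i
  have inj: "inj_on u {..d}"
  proof (rule inj_onI)
    fix i j assume ij: "i \<in> {..d}" "j \<in> {..d}" "u i = u j"
    show "i = j" using sep[of i j] ij by auto
  qed
  have c: "\<bar>c i\<bar> \<le> (3 * M) ^ Suc d" if i: "i \<le> d" for i
  proof -
    have "\<bar>c i\<bar> = (\<Prod>j\<le>d. \<bar>if j = i then 1 else u j / (u j - u i)\<bar>)"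
      unfolding c_def by (rule abs_prod)
    also have "\<dots> \<le> (\<Prod>j\<le>d. 3 * M)"
    proof (rule prod_mono)
      fix j assume j: "j \<in> {..d}"
      have "\<bar>u j / (u j - u i)\<bar> \<le> 3 * M" if "j \<noteq> i"
      proof -
        have s: "1 \<le> M * \<bar>u j - u i\<bar>" using sep[of j i] i j that by simp
        then have "\<bar>u j - u i\<bar> > 0" by (cases "u j = u i") auto
        moreover have "\<bar>u j\<bar> \<le> 3 * (M * \<bar>u j - u i\<bar>)" using u[of j] j s by simp
        ultimately show ?thesis by (simp add: abs_divide divide_le_eq mult.assoc)
      qed
      then show "0 \<le> \<bar>if j = i then 1 else u j / (u j - u i)\<bar> \<and> \<bar>if j = i then 1 else u j / (u j - u i)\<bar> \<le> 3 * M"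
        using M by auto
    qed
    also have "\<dots> = (3 * M) ^ Suc d" by simp
    finally show ?thesis .
  qed
  have "lagrange0 d u v - poly P 0 = lagrange0 d u v - lagrange0 d u (\<lambda>i. poly P (u i))"
    using lagrange0_exact[OF deg inj] by simp
  also have "\<dots> = (\<Sum>i\<le>d. (v i - poly P (u i)) * c i)"
    unfolding lagrange0_sum c_def by (simp add: sum_subtractf left_diff_distrib)
  also have "\<bar>\<dots>\<bar> \<le> (\<Sum>i\<le>d. \<bar>(v i - poly P (u i)) * c i\<bar>)" by (rule sum_abs)
  also have "\<dots> \<le> (\<Sum>i\<le>d. e * (3 * M) ^ Suc d)"
    unfolding abs_mult using v c order_trans[OF abs_ge_zero v] by (intro sum_mono mult_mono) auto
  also have "\<dots> = real (Suc d) * e * (3 * M) ^ Suc d" by simp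
  finally show ?thesis .
qed


section \<open>Counting separated lists\<close>

fun separated :: "('a \<Rightarrow> 'a \<Rightarrow> bool) \<Rightarrow> 'a list \<Rightarrow> bool" where
  "separated near [] = True"
| "separated near (x # xs) = ((\<forall>y\<in>set xs. \<not> near x y) \<and> separated near xs)"

lemma separated_nth:
  assumes "separated near xs" "\<And>x y. near x y \<Longrightarrow> near y x" "i < length xs" "j < length xs" "i \<noteq> j"
  shows "\<not> near (xs ! i) (xs ! j)"
  using assms
proof (induction xs arbitrary: i j)
  case (Cons x xs)
  have "\<not> near x (xs ! k) \<and> \<not> near (xs ! k) x" if "k < length xs" for k
    using Cons.prems(1,2) nth_mem[OF that] unfolding separated.simps by blast
  then show ?case using Cons by (cases i; cases j) auto
qed simp

text \<open>
  Each of the fewer than \<open>k\<close> points already in a list rules out at most \<open>D\<close> points for the next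
  place.
\<close>

lemma card_separated:
  assumes fin: "finite Z" and near: "\<And>z. z \<in> Z \<Longrightarrow> card {z'\<in>Z. near z' z} \<le> D"
  shows "(card Z - k * D) ^ k \<le> card {xs. length xs = k \<and> set xs \<subseteq> Z \<and> separated near xs}"
proof -
  define S where "S m = {xs. length xs = m \<and> set xs \<subseteq> Z \<and> separated near xs}" for m
  have finS: "finite (S m)" for m
    by (rule finite_subset[OF _ finite_lists_length_eq[OF fin, of m]]) (auto simp: S_def)
  have "(card Z - k * D) ^ m \<le> card (S m)" if "m \<le> k" for m
    using that
  proof (induction m)
    case 0
    have "S 0 = {[]}" by (auto simp: S_def)
    then show ?case by simp
  next
    case (Suc m)
    define ok where "ok xs = {z\<in>Z. \<forall>y\<in>set xs. \<not> near z y}" for xs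
    have ok: "card Z - k * D \<le> card (ok xs)" if "xs \<in> S m" for xs
    proof -
      have "Z - ok xs = (\<Union>y\<in>set xs. {z'\<in>Z. near z' y})" by (auto simp: ok_def)
      then have "card (Z - ok xs) \<le> (\<Sum>y\<in>set xs. card {z'\<in>Z. near z' y})"
        by (simp add: card_UN_le)
      also have "\<dots> \<le> (\<Sum>y\<in>set xs. D)" using that near by (intro sum_mono) (auto simp: S_def)
      also have "\<dots> \<le> k * D"
        using that Suc.prems card_length[of xs] by (auto simp: S_def intro!: mult_right_mono)
      finally have "card Z - card (ok xs) \<le> k * D"
        using fin by (subst (asm) card_Diff_subset) (auto simp: ok_def)
      then show ?thesis by linarith
    qed
    have "(card Z - k * D) ^ Suc m \<le> card (S m) * (card Z - k * D)"
      using Suc by (simp add: mult.commute)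
    also have "\<dots> = (\<Sum>xs\<in>S m. card Z - k * D)" by simp
    also have "\<dots> \<le> (\<Sum>xs\<in>S m. card (ok xs))" using ok by (intro sum_mono) auto
    also have "\<dots> = card (Sigma (S m) ok)"
      using finS fin by (subst card_SigmaI) (auto simp: ok_def)
    also have "\<dots> \<le> card (S (Suc m))"
    proof (rule card_inj_on_le[OF _ _ finS])
      show "inj_on (\<lambda>(xs, z). z # xs) (Sigma (S m) ok)" by (auto simp: inj_on_def)
      show "(\<lambda>(xs, z). z # xs) ` Sigma (S m) ok \<subseteq> S (Suc m)" by (auto simp: S_def ok_def)
    qed
    finally show ?case .
  qed
  then show ?thesis by (simp add: S_def)
qed


section \<open>Upper bounds at the point above zero\<close>

text \<open>
  An odd numerator over a power of two is in lowest terms, so the code of this point is computed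
  without reducing a fraction. The sign is a parameter because it is the same at all precisions.
\<close>

definition dyadic_point :: "nat \<Rightarrow> nat \<Rightarrow> nat \<Rightarrow> rat ^ 2" where
  "dyadic_point sg s b = vector [0, (if sg = 0 then 1 else - 1) * of_nat (2 * b + 1) / 2 ^ (s + 1)]"

definition dyadic_code :: "nat \<Rightarrow> nat \<Rightarrow> nat \<Rightarrow> nat" where
  "dyadic_code sg s b = ppair (ppair sg (ppair (2 * b + 1) (2 ^ (s + 1)))) (ppair 0 (ppair 0 1))"

lemma vec_num_dyadic_point:
  assumes "sg \<le> 1"
  shows "vec_num (dyadic_point sg s b) = dyadic_code sg s b"
proof -
  have q: "quotient_of (of_int m / of_int (2 ^ (s + 1))) = (m, 2 ^ (s + 1))" if "odd m" for m
  proof -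
    have "coprime m (2 ^ (s + 1))" using that by (simp add: coprime_commute)
    then show ?thesis
      unfolding Fract_of_int_quotient[symmetric] quotient_of_Fract Rat.normalize_def
      by (simp add: Let_def coprime_iff_gcd_eq_1 del: power_Suc)
  qed
  let ?m = "(if sg = 0 then 1 else - 1) * int (2 * b + 1)"
  have "(if sg = 0 then 1 else - 1) * of_nat (2 * b + 1) / 2 ^ (s + 1) = (of_int ?m / of_int (2 ^ (s + 1)) :: rat)"
    by simp
  moreover have "odd ?m" by simp
  ultimately have "quotient_of ((if sg = 0 then 1 else - 1) * of_nat (2 * b + 1) / 2 ^ (s + 1)) = (?m, 2 ^ (s + 1))"
    using q by (simp only:)
  moreover have "?m < 0 \<longleftrightarrow> sg \<noteq> 0" "nat \<bar>?m\<bar> = 2 * b + 1" "of_bool (sg \<noteq> 0) = sg"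
    using assms by (auto simp: le_Suc_eq)
  moreover have "nat (2 ^ (s + 1)) = 2 ^ (s + 1)" by (subst nat_power_eq) simp_all
  ultimately have "rat_num (dyadic_point sg s b $ 2) = ppair sg (ppair (2 * b + 1) (2 ^ (s + 1)))"
    unfolding dyadic_point_def vector_2 rat_num_def by (simp only: Let_def prod.case)
  moreover have "rat_num (dyadic_point sg s b $ 1) = ppair 0 (ppair 0 1)"
    by (simp add: dyadic_point_def rat_num_def)
  ultimately show ?thesis by (simp only: vec_num_def dyadic_code_def)
qed

lemma pr_dyadic_code: "prim_rec f \<Longrightarrow> prim_rec g \<Longrightarrow> prim_rec (\<lambda>x. num (pair_bits (dyadic_code sg (f x) (g x))))"
  unfolding dyadic_code_def by (intro prim_rec.comp[OF pr_num_pair_bits] pr_intros)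

lemma dyadic_point_in_ball:
  fixes y :: real
  assumes b: "\<bar>2 ^ s * \<bar>y\<bar> - real b\<bar> \<le> 3" and s: "s \<ge> 2"
  shows "real_vec (dyadic_point (of_bool (y < 0)) s b) \<in> ball (vector [0, y] :: real ^ 2) (1 / 2 ^ (s - 2))"
proof (rule in_ball_2)
  let ?\<sigma> = "if y < 0 then - 1 else 1 :: real"
  have y: "y = ?\<sigma> * \<bar>y\<bar>" by simp
  have "of_rat (dyadic_point (of_bool (y < 0)) s b $ 2) = ?\<sigma> * ((2 * real b + 1) / 2 ^ (s + 1))"
    by (simp add: dyadic_point_def of_rat_divide of_rat_mult of_rat_add of_rat_power of_rat_minus)
  then have "of_rat (dyadic_point (of_bool (y < 0)) s b $ 2) - y = ?\<sigma> * ((2 * real b + 1) / 2 ^ (s + 1) - \<bar>y\<bar>)"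
    by (auto simp: right_diff_distrib)
  then have "\<bar>of_rat (dyadic_point (of_bool (y < 0)) s b $ 2) - y\<bar> = \<bar>(2 * real b + 1) / 2 ^ (s + 1) - \<bar>y\<bar>\<bar>"
    by (simp add: abs_mult)
  also have "(2 * real b + 1) / 2 ^ (s + 1) - \<bar>y\<bar> = (real b + 1/2 - 2 ^ s * \<bar>y\<bar>) / 2 ^ s"
    by (simp add: field_simps)
  also have "\<bar>\<dots>\<bar> = \<bar>real b + 1/2 - 2 ^ s * \<bar>y\<bar>\<bar> / 2 ^ s" by (simp add: abs_divide)
  also have "\<dots> < 4 / 2 ^ s" using b by (intro divide_strict_right_mono) auto
  also have "\<dots> = 1 / 2 ^ (s - 2)"
  proof -
    obtain s' where "s = 2 + s'" using le_Suc_ex[OF s] by blast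
    then show ?thesis by (simp add: power_add)
  qed
  finally show "\<bar>of_rat (dyadic_point (of_bool (y < 0)) s b $ 1) - (vector [0, y] :: real ^ 2) $ 1\<bar> +
      \<bar>of_rat (dyadic_point (of_bool (y < 0)) s b $ 2) - (vector [0, y] :: real ^ 2) $ 2\<bar> < 1 / 2 ^ (s - 2)"
    by (simp add: dyadic_point_def)
qed

lemma kolmogorov_at_dyadic:
  fixes y :: real
  assumes out: "tm_output U \<pi> w" "num w = num (pair_bits (dyadic_code (of_bool (y < 0)) s b))"
    and "\<bar>2 ^ s * \<bar>y\<bar> - real b\<bar> \<le> 3" "s \<ge> 2"
  shows "kolmogorov_at U (s - 2) (vector [0, y] :: real ^ 2) \<le> length \<pi>"
proof -
  have "w = tuple_code (dyadic_point (of_bool (y < 0)) s b)"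
    using num_inj[OF out(2)] by (simp add: tuple_code_2 vec_num_dyadic_point)
  then have "kolmogorov U (dyadic_point (of_bool (y < 0)) s b) \<le> length \<pi>"
    using out(1) by (intro kolmogorov_le) simp
  moreover have "kolmogorov_at U (s - 2) (vector [0, y] :: real ^ 2) \<le> kolmogorov U (dyadic_point (of_bool (y < 0)) s b)"
    by (rule kolmogorov_at_le[OF dyadic_point_in_ball[OF assms(3,4)]])
  ultimately show ?thesis by simp
qed

text \<open>
  For every \<open>k\<close> the payload consists of the first \<open>k\<^sup>2\<close> binary digits of the absolute value of the second
  coordinate, counted from a fixed power of two that exceeds it. Precision and program length are thus both
  \<open>k\<^sup>2\<close> up to terms of lower order.
\<close>

lemma dimension_above_zero_le:
  fixes y :: real
  assumes U: "universal_prefix_tm U" and \<eta>: "\<eta> > 0"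
  shows "eff_dim U (vector [0, y] :: real ^ 2) \<le> ereal (1 + \<eta>)"
proof (rule eff_dim_le)
  fix N
  let ?sg = "of_bool (y < 0) :: nat"
  obtain c where c: "\<bar>y\<bar> < 2 ^ c" using real_arch_pow[of 2 "\<bar>y\<bar>"] by auto
  have "prim_rec_pred (\<lambda>z. True)" "prim_rec (\<lambda>z. num (pair_bits (dyadic_code ?sg ((pfst z)\<^sup>2 - c) (pfst (psnd z)))))"
    by (intro pr_intros pr_dyadic_code)+
  from payload_program[OF U, of "\<lambda>k v y. True" "\<lambda>k v y. num (pair_bits (dyadic_code ?sg (k\<^sup>2 - c) v))", OF this]
  have "\<exists>C. \<forall>k v w. v < 2 ^ k\<^sup>2 \<longrightarrow> num (pair_bits (dyadic_code ?sg (k\<^sup>2 - c) v)) = num w \<longrightarrow>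
      (\<exists>\<pi>. tm_output U \<pi> w \<and> length \<pi> \<le> k\<^sup>2 + k + C)" by simp
  then obtain C where C: "\<forall>k v w. v < 2 ^ k\<^sup>2 \<longrightarrow> num (pair_bits (dyadic_code ?sg (k\<^sup>2 - c) v)) = num w \<longrightarrow>
      (\<exists>\<pi>. tm_output U \<pi> w \<and> length \<pi> \<le> k\<^sup>2 + k + C)" by blast
  define X where "X = real C + (1 + \<eta>) * (real c + 2)"
  have X: "X \<ge> 0" using \<eta> by (simp add: X_def)
  obtain k0 :: nat where k0: "(1 + X) / \<eta> \<le> real k0" using real_arch_simple by blast
  define k where "k = k0 + N + c + 3"
  have kk: "k \<le> k\<^sup>2" by (simp add: power2_eq_square)
  have big: "N + c + 3 \<le> k\<^sup>2" using kk by (simp add: k_def)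
  define s where "s = k\<^sup>2 - c"
  have s: "s \<ge> 2" "k\<^sup>2 = s + c" "s - 2 \<ge> N" "s - 2 > 0" using big by (auto simp: s_def)
  define b where "b = nat \<lfloor>2 ^ s * \<bar>y\<bar>\<rfloor>"
  have fl: "real b = of_int \<lfloor>2 ^ s * \<bar>y\<bar>\<rfloor>" by (simp add: b_def)
  have b3: "\<bar>2 ^ s * \<bar>y\<bar> - real b\<bar> \<le> 3" unfolding fl by linarith
  have "real b \<le> 2 ^ s * \<bar>y\<bar>" unfolding fl by linarith
  also have "\<dots> < 2 ^ s * 2 ^ c" using c by (intro mult_strict_left_mono) auto
  also have "\<dots> = 2 ^ k\<^sup>2" by (simp add: s(2) power_add)
  finally have "b < 2 ^ k\<^sup>2" by (metis of_nat_less_iff of_nat_numeral of_nat_power)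
  moreover obtain w where w: "num w = num (pair_bits (dyadic_code ?sg s b))" by blast
  ultimately obtain \<pi> where \<pi>: "tm_output U \<pi> w" "length \<pi> \<le> k\<^sup>2 + k + C"
    using C unfolding s_def by metis
  have "kolmogorov_at U (s - 2) (vector [0, y] :: real ^ 2) \<le> k\<^sup>2 + k + C"
    using kolmogorov_at_dyadic[OF \<pi>(1) w b3 s(1)] \<pi>(2) by simp
  then have "real (kolmogorov_at U (s - 2) (vector [0, y] :: real ^ 2)) \<le> real (k\<^sup>2 + k + C)" by (simp only: of_nat_le_iff)
  also have "\<dots> \<le> (1 + \<eta>) * real (s - 2)"
  proof -
    have k1: "real k \<ge> 1" "(1 + X) / \<eta> \<le> real k" using k0 by (auto simp: k_def)
    have "real k * (1 + X) \<le> real k * (\<eta> * real k)"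
      using k1(2) \<eta> by (intro mult_left_mono) (auto simp: divide_le_eq mult.commute)
    moreover have "X \<le> real k * X" using k1 X by (simp add: mult_le_cancel_right1)
    ultimately have "real k + X \<le> \<eta> * (real k)\<^sup>2" by (simp add: algebra_simps power2_eq_square)
    moreover have "(1 + \<eta>) * real (s - 2) = (real k)\<^sup>2 + \<eta> * (real k)\<^sup>2 - (1 + \<eta>) * (real c + 2)"
    proof -
      have "real (s - 2) = (real k)\<^sup>2 - (real c + 2)"
        using s(1) arg_cong[OF s(2), of real] by (simp add: of_nat_diff)
      then show ?thesis by (simp only:) (simp add: algebra_simps)
    qed
    moreover have "real (k\<^sup>2 + k + C) = (real k)\<^sup>2 + real k + real C" by simp
    ultimately show ?thesis unfolding X_def by linarith
  qed
  finally show "\<exists>r\<ge>N. r > 0 \<and> real (kolmogorov_at U r (vector [0, y] :: real ^ 2)) \<le> (1 + \<eta>) * real r"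
    using s by blast
qed


section \<open>A popular value near the value at zero\<close>

lemma lagrange0_cong:
  assumes "\<And>i. i \<le> d \<Longrightarrow> u i = u' i" "\<And>i. i \<le> d \<Longrightarrow> v i = v' i"
  shows "lagrange0 d u v = lagrange0 d u' v'"
  unfolding lagrange0_sum using assms by (intro sum.cong refl arg_cong2[where f="(*)"] prod.cong) auto

lemma tail_tup: "(psnd ^^ length xs) (tup xs) = 0"
  by (induction xs) (simp_all add: funpow_Suc_right del: funpow.simps(2))

lemma uniform_time:
  fixes P :: "'a \<Rightarrow> nat \<Rightarrow> bool"
  assumes "finite Q" "\<And>q. q \<in> Q \<Longrightarrow> \<exists>t. P q t" "\<And>q t t'. P q t \<Longrightarrow> t \<le> t' \<Longrightarrow> P q t'"
  shows "\<exists>T. \<forall>q\<in>Q. P q T"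
  using assms(1,2)
proof (induction Q)
  case (insert q Q)
  then obtain T t where "\<forall>q\<in>Q. P q T" "P q t" by blast
  then have "\<forall>q\<in>insert q Q. P q (max T t)" using assms(3) by (metis insert_iff max.cobounded1 max.cobounded2)
  then show ?case by blast
qed simp

lemma pigeonhole_fiber:
  assumes "finite S" "S \<noteq> {}" "card (f ` S) \<le> m"
  shows "\<exists>y\<in>f ` S. card S \<le> m * card {x\<in>S. f x = y}"
proof (rule ccontr)
  assume "\<not> ?thesis"
  then have lt: "m * card {x\<in>S. f x = y} \<le> card S - 1" if "y \<in> f ` S" for y using that by fastforce
  have "card S = (\<Sum>y\<in>f ` S. card {x\<in>S. f x = y})"
    using sum.image_gen[OF assms(1), of "\<lambda>_. 1::nat" f] by simp
  then have "m * card S = (\<Sum>y\<in>f ` S. m * card {x\<in>S. f x = y})" by (simp add: sum_distrib_left)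
  also have "\<dots> \<le> (\<Sum>y\<in>f ` S. card S - 1)" using lt by (intro sum_mono)
  also have "\<dots> = card (f ` S) * (card S - 1)" by simp
  also have "\<dots> \<le> m * (card S - 1)" using assms(3) by (rule mult_le_mono1)
  finally have "m = 0 \<or> card S = 0" by (cases "card S") auto
  moreover have "card S > 0" "card (f ` S) > 0" using assms by (auto simp: card_gt_0_iff)
  ultimately show False using assms(3) by auto
qed

definition low_columns :: "turing_machine \<Rightarrow> real poly \<Rightarrow> nat \<Rightarrow> nat \<Rightarrow> int set" where
  "low_columns U P a n = (\<lambda>q :: rat ^ 2. \<lfloor>2 ^ (a * n) * (of_rat (q $ 1) :: real)\<rfloor>) `
     {q. kolmogorov U q \<le> (a + 1) * n \<and>
         (\<exists>x\<in>{1..2}. real_vec q \<in> ball (vector [x, poly P x]) (1 / 2 ^ (a * n)))}"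

text \<open>
  Choose one low-complexity point \<open>q\<close> in each of the columns. At most \<open>3 * 2 ^ ((a - 2) * n)\<close> of them lie
  within distance \<open>2 ^ - (2 * n)\<close> of a given one, so for large \<open>n\<close> at least half of them remain available for each place
  of a separated list. By
  \<open>lagrange0_error\<close> the separated lists all interpolate nearly \<open>P(0)\<close> and can only vote for three
  adjacent values, one of which therefore gets a third of the votes.
\<close>

lemma (in low_points) popular_near:
  fixes P :: "real poly"
  assumes U: "universal_prefix_tm U"
    and sim_out: "\<And>x y. tm_output U x y \<Longrightarrow> \<exists>t. sim (num x) t = Suc (num y)"
    and deg: "degree P \<le> d" and a: "2 * d + 3 \<le> a"
  shows "\<exists>n1. \<forall>n\<ge>n1. 2 ^ ((a - 1) * n) \<le> card (low_columns U P a n) \<longrightarrow>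
           (\<exists>b t. popular n b t \<and> \<bar>2 ^ ((a - 2 * d - 3) * n) * \<bar>poly P 0\<bar> - real b\<bar> \<le> 3)"
proof -
  obtain Lp where Lp: "Lp \<ge> 0" "\<And>x u. x \<in> {0..3} \<Longrightarrow> u \<in> {0..3} \<Longrightarrow> \<bar>poly P x - poly P u\<bar> \<le> Lp * \<bar>x - u\<bar>"
    using poly_Lipschitz[of P] by blast
  define K0 where "K0 = real (Suc d) * (1 + Lp) * 3 ^ Suc d"
  obtain m1 where m1: "real (6 * Suc d) + K0 < 2 ^ m1" using real_arch_pow[of 2] by auto
  have K0: "K0 \<ge> 0" using Lp(1) by (simp add: K0_def)
  have "\<exists>b t. popular n b t \<and> \<bar>2 ^ ((a - 2 * d - 3) * n) * \<bar>poly P 0\<bar> - real b\<bar> \<le> 3"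
    if n: "n \<ge> m1 + 3" and J: "2 ^ ((a - 1) * n) \<le> card (low_columns U P a n)" for n
  proof -
    define r where "r = a * n"
    define s where "s = (a - 2 * d - 3) * n"
    define M :: nat where "M = 2 ^ ((a - 2) * n)"
    have "(2::real) ^ m1 \<le> 2 ^ n" using n by (intro power_increasing) auto
    then have big: "real (6 * Suc d) \<le> 2 ^ n" "K0 \<le> 2 ^ n" using m1 K0 by linarith+
    have six: "6 * Suc d \<le> 2 ^ n" using big(1) by (metis of_nat_le_iff of_nat_numeral of_nat_power)
    have half: "2 ^ n = 2 * (2::nat) ^ (n - 1)" using n by (metis Suc_pred' add_gr_0 less_le_trans power_Suc zero_less_numeral)
    have re: "r = s + 2 * n * Suc d + n"
    proof -
      obtain a' where "a = 2 * d + 3 + a'" using a le_Suc_ex by blast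
      then show ?thesis by (simp add: r_def s_def algebra_simps)
    qed
    define G where "G = {q :: rat ^ 2. kolmogorov U q \<le> (a + 1) * n \<and>
         (\<exists>x\<in>{1..2}. real_vec q \<in> ball (vector [x, poly P x]) (1 / 2 ^ r))}"
    define fl where "fl q = \<lfloor>2 ^ r * (of_rat (q $ 1) :: real)\<rfloor>" for q :: "rat ^ 2"
    have col: "low_columns U P a n = fl ` G" by (simp add: low_columns_def G_def fl_def r_def)
    have "finite G" by (rule finite_subset[OF _ card_low_complexity(1)[OF U]]) (auto simp: G_def)
    obtain Q where Q: "Q \<subseteq> G" "inj_on fl Q" "fl ` Q = fl ` G"
      using subset_image_inj[of "fl ` G" fl G] by auto
    have finQ: "finite Q" using Q(1) \<open>finite G\<close> by (rule finite_subset)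
    have cardQ: "2 ^ n * M \<le> card Q"
    proof -
      have "card Q = card (low_columns U P a n)" using card_image[OF Q(2)] Q(3) col by simp
      moreover have "(a - 1) * n = n + (a - 2) * n"
      proof -
        obtain a' where "a = 2 + a'" using a le_Suc_ex[of 2 a] by auto
        then show ?thesis by (simp add: algebra_simps)
      qed
      ultimately show ?thesis using J by (simp add: M_def power_add)
    qed
    \<comment> \<open>Phrased over the rationals exactly as in \<open>votes\<close>.\<close>
    define near where "near q q' \<longleftrightarrow> \<not> 1 \<le> of_nat (2 ^ (2 * n)) * \<bar>q $ 1 - q' $ 1\<bar>" for q q' :: "rat ^ 2"
    have near_sym: "near q q' \<Longrightarrow> near q' q" for q q' by (simp add: near_def abs_minus_commute)
    have real_near: "near q q' \<longleftrightarrow> 2 ^ (2 * n) * \<bar>of_rat (q $ 1) - of_rat (q' $ 1)\<bar> < (1::real)" for q q'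
    proof -
      have "near q q' \<longleftrightarrow> (of_rat (of_nat (2 ^ (2 * n)) * \<bar>q $ 1 - q' $ 1\<bar>) :: real) < of_rat 1"
        by (simp only: near_def not_le of_rat_less)
      then show ?thesis by (simp add: of_rat_mult of_rat_diff of_rat_power abs_of_rat[symmetric] del: abs_of_rat)
    qed
    have crowd: "card {q'\<in>Q. near q' q} \<le> 3 * M" if "q \<in> Q" for q
    proof -
      have "fl ` {q'\<in>Q. near q' q} \<subseteq> {fl q - int M..fl q + int M}"
      proof (rule image_subsetI)
        fix q' assume "q' \<in> {q'\<in>Q. near q' q}"
        then have "2 ^ (2 * n) * \<bar>of_rat (q' $ 1) - of_rat (q $ 1)\<bar> < (1::real)" using real_near by simp
        then have "real M * (2 ^ (2 * n) * \<bar>of_rat (q' $ 1) - of_rat (q $ 1)\<bar>) < real M * 1"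
          by (intro mult_strict_left_mono) (auto simp: M_def)
        moreover have "real M * 2 ^ (2 * n) = 2 ^ r"
        proof -
          obtain a' where "a = 2 + a'" using a le_Suc_ex[of 2 a] by auto
          then have "(a - 2) * n + 2 * n = r" by (simp add: r_def algebra_simps)
          then show ?thesis by (simp add: M_def flip: power_add)
        qed
        ultimately have "2 ^ r * \<bar>of_rat (q' $ 1) - of_rat (q $ 1)\<bar> < real M" by (simp only: mult.assoc[symmetric] mult_1_right)
        then have "\<bar>2 ^ r * of_rat (q' $ 1) - 2 ^ r * of_rat (q $ 1)\<bar> < real M"
          by (simp add: abs_mult flip: right_diff_distrib)
        then have "\<bar>fl q' - fl q\<bar> \<le> int M" unfolding fl_def by linarith
        then show "fl q' \<in> {fl q - int M..fl q + int M}" by (simp add: abs_le_iff)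
      qed
      moreover have "inj_on fl {q'\<in>Q. near q' q}" by (rule inj_on_subset[OF Q(2)]) auto
      ultimately have "card {q'\<in>Q. near q' q} \<le> card {fl q - int M..fl q + int M}"
        by (intro card_inj_on_le) auto
      also have "\<dots> = 2 * M + 1" by simp
      also have "\<dots> \<le> 3 * M" by (simp add: M_def)
      finally show ?thesis .
    qed
    define S where "S = {xs. length xs = Suc d \<and> set xs \<subseteq> Q \<and> separated near xs}"
    have finS: "finite S"
      by (rule finite_subset[OF _ finite_lists_length_eq[OF finQ, of "Suc d"]]) (auto simp: S_def)
    have "(card Q - Suc d * (3 * M)) ^ Suc d \<le> card S"
      unfolding S_def by (rule card_separated[OF finQ crowd])
    moreover have "2 ^ (n - 1) * M \<le> card Q - Suc d * (3 * M)"
    proof -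
      have "2 * (Suc d * (3 * M)) \<le> 2 * (2 ^ (n - 1) * M)"
        using mult_le_mono1[OF six, of M] half by (simp add: algebra_simps)
      moreover have "2 * (2 ^ (n - 1) * M) \<le> card Q" using cardQ half by simp
      ultimately show ?thesis by linarith
    qed
    then have "(2 ^ (n - 1) * M) ^ Suc d \<le> (card Q - Suc d * (3 * M)) ^ Suc d" by (rule power_mono) simp
    ultimately have "(2 ^ (n - 1) * M) ^ Suc d \<le> card S" by (rule order_trans[rotated])
    moreover have "3 * M ^ Suc d \<le> (2 ^ (n - 1) * M) ^ Suc d"
    proof -
      have "(2::nat) ^ 2 \<le> 2 ^ (n - 1)" using n by (intro power_increasing) auto
      then have "(3::nat) \<le> 2 ^ (n - 1)" by simp
      also have "\<dots> \<le> (2 ^ (n - 1)) ^ Suc d" by simp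
      finally have "3 * M ^ Suc d \<le> (2 ^ (n - 1)) ^ Suc d * M ^ Suc d" by (rule mult_le_mono1)
      then show ?thesis by (simp only: power_mult_distrib)
    qed
    ultimately have cardS: "3 * M ^ Suc d \<le> card S" by (rule order_trans[rotated])
    then have "card S > 0" by (metis M_def less_le_trans mult_pos_pos zero_less_numeral zero_less_power)
    then have neS: "S \<noteq> {}" by auto
    define w where "w xs = tup (map vec_num xs)" for xs :: "(rat ^ 2) list"
    have wi: "comp_at i (w xs) = vec_num (xs ! i)" if "xs \<in> S" "i \<le> d" for xs i
      using that by (simp add: w_def comp_at_tup S_def)
    have coord: "first_coord (vec_num q) = q $ 1" "second_coord (vec_num q) = q $ 2" for q
      by (simp_all add: first_coord_def second_coord_def vec_num_def rat_val_rat_num)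
    define lag where "lag xs = lagrange0 d (\<lambda>i. first_coord (comp_at i (w xs))) (\<lambda>i. second_coord (comp_at i (w xs)))" for xs
    have lam: "lag xs = lagrange0 d (\<lambda>i. xs ! i $ 1) (\<lambda>i. xs ! i $ 2)" if "xs \<in> S" for xs
      unfolding lag_def using that by (intro lagrange0_cong) (simp_all add: wi coord)
    define \<beta>0 where "\<beta>0 = 2 ^ s * \<bar>poly P 0\<bar>"
    define \<beta> where "\<beta> xs = of_nat (2 ^ s) * \<bar>lag xs\<bar>" for xs
    have SQ: "xs ! i \<in> Q" if "xs \<in> S" "i \<le> d" for xs i
    proof -
      have "i < length xs" "set xs \<subseteq> Q" using that by (auto simp: S_def)
      then show ?thesis using nth_mem by blast
    qed
    have err: "\<bar>of_rat (\<beta> xs) - \<beta>0\<bar> \<le> 1" if xs: "xs \<in> S" for xs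
    proof -
      define u v where "u i = (of_rat (xs ! i $ 1) :: real)" and "v i = (of_rat (xs ! i $ 2) :: real)" for i
      have xsi: "xs ! i \<in> G" if "i \<le> d" for i
        using SQ[OF xs that] Q(1) by blast
      have pt: "u i \<in> {0..3} \<and> \<bar>v i - poly P (u i)\<bar> \<le> (1 + Lp) / 2 ^ r" if i: "i \<le> d" for i
      proof -
        obtain x where x: "x \<in> {1..2}" and bl: "real_vec (xs ! i) \<in> ball (vector [x, poly P x]) (1 / 2 ^ r)"
          using xsi[OF i] by (auto simp: G_def)
        have ux: "\<bar>u i - x\<bar> < 1 / 2 ^ r" "\<bar>v i - poly P x\<bar> < 1 / 2 ^ r"
          using ball_component[OF bl, of 1] ball_component[OF bl, of 2] by (simp_all add: u_def v_def)
        have "1 / 2 ^ r \<le> (1::real)" by simp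
        then have "\<bar>u i - x\<bar> < 1" using ux(1) by linarith
        then have u3: "u i \<in> {0..3}" using x by (auto simp: abs_less_iff)
        have "\<bar>poly P x - poly P (u i)\<bar> \<le> Lp * \<bar>x - u i\<bar>" using x u3 by (intro Lp(2)) auto
        also have "\<dots> \<le> Lp * (1 / 2 ^ r)" using ux(1) Lp(1) by (intro mult_left_mono) (auto simp: abs_minus_commute)
        finally have "\<bar>v i - poly P (u i)\<bar> \<le> 1 / 2 ^ r + Lp * (1 / 2 ^ r)" using ux(2) by linarith
        then show ?thesis using u3 by (simp add: add_divide_distrib)
      qed
      have sp: "1 \<le> 2 ^ (2 * n) * \<bar>u i - u j\<bar>" if "i \<le> d" "j \<le> d" "i \<noteq> j" for i j
      proof -
        have "\<not> near (xs ! i) (xs ! j)"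
          by (rule separated_nth) (use xs that near_sym in \<open>auto simp: S_def\<close>)
        then show ?thesis using real_near[of "xs ! i" "xs ! j"] by (simp add: u_def v_def)
      qed
      have "\<bar>lagrange0 d u v - poly P 0\<bar> \<le> real (Suc d) * ((1 + Lp) / 2 ^ r) * (3 * 2 ^ (2 * n)) ^ Suc d"
        by (rule lagrange0_error[OF deg]) (use pt sp in auto)
      also have "\<dots> = K0 * (2 ^ (2 * n * Suc d) / 2 ^ r)"
        unfolding K0_def power_mult_distrib power_mult[of "2 :: real" "2 * n" "Suc d"]
        by (simp only: times_divide_eq_left times_divide_eq_right mult_ac)
      finally have "2 ^ s * \<bar>lagrange0 d u v - poly P 0\<bar> \<le> 2 ^ s * (K0 * (2 ^ (2 * n * Suc d) / 2 ^ r))"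
        by (intro mult_left_mono) auto
      also have "\<dots> = K0 * (2 ^ s * 2 ^ (2 * n * Suc d) / 2 ^ r)" by simp
      also have "\<dots> = K0 / 2 ^ n" unfolding re power_add by simp
      also have "\<dots> \<le> 1" using big(2) by simp
      finally have e1: "2 ^ s * \<bar>lagrange0 d u v - poly P 0\<bar> \<le> 1" .
      have uv: "(\<lambda>i. of_rat (xs ! i $ 1)) = u" "(\<lambda>i. of_rat (xs ! i $ 2)) = v"
        by (simp_all add: u_def v_def fun_eq_iff)
      have "of_rat (\<beta> xs) = 2 ^ s * \<bar>lagrange0 d u v\<bar>"
        by (simp add: \<beta>_def of_rat_mult of_rat_power abs_of_rat[symmetric] lam[OF xs] of_rat_lagrange0 uv del: abs_of_rat)
      then have "of_rat (\<beta> xs) - \<beta>0 = 2 ^ s * (\<bar>lagrange0 d u v\<bar> - \<bar>poly P 0\<bar>)"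
        by (simp add: \<beta>0_def right_diff_distrib)
      then have "\<bar>of_rat (\<beta> xs) - \<beta>0\<bar> = 2 ^ s * \<bar>\<bar>lagrange0 d u v\<bar> - \<bar>poly P 0\<bar>\<bar>"
        by (simp add: abs_mult)
      also have "\<dots> \<le> 2 ^ s * \<bar>lagrange0 d u v - poly P 0\<bar>" by (intro mult_left_mono abs_triangle_ineq3) simp
      finally show ?thesis using e1 by linarith
    qed
    define b where "b xs = nat \<lfloor>\<beta> xs\<rfloor>" for xs
    have b0: "\<beta> xs \<ge> 0" for xs by (simp add: \<beta>_def)
    have bfl: "of_nat (b xs) \<le> \<beta> xs \<and> \<beta> xs < of_nat (Suc (b xs))" for xs
    proof -
      have "int (b xs) = \<lfloor>\<beta> xs\<rfloor>" using b0 by (simp add: b_def)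
      then have "of_nat (b xs) = (of_int \<lfloor>\<beta> xs\<rfloor> :: rat)" by (metis of_int_of_nat_eq)
      then show ?thesis using floor_correct[of "\<beta> xs"] by simp
    qed
    have breal: "real (b xs) \<le> of_rat (\<beta> xs) \<and> of_rat (\<beta> xs) < real (b xs) + 1" for xs
    proof -
      have "of_rat (of_nat (b xs)) \<le> (of_rat (\<beta> xs) :: real)" "of_rat (\<beta> xs) < (of_rat (of_nat (Suc (b xs))) :: real)"
        using bfl[of xs] by (simp_all only: of_rat_less_eq of_rat_less)
      then show ?thesis by (simp add: of_rat_add)
    qed
    \<comment> \<open>The scaled values \<open>\<beta> xs\<close> are within 1 of \<open>\<beta>0\<close>, hence so are their integer parts.\<close>
    have "b ` S \<subseteq> nat ` {\<lfloor>\<beta>0\<rfloor> - 1..\<lfloor>\<beta>0\<rfloor> + 1}"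
    proof (rule image_subsetI)
      fix xs assume "xs \<in> S"
      then have "int (b xs) \<in> {\<lfloor>\<beta>0\<rfloor> - 1..\<lfloor>\<beta>0\<rfloor> + 1}"
        using err[of xs] breal[of xs] unfolding atLeastAtMost_iff by linarith
      then have "nat (int (b xs)) \<in> nat ` {\<lfloor>\<beta>0\<rfloor> - 1..\<lfloor>\<beta>0\<rfloor> + 1}" by (rule imageI)
      then show "b xs \<in> nat ` {\<lfloor>\<beta>0\<rfloor> - 1..\<lfloor>\<beta>0\<rfloor> + 1}" by simp
    qed
    then have "card (b ` S) \<le> card (nat ` {\<lfloor>\<beta>0\<rfloor> - 1..\<lfloor>\<beta>0\<rfloor> + 1})" by (intro card_mono) auto
    also have "\<dots> \<le> card {\<lfloor>\<beta>0\<rfloor> - 1..\<lfloor>\<beta>0\<rfloor> + 1}" by (rule card_image_le) simp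
    also have "\<dots> = 3" by simp
    finally have "card (b ` S) \<le> 3" .
    from pigeonhole_fiber[OF finS neS this] obtain y where y: "y \<in> b ` S" "card S \<le> 3 * card {xs\<in>S. b xs = y}"
      by blast
    have "\<exists>T. \<forall>q\<in>Q. low n (vec_num q) T"
    proof (rule uniform_time[OF finQ])
      fix q assume "q \<in> Q"
      then have "kolmogorov U q \<le> (a + 1) * n" using Q(1) by (auto simp: G_def)
      from low_complexity_program[OF U this] obtain \<pi> where
        \<pi>: "tm_output U \<pi> (pair_bits (vec_num q))" "num \<pi> < 2 ^ ((a + 1) * n + 1)" by blast
      obtain t where "sim (num \<pi>) t = Suc (num (pair_bits (vec_num q)))" using sim_out[OF \<pi>(1)] by blast
      then have "low n (vec_num q) t" unfolding low_def using \<pi>(2) vec_num_sign by blast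
      then show "\<exists>t. low n (vec_num q) t" by blast
    qed (rule low_mono)
    then obtain T1 where T1: "\<And>q. q \<in> Q \<Longrightarrow> low n (vec_num q) T1" by blast
    define T where "T = T1 + (\<Sum>xs\<in>S. Suc (w xs))"
    have wT: "w xs < T" if "xs \<in> S" for xs
    proof -
      have "Suc (w xs) \<le> (\<Sum>xs\<in>S. Suc (w xs))" by (rule member_le_sum[OF that _ finS]) simp
      then show ?thesis by (simp add: T_def)
    qed
    have vote: "votes n (b xs) (w xs) T" if xs: "xs \<in> S" for xs
    proof -
      have lo: "low n (comp_at i (w xs)) T" if "i \<le> d" for i
        using low_mono[OF T1[OF SQ[OF xs that]], of T] by (simp add: wi[OF xs that] T_def)
      have sep: "i = j \<or> 1 \<le> of_nat (2 ^ (2 * n)) * \<bar>first_coord (comp_at i (w xs)) - first_coord (comp_at j (w xs))\<bar>"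
        if "i \<le> d" "j \<le> d" for i j
      proof (cases "i = j")
        case False
        have "\<not> near (xs ! i) (xs ! j)"
          by (rule separated_nth) (use xs that near_sym False in \<open>auto simp: S_def\<close>)
        then show ?thesis by (simp add: near_def wi[OF xs] that coord)
      qed simp
      have le: "i \<le> d" if "i \<in> set [0..<Suc d]" for i using that by auto
      show ?thesis unfolding votes_def
      proof (intro conjI ballI)
        show "low n (comp_at i (w xs)) T" if "i \<in> set [0..<Suc d]" for i using lo le that by blast
        show "(psnd ^^ Suc d) (w xs) = 0"
          using tail_tup[of "map vec_num xs"] xs by (simp add: w_def S_def del: funpow.simps)
        show "i = j \<or> 1 \<le> of_nat (2 ^ (2 * n)) * \<bar>first_coord (comp_at i (w xs)) - first_coord (comp_at j (w xs))\<bar>"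
          if "i \<in> set [0..<Suc d]" "j \<in> set [0..<Suc d]" for i j
          by (rule sep[OF le[OF that(1)] le[OF that(2)]])
      qed (use bfl[of xs] in \<open>simp_all only: \<beta>_def lag_def s_def\<close>)
    qed
    have "M ^ Suc d \<le> card {xs\<in>S. b xs = y}" using cardS y(2) by linarith
    also have "\<dots> \<le> card {x. x < T \<and> votes n y x T}"
    proof (rule card_inj_on_le)
      show "inj_on w {xs\<in>S. b xs = y}"
      proof (rule inj_onI)
        fix xs ys assume "xs \<in> {xs\<in>S. b xs = y}" "ys \<in> {xs\<in>S. b xs = y}" and eq: "w xs = w ys"
        then have len: "length (map vec_num xs) = length (map vec_num ys)" by (simp add: S_def)
        have "map vec_num xs = map vec_num ys" using tup_inj[OF len] eq by (simp add: w_def)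
        moreover have "inj vec_num" by (rule injI) (rule vec_num_inj)
        ultimately show "xs = ys" by (simp add: inj_map_eq_map)
      qed
      show "w ` {xs\<in>S. b xs = y} \<subseteq> {x. x < T \<and> votes n y x T}" using wT vote by blast
    qed simp
    finally have "popular n y T"
      unfolding popular_def M_def by (simp only: power_mult)
    moreover obtain xs where xs: "xs \<in> S" "y = b xs" using y(1) by blast
    moreover have "\<bar>\<beta>0 - real (b xs)\<bar> \<le> 3" using err[OF xs(1)] breal[of xs] by linarith
    ultimately show ?thesis unfolding \<beta>0_def s_def by blast
  qed
  then show ?thesis by blast
qed

section \<open>Comparing two points of the graph\<close>

text \<open>
  A popular value is described by \<open>n\<close>, its rank and the number of popular values. All three have
  at most \<open>L = 4 * n * (d + 1)\<close> bits, and \<open>k\<close> is the least number such that \<open>k\<^sup>2\<close> bits hold them. The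
  resulting length, about \<open>64 * n * (d + 1)\<close>, is less than half of the precision
  \<open>(a - 2 * d - 3) * n\<close>.
\<close>

lemma (in low_points) many_columns_dimension_le:
  fixes P :: "real poly"
  assumes U: "universal_prefix_tm U"
    and sim_out: "\<And>x y. tm_output U x y \<Longrightarrow> \<exists>t. sim (num x) t = Suc (num y)"
    and deg: "degree P \<le> d" and a: "a = 200 * Suc d"
    and many: "\<And>N. \<exists>n\<ge>N. 2 ^ ((a - 1) * n) \<le> card (low_columns U P a n)"
  shows "eff_dim U (vector [0, poly P 0] :: real ^ 2) \<le> ereal (1/2)"
proof (rule eff_dim_le)
  fix N
  let ?y = "poly P 0"
  let ?sg = "of_bool (?y < 0) :: nat"
  obtain n1 where n1: "\<And>n. n \<ge> n1 \<Longrightarrow> 2 ^ ((a - 1) * n) \<le> card (low_columns U P a n) \<Longrightarrow>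
           (\<exists>b t. popular n b t \<and> \<bar>2 ^ ((a - 2 * d - 3) * n) * \<bar>?y\<bar> - real b\<bar> \<le> 3)"
    using popular_near[OF U sim_out deg] a by auto
  have h: "prim_rec (\<lambda>z. num (pair_bits (dyadic_code ?sg ((a - 2 * d - 3) * pfst z) (psnd z))))"
    by (intro pr_intros pr_dyadic_code)
  have "\<exists>C. \<forall>n L k b t w. n < 2 ^ L \<longrightarrow> finite {b. \<exists>t. popular n b t} \<longrightarrow>
           card {b. \<exists>t. popular n b t} < 2 ^ L \<longrightarrow> popular n b t \<longrightarrow>
           num (pair_bits (dyadic_code ?sg ((a - 2 * d - 3) * n) b)) = num w \<longrightarrow> 4 * L + 6 \<le> k\<^sup>2 \<longrightarrow>
           (\<exists>\<pi>. tm_output U \<pi> w \<and> length \<pi> \<le> k\<^sup>2 + k + C)"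
    by (rule enumeration_program[OF U prp_popular h]) (rule popular_mono)
  then obtain C where C: "\<forall>n L k b t w. n < 2 ^ L \<longrightarrow> finite {b. \<exists>t. popular n b t} \<longrightarrow>
           card {b. \<exists>t. popular n b t} < 2 ^ L \<longrightarrow> popular n b t \<longrightarrow>
           num (pair_bits (dyadic_code ?sg ((a - 2 * d - 3) * n) b)) = num w \<longrightarrow> 4 * L + 6 \<le> k\<^sup>2 \<longrightarrow>
           (\<exists>\<pi>. tm_output U \<pi> w \<and> length \<pi> \<le> k\<^sup>2 + k + C)" by blast
  obtain n where n: "n \<ge> n1 + N + C + 40" and J: "2 ^ ((a - 1) * n) \<le> card (low_columns U P a n)"
    using many by blast
  obtain b t where pop: "popular n b t" and b3: "\<bar>2 ^ ((a - 2 * d - 3) * n) * \<bar>?y\<bar> - real b\<bar> \<le> 3"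
    using n1[OF _ J] n by auto
  define s where "s = (a - 2 * d - 3) * n"
  define L where "L = 4 * n * Suc d"
  have a2: "a \<ge> 2" using a by simp
  have "195 * Suc d * n \<le> s" unfolding s_def a by (intro mult_le_mono1) simp
  then have s: "195 * (Suc d * n) \<le> s" by (simp only: mult.assoc)
  have dn: "n \<le> Suc d * n" by simp
  have s2: "s \<ge> 2" "s - 2 \<ge> N" "s - 2 > 0" using s dn n by linarith+
  have "n \<le> L" by (simp add: L_def)
  then have "(2::nat) ^ n \<le> 2 ^ L" by (intro power_increasing) auto
  then have nL: "n < 2 ^ L" using less_exp[of n] by linarith
  have "(3 * n + 1) * Suc d < L" unfolding L_def using n by (intro mult_strict_right_mono) auto
  then have "(2::nat) ^ ((3 * n + 1) * Suc d) < 2 ^ L" by (intro power_strict_increasing) auto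
  then have cL: "card {b. \<exists>t. popular n b t} < 2 ^ L" using card_popular(2)[OF a2, of n] by linarith
  have "\<exists>k. 4 * L + 6 \<le> k\<^sup>2" by (intro exI[of _ "4 * L + 6"]) (simp add: power2_eq_square)
  define k where "k = (LEAST k. 4 * L + 6 \<le> k\<^sup>2)"
  have k: "4 * L + 6 \<le> k\<^sup>2" unfolding k_def by (rule LeastI_ex) fact
  then have "k \<noteq> 0" by (intro notI) simp
  then obtain k' where k': "k = Suc k'" by (cases k) auto
  have "\<not> 4 * L + 6 \<le> k'\<^sup>2" using not_less_Least[of k' "\<lambda>k. 4 * L + 6 \<le> k\<^sup>2"] k' by (simp add: k_def)
  moreover have "k' \<le> k'\<^sup>2" by (simp add: power2_eq_square)
  moreover have "k\<^sup>2 + k = k'\<^sup>2 + 3 * k' + 2" by (simp add: k' power2_eq_square)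
  ultimately have kb: "k\<^sup>2 + k \<le> 16 * L + 24" by linarith
  obtain w where w: "num w = num (pair_bits (dyadic_code ?sg s b))" by blast
  obtain \<pi> where \<pi>: "tm_output U \<pi> w" "length \<pi> \<le> k\<^sup>2 + k + C"
    using C[rule_format, OF nL card_popular(1)[OF a2] cL pop w[unfolded s_def, symmetric] k] by blast
  have "kolmogorov_at U (s - 2) (vector [0, ?y] :: real ^ 2) \<le> k\<^sup>2 + k + C"
    using kolmogorov_at_dyadic[OF \<pi>(1) w b3[folded s_def] s2(1)] \<pi>(2) by simp
  also have "\<dots> \<le> 16 * L + 24 + C" using kb by simp
  also have "16 * L = 64 * (Suc d * n)" by (simp add: L_def)
  finally have "2 * kolmogorov_at U (s - 2) (vector [0, ?y] :: real ^ 2) \<le> 128 * (Suc d * n) + 48 + 2 * C" by simp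
  also have "\<dots> \<le> s - 2" using s dn n by linarith
  finally have "real (2 * kolmogorov_at U (s - 2) (vector [0, ?y] :: real ^ 2)) \<le> real (s - 2)" by (simp only: of_nat_le_iff)
  then have "real (kolmogorov_at U (s - 2) (vector [0, ?y] :: real ^ 2)) \<le> 1/2 * real (s - 2)" by simp
  then show "\<exists>r\<ge>N. r > 0 \<and> real (kolmogorov_at U r (vector [0, ?y] :: real ^ 2)) \<le> 1/2 * real r"
    using s2 by blast
qed

text \<open>
  If \<open>x\<close> is further than two column widths from the left ends of all low columns, for all large
  \<open>n\<close>, then its point on the graph has complexity above \<open>(a + 1) * n\<close> at precision \<open>a * n\<close>.
\<close>

lemma few_columns_dimension_ge:
  assumes U: "universal_prefix_tm U" and a: "a \<ge> 1"
    and few: "\<And>n. n \<ge> n0 \<Longrightarrow> card (low_columns U P a n) < 2 ^ ((a - 1) * n)"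
  shows "\<exists>x. eff_dim U (vector [x, poly P x] :: real ^ 2) \<ge> ereal ((real (a + 1) - 1/2) / real a)"
proof -
  define F where "F n = (\<lambda>j. of_int j / 2 ^ (a * n) :: real) ` low_columns U P a n" for n
  define N where "N = max n0 4"
  have fin: "finite (low_columns U P a n)" for n
    unfolding low_columns_def
    by (intro finite_imageI finite_subset[OF _ card_low_complexity(1)[OF U, of "(a + 1) * n"]]) auto
  have small: "real (card (F n)) * (2 / 2 ^ (a * n)) \<le> 2 / 2 ^ n" if "n \<ge> N" for n
  proof -
    have "card (F n) \<le> card (low_columns U P a n)" unfolding F_def by (rule card_image_le[OF fin])
    also have "\<dots> \<le> 2 ^ ((a - 1) * n)" using few[of n] that by (simp add: N_def)
    finally have "real (card (F n)) \<le> real (2 ^ ((a - 1) * n))" by (simp only: of_nat_le_iff)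
    then have "real (card (F n)) * (2 / 2 ^ (a * n)) \<le> 2 ^ ((a - 1) * n) * (2 / 2 ^ (a * n))"
      by (intro mult_right_mono) auto
    also have "\<dots> = 2 / 2 ^ n"
    proof -
      obtain a' where "a = Suc a'" using a by (cases a) auto
      then have "(2::real) ^ (a * n) = 2 ^ ((a - 1) * n) * 2 ^ n" by (simp add: power_add)
      then show ?thesis by (simp add: field_simps)
    qed
    finally show ?thesis .
  qed
  have "\<exists>x\<in>{1..2}. \<forall>n\<ge>N. \<forall>u\<in>F n. \<bar>x - u\<bar> > 2 / 2 ^ (a * n)"
    by (rule avoid_neighbourhoods) (use fin small in \<open>auto simp: F_def N_def\<close>)
  then obtain x where x: "x \<in> {1..2}" "\<And>n u. n \<ge> N \<Longrightarrow> u \<in> F n \<Longrightarrow> \<bar>x - u\<bar> > 2 / 2 ^ (a * n)" by blast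
  let ?z = "vector [x, poly P x] :: real ^ 2"
  have "(a + 1) * n < kolmogorov_at U (a * n) ?z" if n: "n \<ge> N" for n
  proof (rule ccontr)
    assume *: "\<not> (a + 1) * n < kolmogorov_at U (a * n) ?z"
    obtain q where q: "real_vec q \<in> ball ?z (1 / 2 ^ (a * n))" "kolmogorov_at U (a * n) ?z = kolmogorov U q"
      using kolmogorov_at_attained by blast
    let ?u = "of_rat (q $ 1) :: real"
    let ?j = "\<lfloor>2 ^ (a * n) * ?u\<rfloor>"
    have "kolmogorov U q \<le> (a + 1) * n" using * q(2) by simp
    then have "?j \<in> low_columns U P a n" unfolding low_columns_def using q(1) x(1) by blast
    then have "of_int ?j / 2 ^ (a * n) \<in> F n" unfolding F_def by (rule imageI)
    from x(2)[OF n this] have "\<bar>x - of_int ?j / 2 ^ (a * n)\<bar> > 2 / 2 ^ (a * n)" .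
    moreover have "\<bar>?u - x\<bar> < 1 / 2 ^ (a * n)" using ball_component[OF q(1), of 1] by simp
    moreover have "\<bar>?u - of_int ?j / 2 ^ (a * n)\<bar> \<le> 1 / 2 ^ (a * n)"
    proof -
      have "?u - of_int ?j / 2 ^ (a * n) = (2 ^ (a * n) * ?u - of_int ?j) / 2 ^ (a * n)"
        by (simp add: diff_divide_distrib)
      moreover have "\<bar>2 ^ (a * n) * ?u - of_int ?j\<bar> \<le> 1" by linarith
      ultimately show ?thesis by (simp add: abs_divide divide_right_mono)
    qed
    moreover have "2 / 2 ^ (a * n) = 1 / 2 ^ (a * n) + 1 / (2::real) ^ (a * n)" by simp
    ultimately show False by linarith
  qed
  then have "eff_dim U ?z \<ge> ereal ((real (a + 1) - 1/2) / real a)"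
    using a by (intro eff_dim_ge) auto
  then show ?thesis by blast
qed

theorem mainTheorem3:
  fixes U :: turing_machine and P :: "real poly"
  assumes "universal_prefix_tm U"
  shows "\<exists>d\<^sub>1 \<in> dim_spectrum U (poly_graph P).
         \<exists>d\<^sub>2 \<in> dim_spectrum U (poly_graph P). d\<^sub>1 \<noteq> d\<^sub>2"
proof -
  let ?z = "\<lambda>x. vector [x, poly P x] :: real ^ 2"
  have in_spectrum: "eff_dim U (?z x) \<in> dim_spectrum U (poly_graph P)" for x
    unfolding dim_spectrum_def poly_graph_def by blast
  have "\<exists>x. eff_dim U (?z 0) < eff_dim U (?z x)"
  proof -
    \<comment> \<open>The factor 200 makes the precision \<open>(a - 2 * d - 3) * n\<close> of the popular values more than twice
      the length \<open>64 * n * (d + 1)\<close> of their descriptions.\<close>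
    define d a where "d = degree P" and "a = 200 * Suc d"
    have "wf_tm U" using assms by (simp add: universal_prefix_tm_def prefix_tm_def)
    then interpret tm_sim U by unfold_locales
    interpret low_points d a sim
      by unfold_locales (rule pr_sim, rule sim_stable)
    show ?thesis
    proof (cases "\<exists>n0. \<forall>n\<ge>n0. card (low_columns U P a n) < 2 ^ ((a - 1) * n)")
      case True
      then obtain n0 where n0: "\<And>n. n \<ge> n0 \<Longrightarrow> card (low_columns U P a n) < 2 ^ ((a - 1) * n)" by blast
      obtain x where x: "eff_dim U (?z x) \<ge> ereal ((real (a + 1) - 1/2) / real a)"
        using few_columns_dimension_ge[OF assms _ n0] by (auto simp: a_def)
      have "eff_dim U (?z 0) \<le> ereal (1 + 1 / (4 * real a))"
        by (rule dimension_above_zero_le[OF assms]) (simp add: a_def)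
      also have "\<dots> < ereal ((real (a + 1) - 1/2) / real a)"
        by (simp add: a_def field_simps)
      finally show ?thesis using x by (meson less_le_trans)
    next
      case False
      then have "\<exists>n\<ge>N. 2 ^ ((a - 1) * n) \<le> card (low_columns U P a n)" for N
        by (meson not_less)
      then have "eff_dim U (?z 0) \<le> ereal (1/2)"
        using many_columns_dimension_le[OF assms sim_output _ a_def] by (simp add: d_def)
      also have "ereal (1/2) < ereal (5/8)" by simp
      finally have "eff_dim U (?z 0) < ereal (5/8)" .
      moreover obtain x where "eff_dim U (?z x) \<ge> ereal (5/8)"
        using generic_dimension[OF assms, of "poly P"] by blast
      ultimately show ?thesis by (meson less_le_trans)
    qed
  qed
  then show ?thesis using in_spectrum by (metis less_irrefl)
qed

end
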